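(* For every SR instance, a stable partition with minimum regret always exists and can be computed in linear time.
   Context: An SR (Stable Roommates) instance $I=(A,\succ)$ consists of an even number $n$ of agents, each with a strict complete preference ranking over the other agents (ranking itself last). A stable partition is a permutation $\Pi$ of $A$ such that (T1) every agent weakly prefers its successor to its predecessor, and (T2) no two distinct agents $a_i,a_j$ satisfy $a_j \succ_i \Pi^{-1}(a_i)$ and $a_i \succ_j \Pi^{-1}(a_j)$. An agent has rank $i$ for $a_j$ if it is $a_j$'s $i$th choice. The profile $p(\Pi)=(p_1\dots p_n)$ has $p_i$ equal to the number of agents whose successor in $\Pi$ has rank $i$ plus the number of agents whose predecessor in $\Pi$ has rank $i$. The regret $r(\Pi)$ is the index of the last positive entry of $p(\Pi)$, i.e., the worst rank of any successor or predecessor. A minimum-regret stable partition minimises $r(\Pi)$ over all stable partitions. Linear time means linear in the input size, $O(n^2)$. *)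

theory Defs
  imports Complex_Main "HOL-Combinatorics.Permutations" "HOL-Library.Landau_Symbols"
begin

section \<open>Stable Roommates instances and stable partitions\<close>

text \<open>
  \<^term>\<open>(x, y) \<in> P a\<close> means that agent \<^term>\<open>a\<close> strictly prefers \<^term>\<open>x\<close> to \<^term>\<open>y\<close>.
\<close>

definition sr_instance :: "'a set \<Rightarrow> ('a \<Rightarrow> 'a rel) \<Rightarrow> bool" where
  "sr_instance A P \<longleftrightarrow>
     finite A \<and> even (card A) \<and>
     (\<forall>a\<in>A. P a \<subseteq> A \<times> A \<and> strict_linear_order_on A (P a) \<and>
            (\<forall>x\<in>A - {a}. (x, a) \<in> P a))"

definition rank :: "'a set \<Rightarrow> ('a \<Rightarrow> 'a rel) \<Rightarrow> 'a \<Rightarrow> 'a \<Rightarrow> nat" where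
  "rank A P a x = card {y \<in> A. (y, x) \<in> P a} + 1"

definition stable_partition :: "'a set \<Rightarrow> ('a \<Rightarrow> 'a rel) \<Rightarrow> ('a \<Rightarrow> 'a) \<Rightarrow> bool" where
  "stable_partition A P \<pi> \<longleftrightarrow>
     \<pi> permutes A \<and>
     (\<forall>a\<in>A. \<pi> a = inv \<pi> a \<or> (\<pi> a, inv \<pi> a) \<in> P a) \<and>
     \<not> (\<exists>a\<in>A. \<exists>b\<in>A. a \<noteq> b \<and> (b, inv \<pi> a) \<in> P a \<and> (a, inv \<pi> b) \<in> P b)"

definition profile :: "'a set \<Rightarrow> ('a \<Rightarrow> 'a rel) \<Rightarrow> ('a \<Rightarrow> 'a) \<Rightarrow> nat \<Rightarrow> nat" where
  "profile A P \<pi> i =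
     card {a \<in> A. rank A P a (\<pi> a) = i} + card {a \<in> A. rank A P a (inv \<pi> a) = i}"

definition regret :: "'a set \<Rightarrow> ('a \<Rightarrow> 'a rel) \<Rightarrow> ('a \<Rightarrow> 'a) \<Rightarrow> nat" where
  "regret A P \<pi> = Max {i \<in> {1..card A}. profile A P \<pi> i > 0}"

definition min_regret_stable_partition ::
    "'a set \<Rightarrow> ('a \<Rightarrow> 'a rel) \<Rightarrow> ('a \<Rightarrow> 'a) \<Rightarrow> bool" where
  "min_regret_stable_partition A P \<pi> \<longleftrightarrow> is_arg_min (regret A P) (stable_partition A P) \<pi>"


section \<open>A word RAM\<close>

text \<open>
  Programs act on registers and on a random access memory whose entries are words of
  \<^term>\<open>w\<close> bits, i.e. natural numbers below \<^term>\<open>2 ^ w :: nat\<close>. Arithmetic is modulo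
  \<^term>\<open>2 ^ w :: nat\<close>, except for the subtraction, which is truncated at zero. The comparisons
  return 1 or 0, and a test succeeds if its value is nonzero. Every command and every node of
  an evaluated expression costs one time unit, as does every evaluation of a loop test.
\<close>

datatype expr =
    Const nat
  | Reg nat
  | Load expr
  | Add expr expr
  | Sub expr expr
  | Mul expr expr
  | Less expr expr
  | Equal expr expr

datatype prog =
    Skip
  | Assign nat expr
  | Store expr expr
  | Seq prog prog
  | If expr prog prog
  | While expr prog

text \<open>A state consists of the register contents and the memory contents.\<close>

type_synonym state = "(nat \<Rightarrow> nat) \<times> (nat \<Rightarrow> nat)"

primrec val :: "nat \<Rightarrow> state \<Rightarrow> expr \<Rightarrow> nat" where
  "val w s (Const k) = k mod 2 ^ w"
| "val w s (Reg r) = fst s r"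
| "val w s (Load e) = snd s (val w s e)"
| "val w s (Add e f) = (val w s e + val w s f) mod 2 ^ w"
| "val w s (Sub e f) = val w s e - val w s f"
| "val w s (Mul e f) = (val w s e * val w s f) mod 2 ^ w"
| "val w s (Less e f) = (if val w s e < val w s f then 1 else 0)"
| "val w s (Equal e f) = (if val w s e = val w s f then 1 else 0)"

primrec cost :: "expr \<Rightarrow> nat" where
  "cost (Const k) = 1"
| "cost (Reg r) = 1"
| "cost (Load e) = cost e + 1"
| "cost (Add e f) = cost e + cost f + 1"
| "cost (Sub e f) = cost e + cost f + 1"
| "cost (Mul e f) = cost e + cost f + 1"
| "cost (Less e f) = cost e + cost f + 1"
| "cost (Equal e f) = cost e + cost f + 1"

text \<open>
  \<^term>\<open>exec w c s t s'\<close>: with words of \<^term>\<open>w\<close> bits, the program \<^term>\<open>c\<close> started in the state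
  \<^term>\<open>s\<close> halts after exactly \<^term>\<open>t\<close> time units in the state \<^term>\<open>s'\<close>.
\<close>

inductive exec :: "nat \<Rightarrow> prog \<Rightarrow> state \<Rightarrow> nat \<Rightarrow> state \<Rightarrow> bool" for w :: nat where
  Skip: "exec w Skip s 1 s"
| Assign: "exec w (Assign r e) s (cost e + 1) ((fst s)(r := val w s e), snd s)"
| Store: "exec w (Store e f) s (cost e + cost f + 1) (fst s, (snd s)(val w s e := val w s f))"
| Seq: "exec w c s t s' \<Longrightarrow> exec w d s' t' s'' \<Longrightarrow> exec w (Seq c d) s (t + t' + 1) s''"
| If_True: "val w s e \<noteq> 0 \<Longrightarrow> exec w c s t s' \<Longrightarrow> exec w (If e c d) s (cost e + t + 1) s'"
| If_False: "val w s e = 0 \<Longrightarrow> exec w d s t s' \<Longrightarrow> exec w (If e c d) s (cost e + t + 1) s'"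
| While_False: "val w s e = 0 \<Longrightarrow> exec w (While e c) s (cost e + 1) s"
| While_True:
    "val w s e \<noteq> 0 \<Longrightarrow> exec w c s t s' \<Longrightarrow> exec w (While e c) s' t' s'' \<Longrightarrow>
     exec w (While e c) s (cost e + t + t' + 1) s''"

inductive_cases SkipE: "exec w Skip s t s'"
inductive_cases AssignE: "exec w (Assign r e) s t s'"
inductive_cases StoreE: "exec w (Store e f) s t s'"
inductive_cases SeqE: "exec w (Seq c d) s t s'"
inductive_cases IfE: "exec w (If e c d) s t s'"
inductive_cases WhileE: "exec w (While e c) s t s'"

text \<open>Final state and running time are determined by the initial state.\<close>

lemma exec_deterministic:
  "exec w c s t s' \<Longrightarrow> exec w c s u s'' \<Longrightarrow> t = u \<and> s' = s''"
proof (induction arbitrary: u s'' rule: exec.induct)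
  case (Skip s)
  then show ?case by (auto elim: SkipE)
next
  case (Assign r e s)
  then show ?case by (auto elim: AssignE)
next
  case (Store e f s)
  then show ?case by (auto elim: StoreE)
next
  case (Seq c s t s' d t' sa)
  from Seq.prems obtain t1 s1 t2 where
    "exec w c s t1 s1" "exec w d s1 t2 s''" "u = t1 + t2 + 1" by (rule SeqE) simp
  with Seq.IH(1)[of t1 s1] Seq.IH(2)[of t2 s''] show ?case by simp
next
  case (If_True s e c t s' d)
  from If_True.prems obtain t1 where
    "exec w c s t1 s''" "u = cost e + t1 + 1" by (rule IfE) (simp_all add: If_True.hyps)
  with If_True.IH[of t1 s''] show ?case by simp
next
  case (If_False s e d t s' c)
  from If_False.prems obtain t1 where
    "exec w d s t1 s''" "u = cost e + t1 + 1" by (rule IfE) (simp_all add: If_False.hyps)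
  with If_False.IH[of t1 s''] show ?case by simp
next
  case (While_False s e c)
  from While_False.prems show ?case by (rule WhileE) (simp_all add: While_False.hyps)
next
  case (While_True s e c t s' t' sa)
  from While_True.prems obtain t1 s1 t2 where
    "exec w c s t1 s1" "exec w (While e c) s1 t2 s''" "u = cost e + t1 + t2 + 1"
    by (rule WhileE) (simp_all add: While_True.hyps)
  with While_True.IH(1)[of t1 s1] While_True.IH(2)[of t2 s''] show ?case by simp
qed


section \<open>Computing a partition for a given instance\<close>

text \<open>
  The agents are \<^term>\<open>{..<n}\<close>. Cell 0 of the memory holds the number of agents, and the
  cells \<^term>\<open>n * a + 1\<close> to \<^term>\<open>n * a + n\<close> hold the preference list of agent \<^term>\<open>a\<close>, best
  choice first. Everything else is zero.
\<close>

definition input_state :: "nat \<Rightarrow> (nat \<Rightarrow> nat rel) \<Rightarrow> state \<Rightarrow> bool" where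
  "input_state n P s \<longleftrightarrow>
     (\<forall>r. fst s r = 0) \<and>
     snd s 0 = n \<and>
     (\<forall>a<n. \<forall>x<n. snd s (n * a + rank {..<n} P a x) = x) \<and>
     (\<forall>i>n * n. snd s i = 0)"

text \<open>On termination cell \<^term>\<open>a\<close> holds the successor of agent \<^term>\<open>a\<close>.\<close>

definition output_state :: "nat \<Rightarrow> (nat \<Rightarrow> nat) \<Rightarrow> state \<Rightarrow> bool" where
  "output_state n \<pi> s \<longleftrightarrow> (\<forall>a<n. snd s a = \<pi> a)"

text \<open>
  Linear time: the preference lists have total length \<^term>\<open>n * n\<close>. As usual for the word RAM,
  words have to be large enough, but logarithmically many bits suffice: the same program has to
  be correct and fast for every word length \<^term>\<open>w\<close> that is at least \<^term>\<open>k\<close> times the binary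
  logarithm of \<^term>\<open>n + 2\<close>, for some constant \<^term>\<open>k\<close>.
\<close>

definition linear_time_computable ::
    "(nat set \<Rightarrow> (nat \<Rightarrow> nat rel) \<Rightarrow> (nat \<Rightarrow> nat) \<Rightarrow> bool) \<Rightarrow> bool" where
  "linear_time_computable Q \<longleftrightarrow>
     (\<exists>c k. \<exists>T :: nat \<Rightarrow> nat.
        (\<lambda>n. real (T n)) \<in> O(\<lambda>n. real n ^ 2) \<and>
        (\<forall>n P w s. sr_instance {..<n} P \<longrightarrow> (n + 2) ^ k \<le> 2 ^ w \<longrightarrow> input_state n P s \<longrightarrow>
           (\<exists>t s' \<pi>. exec w c s t s' \<and> t \<le> T n \<and> output_state n \<pi> s' \<and> Q {..<n} P \<pi>)))"

end

theory Submission
  imports Defs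
begin

text \<open>
  In the bipartite double cover of a roommates instance a permutation is a perfect matching, and
  a stable partition is a stable marriage in which every man weakly prefers his wife to the
  husband of his copy. Gale and Shapley's man-optimal marriage lies above all stable partitions.
  From there rotations are eliminated, always on a search path that starts at the last entry
  \<^term>\<open>x\<close> of an agent \<^term>\<open>y\<close> attaining the current worst rank: a partition that avoids the
  pair has to move \<^term>\<open>x\<close>, and with it every agent on the path, off their first entries.
  Hence it survives the elimination of the rotation at the end of the path. If that rotation
  is an odd party, or if \<^term>\<open>x\<close> has no other entry, then no partition can avoid the pair, the
  regret is known, and the remaining rotations may be eliminated in any order.

  Eliminating an odd party in the double cover inverts it, which swaps first and last entries
  and makes its agents inactive, so the algorithm needs no case distinction. The part of the
  search path below an eliminated rotation remains valid and is kept on the stack; this makes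
  the total work linear in the size of the preference lists.
\<close>

text \<open>Only last entries matter for the regret, since every agent ranks its predecessor weakly
  below its successor. A partition below the table in which \<open>x\<close> keeps its first entry
  \<open>y\<close> has \<open>x\<close> as the predecessor of \<open>y\<close>, so at a pair of the
  worst rank it cannot beat the table. If instead \<open>x\<close> leaves \<open>y\<close>,
  stability of the partition forces the next live entry \<open>b\<close> of \<open>x\<close> onto a
  husband at least as good as \<open>x\<close>, and the present husband of \<open>b\<close> has to
  leave too; this is why the whole path moves.

  Linearity rests on monotonicity. Deleted pairs never return and worst entries never get worse, so
  each scan pointer runs once through its list. The sweep over ranks and agents never goes back
  either: a pair that is passed over ends in an agent without a choice, and this remains so.

  The invariant distinguishes two cases for each partition separately, so optimality survives the
  moment at which the table leaves the region above that partition.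

  Existence is not proved beforehand. It is read off a run of the program on an initial segment of
  the naturals and carried to other agent sets by a bijection.\<close>

section \<open>Stable marriages of the double cover, tables and rotations\<close>

locale preferences =
  fixes n :: nat and rk :: "nat \<Rightarrow> nat \<Rightarrow> nat"
  assumes rk_bij: "a < n \<Longrightarrow> bij_betw (rk a) {..<n} {1..n}"
    and rk_self: "a < n \<Longrightarrow> rk a a = n"
begin

definition pr :: "nat \<Rightarrow> nat \<Rightarrow> nat" where
  "pr a i = inv_into {..<n} (rk a) i"

lemma rk_inject [simp]: "a < n \<Longrightarrow> b < n \<Longrightarrow> c < n \<Longrightarrow> rk a b = rk a c \<longleftrightarrow> b = c"
  using rk_bij[of a] by (auto simp: bij_betw_def inj_on_def)

lemma rk_ge_1: "a < n \<Longrightarrow> b < n \<Longrightarrow> 1 \<le> rk a b"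
  and rk_le_n: "a < n \<Longrightarrow> b < n \<Longrightarrow> rk a b \<le> n"
  using rk_bij[of a] by (auto simp: bij_betw_def)

lemma pr_less: "a < n \<Longrightarrow> 1 \<le> i \<Longrightarrow> i \<le> n \<Longrightarrow> pr a i < n"
  and rk_pr: "a < n \<Longrightarrow> 1 \<le> i \<Longrightarrow> i \<le> n \<Longrightarrow> rk a (pr a i) = i"
  using rk_bij[of a] inv_into_into[of i "rk a" "{..<n}"] f_inv_into_f[of i "rk a" "{..<n}"]
  by (auto simp: bij_betw_def pr_def)

lemma pr_rk: "a < n \<Longrightarrow> b < n \<Longrightarrow> pr a (rk a b) = b"
  using rk_bij[of a] by (auto simp: bij_betw_def pr_def)

text \<open>
  In a marriage \<^term>\<open>f\<close> maps men to their wives and \<^term>\<open>l\<close> maps women to their husbands;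
  both sides consist of copies of the same agents. Thus \<^term>\<open>f a\<close> and \<^term>\<open>l a\<close> are the first
  and the last entry of \<^term>\<open>a\<close> in a stable table of Irving and Tan.
\<close>

definition marriage :: "(nat \<Rightarrow> nat) \<Rightarrow> (nat \<Rightarrow> nat) \<Rightarrow> bool" where
  "marriage f l \<longleftrightarrow>
     (\<forall>a<n. f a < n \<and> l a < n \<and> l (f a) = a \<and> f (l a) = a) \<and>
     (\<forall>a<n. \<forall>b<n. rk a b < rk a (f a) \<longrightarrow> rk b (l b) < rk b a)"

definition active :: "(nat \<Rightarrow> nat) \<Rightarrow> (nat \<Rightarrow> nat) \<Rightarrow> nat \<Rightarrow> bool" where
  "active f l a \<longleftrightarrow> rk a (f a) < rk a (l a)"

text \<open>A marriage inverted on such an agent has the orientation that a stable partition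
  demands. Twisted agents arise only from eliminated odd parties.\<close>

definition twisted :: "(nat \<Rightarrow> nat) \<Rightarrow> (nat \<Rightarrow> nat) \<Rightarrow> nat \<Rightarrow> bool" where
  "twisted f l a \<longleftrightarrow> rk a (l a) < rk a (f a)"

definition worst :: "(nat \<Rightarrow> nat) \<Rightarrow> (nat \<Rightarrow> nat) \<Rightarrow> nat \<Rightarrow> nat" where
  "worst f l a = max (rk a (f a)) (rk a (l a))"

text \<open>The last clause isolates the inverted odd parties: up to the worst entries, only the two
  neighbours are mutually acceptable. This keeps twisted agents out of later rotations and excludes
  blocking pairs once the parties are turned back.\<close>

definition table :: "(nat \<Rightarrow> nat) \<Rightarrow> (nat \<Rightarrow> nat) \<Rightarrow> bool" where
  "table f l \<longleftrightarrow> marriage f l \<and>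
     (\<forall>a<n. twisted f l a \<longrightarrow> twisted f l (f a) \<and> twisted f l (l a) \<and>
       (\<forall>b<n. rk a b \<le> worst f l a \<longrightarrow> rk b a \<le> worst f l b \<longrightarrow> b = f a \<or> b = l a))"

text \<open>\<open>X\<close> may be a union of cycles; closure under \<open>a\<close> to
  \<open>l (s a)\<close> and injectivity of \<open>s\<close> suffice for the elimination. The
  comparison with \<open>l a\<close> confines the move to the roommates list of \<open>a\<close>,
  and the last clause says that the entries skipped on the way are dead.\<close>

definition rotation :: "(nat \<Rightarrow> nat) \<Rightarrow> (nat \<Rightarrow> nat) \<Rightarrow> (nat \<Rightarrow> nat) \<Rightarrow> nat set \<Rightarrow> bool" where
  "rotation f l s X \<longleftrightarrow> X \<subseteq> {..<n} \<and> inj_on s X \<and>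
     (\<forall>a\<in>X. s a < n \<and> l (s a) \<in> X \<and>
       rk a (f a) < rk a (s a) \<and> rk a (s a) \<le> rk a (l a) \<and>
       rk (s a) a \<le> rk (s a) (l (s a)) \<and>
       (\<forall>b<n. rk a (f a) < rk a b \<longrightarrow> rk a b < rk a (s a) \<longrightarrow> rk b (l b) < rk b a))"

definition elim_f :: "(nat \<Rightarrow> nat) \<Rightarrow> (nat \<Rightarrow> nat) \<Rightarrow> nat set \<Rightarrow> nat \<Rightarrow> nat" where
  "elim_f f s X a = (if a \<in> X then s a else f a)"

definition elim_l :: "(nat \<Rightarrow> nat) \<Rightarrow> (nat \<Rightarrow> nat) \<Rightarrow> nat set \<Rightarrow> nat \<Rightarrow> nat" where
  "elim_l l s X b = (if b \<in> s ` X then inv_into X s b else l b)"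

lemma marriageD:
  assumes "marriage f l" "a < n"
  shows "f a < n" "l a < n" "l (f a) = a" "f (l a) = a"
  using assms by (auto simp: marriage_def)

lemma marriage_stable:
  assumes "marriage f l" "a < n" "b < n" "rk a b < rk a (f a)"
  shows "rk b (l b) < rk b a"
  using assms by (auto simp: marriage_def)

text \<open>A blocking pair does not distinguish the sides. A bound on the wives in all marriages
  thereby becomes a bound on the husbands.\<close>

lemma marriage_swap:
  assumes "marriage f l"
  shows "marriage l f"
proof -
  have "rk b (f b) < rk b a" if "a < n" "b < n" "rk a b < rk a (l a)" for a b
  proof (rule ccontr)
    note ab = marriageD[OF assms that(1)] marriageD[OF assms that(2)]
    assume "\<not> rk b (f b) < rk b a"
    moreover have "a \<noteq> f b" using that ab by auto
    then have "rk b (f b) \<noteq> rk b a" using that ab by simp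
    ultimately have "rk b a < rk b (f b)" by simp
    from marriage_stable[OF assms that(2,1) this] that show False by simp
  qed
  with assms show ?thesis by (auto simp: marriage_def)
qed

context
  fixes f l s X
  assumes m: "marriage f l" and rot: "rotation f l s X"
begin

lemma rotD:
  assumes "a \<in> X"
  shows "a < n" "s a < n" "l (s a) \<in> X" "rk a (f a) < rk a (s a)" "rk a (s a) \<le> rk a (l a)"
    "rk (s a) a \<le> rk (s a) (l (s a))"
    "b < n \<Longrightarrow> rk a (f a) < rk a b \<Longrightarrow> rk a b < rk a (s a) \<Longrightarrow> rk b (l b) < rk b a"
  using rot assms by (auto simp: rotation_def)

lemma rotation_finite: "finite X"
  using rot finite_subset by (auto simp: rotation_def)

text \<open>An injective self-map of a finite set is onto, so \<open>X\<close> is closed backwards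
  as well: each abandoned woman is somebody's next entry.\<close>

lemma rotation_prev:
  assumes "a \<in> X"
  obtains c where "c \<in> X" "s c = f a"
proof -
  have "inj_on (\<lambda>x. l (s x)) X"
  proof (rule inj_onI)
    fix x y assume "x \<in> X" "y \<in> X" "l (s x) = l (s y)"
    then have "s x = s y" using rotD(2) marriageD(4)[OF m] by metis
    with \<open>x \<in> X\<close> \<open>y \<in> X\<close> rot show "x = y" by (auto simp: rotation_def inj_on_def)
  qed
  moreover have "(\<lambda>x. l (s x)) ` X \<subseteq> X" using rotD(3) by auto
  ultimately have "(\<lambda>x. l (s x)) ` X = X" using rotation_finite by (simp add: endo_inj_surj)
  with assms obtain c where "c \<in> X" "l (s c) = a" by (metis imageE)
  with that[of c] rotD(2)[of c] marriageD(4)[OF m] show thesis by auto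
qed

lemma elim_l_s: "a \<in> X \<Longrightarrow> elim_l l s X (s a) = a"
  using rot by (auto simp: elim_l_def rotation_def)

lemma elim_l_le:
  assumes "b < n"
  shows "rk b (elim_l l s X b) \<le> rk b (l b)"
proof (cases "b \<in> s ` X")
  case True
  then obtain c where "c \<in> X" "b = s c" by auto
  with rotD(6)[of c] elim_l_s show ?thesis by auto
qed (simp add: elim_l_def)

lemma elim_f_ge:
  assumes "a < n"
  shows "rk a (f a) \<le> rk a (elim_f f s X a)"
  using rotD(4)[of a] by (auto simp: elim_f_def)

lemma elim_marriage: "marriage (elim_f f s X) (elim_l l s X)"
proof -
  let ?f = "elim_f f s X" and ?l = "elim_l l s X"
  have perm: "?f a < n \<and> ?l a < n \<and> ?l (?f a) = a \<and> ?f (?l a) = a" if "a < n" for a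
  proof -
    note ma = marriageD[OF m that]
    have "?f a < n \<and> ?l (?f a) = a"
    proof (cases "a \<in> X")
      case True
      then show ?thesis using elim_l_s rotD(2) by (simp add: elim_f_def)
    next
      case False
      then have "f a \<notin> s ` X" using rotD(3) ma by (metis imageE)
      with False ma show ?thesis by (simp add: elim_f_def elim_l_def)
    qed
    moreover have "?l a < n \<and> ?f (?l a) = a"
    proof (cases "a \<in> s ` X")
      case True
      then obtain c where "c \<in> X" "a = s c" by auto
      then show ?thesis using elim_l_s rotD(1) by (simp add: elim_f_def)
    next
      case False
      have "l a \<notin> X"
      proof
        assume "l a \<in> X"
        then obtain c where "c \<in> X" "s c = f (l a)" by (rule rotation_prev)
        with False ma show False by auto
      qed
      with False ma show ?thesis by (simp add: elim_f_def elim_l_def)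
    qed
    ultimately show ?thesis by simp
  qed
  have "rk b (?l b) < rk b a" if ab: "a < n" "b < n" "rk a b < rk a (?f a)" for a b
  proof (cases "rk a b < rk a (f a)")
    case True
    with marriage_stable[OF m ab(1,2)] elim_l_le[OF ab(2)] show ?thesis by simp
  next
    case False
    with ab(3) have a: "a \<in> X" "rk a b < rk a (s a)" by (auto simp: elim_f_def split: if_splits)
    show ?thesis
    proof (cases "b = f a")
      case True
      \<comment> \<open>The abandoned wife receives the man \<open>c\<close> who moves to her, and
        she prefers him to \<open>a\<close>.\<close>
      obtain c where c: "c \<in> X" "s c = f a" using a(1) by (rule rotation_prev)
      have "c \<noteq> a" using c rotD(4)[OF a(1)] by auto
      moreover have "rk b c \<le> rk b a"
        using rotD(6)[OF c(1)] c True marriageD(3)[OF m ab(1)] by simp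
      moreover have "?l b = c" using elim_l_s c True by metis
      ultimately show ?thesis using ab c rotD(1)[of c] by (simp add: le_less)
    next
      case neq: False
      with False ab(1,2) marriageD(1)[OF m ab(1)] have "rk a (f a) < rk a b"
        by (metis nat_neq_iff rk_inject)
      with rotD(7)[OF a(1) ab(2) _ a(2)] elim_l_le[OF ab(2)] show ?thesis by simp
    qed
  qed
  with perm show ?thesis by (auto simp: marriage_def)
qed

end

lemma tableD:
  assumes "table f l"
  shows "marriage f l"
    and "a < n \<Longrightarrow> twisted f l a \<Longrightarrow> twisted f l (f a)"
    and "a < n \<Longrightarrow> twisted f l a \<Longrightarrow> twisted f l (l a)"
    and "a < n \<Longrightarrow> twisted f l a \<Longrightarrow> b < n \<Longrightarrow> rk a b \<le> worst f l a \<Longrightarrow> rk b a \<le> worst f l b \<Longrightarrow>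
      b = f a \<or> b = l a"
  using assms by (auto simp: table_def)

text \<open>The only agents acceptable to a twisted \<open>b\<close> are its neighbours, and these
  are twisted themselves.\<close>

lemma table_not_twisted:
  assumes "table f l" "a < n" "active f l a" "b < n" "rk a b \<le> rk a (l a)" "rk b a \<le> rk b (l b)"
  shows "\<not> twisted f l b"
proof
  assume tw: "twisted f l b"
  have "rk b a \<le> worst f l b" "rk a b \<le> worst f l a"
    using assms by (auto simp: worst_def)
  from tableD(4)[OF assms(1,4) tw assms(2) this] have "a = f b \<or> a = l b" .
  then have "twisted f l a" using tableD(2,3)[OF assms(1,4) tw] by auto
  with assms(3) show False by (simp add: twisted_def active_def)
qed

text \<open>If \<open>l b\<close> had a single entry, \<open>b\<close> and \<open>l b\<close> would
  be married to each other on both sides. Then \<open>b\<close>, as a man, would prefer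
  \<open>u\<close> to his wife, and stability would make \<open>u\<close> strictly prefer
  \<open>l u\<close> to \<open>b\<close>.\<close>

lemma next_active:
  assumes t: "table f l" and u: "u < n" "active f l u" and b: "b < n" "rk u (f u) < rk u b"
    "rk u b \<le> rk u (l u)" "rk b u \<le> rk b (l b)"
  shows "active f l (l b)"
proof (rule ccontr)
  note m = tableD(1)[OF t]
  note mb = marriageD[OF m b(1)]
  assume "\<not> active f l (l b)"
  moreover have "\<not> twisted f l b" using table_not_twisted[OF t u b(1,3,4)] .
  then have "\<not> twisted f l (l b)" using tableD(2)[OF t mb(2)] mb by auto
  ultimately have "rk (l b) (f (l b)) = rk (l b) (l (l b))" by (simp add: active_def twisted_def)
  then have eq: "l (l b) = b" using mb marriageD[OF m mb(2)] by simp
  then have "f b = l b" using marriageD[OF m mb(2)] by metis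
  moreover have "u \<noteq> l b" using mb b by auto
  then have "rk b u < rk b (l b)" using b u mb by (simp add: le_less)
  ultimately have "rk u (l u) < rk u b" using marriage_stable[OF m b(1) u(1)] by simp
  with b show False by simp
qed

text \<open>
  Eliminating a rotation either keeps every list in order or it inverts cycles all of whose
  agents have only two entries left; these inverted cycles are the odd parties.
\<close>

context
  fixes f l s X
  assumes t: "table f l" and rot: "rotation f l s X"
begin

definition "flipped = {a \<in> X. f a \<in> X \<and> s (f a) = a}"

private lemmas m = tableD(1)[OF t]
private lemmas rotD' = rotD[OF m rot]

lemma rotation_active: "a \<in> X \<Longrightarrow> active f l a"
  using rotD'(4,5)[of a] by (auto simp: active_def)

lemma rotation_not_twisted: "a \<in> X \<Longrightarrow> \<not> twisted f l a"
  using rotation_active[of a] by (auto simp: active_def twisted_def)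

lemma rotation_s_not_twisted: "a \<in> X \<Longrightarrow> \<not> twisted f l (s a)"
  by (rule table_not_twisted[OF t _ _ _ rotD'(5,6)]) (simp_all add: rotation_active rotD')

lemma table_pair_ge_first:
  assumes "a < n" "b < n" "rk b a \<le> rk b (l b)" "rk a b \<le> rk a (l a)"
  shows "rk a (f a) \<le> rk a b"
  using marriage_stable[OF m assms(1,2)] assms by force

text \<open>The next entry of \<open>f a\<close> is \<open>a\<close>, which is also its last. All
  entries between first and next are dead, so the list of \<open>f a\<close> has only two
  members.\<close>

lemma flipped_list:
  assumes "a \<in> flipped" "b < n" "rk (f a) b \<le> rk (f a) (l (f a))" "rk b (f a) \<le> rk b (l b)"
  shows "b = f (f a) \<or> b = a"
proof (rule ccontr)
  let ?z = "f a"
  from assms(1) have a: "a \<in> X" "?z \<in> X" "s ?z = a" by (auto simp: flipped_def)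
  note an = rotD'(1)[OF a(1)] and zn = rotD'(1)[OF a(2)]
  note lz = marriageD(3)[OF m an]
  assume neg: "\<not> (b = f ?z \<or> b = a)"
  have "rk ?z (f ?z) \<le> rk ?z b" using table_pair_ge_first[OF zn assms(2,4,3)] .
  with neg assms(2) zn marriageD(1)[OF m zn] have 1: "rk ?z (f ?z) < rk ?z b" by (simp add: le_less)
  have "rk ?z b < rk ?z a" using neg assms(2,3) zn an lz by (simp add: le_less)
  with rotD'(7)[OF a(2) assms(2) 1] a assms(4) show False by simp
qed

text \<open>The man who moves to \<open>f a\<close> belongs to its two-entry list and is not
  \<open>a\<close>, so he is \<open>f (f a)\<close>. Hence one reversed edge reverses the whole
  cycle.\<close>

lemma flipped_closed:
  assumes "a \<in> flipped"
  shows "f a \<in> flipped"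
proof -
  from assms have a: "a \<in> X" "f a \<in> X" "s (f a) = a" by (auto simp: flipped_def)
  note an = rotD'(1)[OF a(1)] and zn = rotD'(1)[OF a(2)]
  obtain c where c: "c \<in> X" "s c = f a" using rotation_prev[OF m rot a(1)] .
  have "c \<noteq> a" using c rotD'(4)[OF a(1)] by auto
  moreover have "c = f (f a) \<or> c = a"
    using flipped_list[OF assms, of c] rotD'[OF c(1)] c by simp
  ultimately show ?thesis using c a by (auto simp: flipped_def)
qed

lemma flipped_image: "f ` flipped = flipped"
proof (rule endo_inj_surj)
  show "finite flipped" using rotation_finite[OF m rot] by (auto simp: flipped_def)
  show "f ` flipped \<subseteq> flipped" using flipped_closed by auto
  show "inj_on f flipped"
  proof (rule inj_onI)
    fix x y assume "x \<in> flipped" "y \<in> flipped" and eq: "f x = f y"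
    then have "x < n" "y < n" using rotD'(1) by (auto simp: flipped_def)
    with eq marriageD(3)[OF m] show "x = y" by metis
  qed
qed

lemma flippedE:
  assumes "a \<in> flipped"
  shows "l a \<in> flipped" "s a = l a" "a \<in> X"
    "\<And>b. b < n \<Longrightarrow> rk a b \<le> rk a (l a) \<Longrightarrow> rk b a \<le> rk b (l b) \<Longrightarrow> b = f a \<or> b = l a"
proof -
  from assms obtain c where c: "c \<in> flipped" "a = f c" using flipped_image by blast
  then have "c < n" using rotD'(1) by (auto simp: flipped_def)
  then have "l a = c" using c marriageD(3)[OF m] by simp
  with c show "l a \<in> flipped" "s a = l a" "a \<in> X" by (auto simp: flipped_def)
  show "b = f a \<or> b = l a" if "b < n" "rk a b \<le> rk a (l a)" "rk b a \<le> rk b (l b)" for b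
    using flipped_list[OF c(1) that(1)] that c \<open>l a = c\<close> by auto
qed

lemma flipped_elim:
  assumes "a \<in> flipped"
  shows "elim_f f s X a = l a" "elim_l l s X a = f a"
proof -
  show "elim_f f s X a = l a" using flippedE[OF assms] by (simp add: elim_f_def)
  have "f a \<in> X" "s (f a) = a" using assms by (auto simp: flipped_def)
  then show "elim_l l s X a = f a" using elim_l_s[OF m rot] by metis
qed

text \<open>The critical case is \<open>a = s c\<close> with \<open>c\<close> before
  \<open>s a\<close> in the list of \<open>a\<close>. Unless \<open>c\<close> is \<open>f a\<close>,
  it is an entry skipped by \<open>a\<close>, hence dead, although \<open>c\<close> is just moving
  to \<open>a\<close>. And \<open>c = f a\<close> is exactly the flipped case.\<close>

lemma not_flipped_elim:
  assumes "a < n" "\<not> twisted f l a" "a \<notin> flipped"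
  shows "\<not> twisted (elim_f f s X) (elim_l l s X) a"
proof (cases "a \<in> s ` X")
  case False
  have "rk a (elim_f f s X a) \<le> rk a (l a)"
    using assms rotD'(5) by (auto simp: elim_f_def twisted_def)
  with False show ?thesis by (simp add: elim_l_def twisted_def)
next
  case True
  then obtain c where c: "c \<in> X" "a = s c" by auto
  note cn = rotD'[OF c(1)]
  have lc: "elim_l l s X a = c" using c elim_l_s[OF m rot] by metis
  have ge: "rk a (f a) \<le> rk a c"
    using table_pair_ge_first[OF assms(1) cn(1)] cn c by simp
  show ?thesis
  proof (cases "a \<in> X")
    case False
    with lc ge show ?thesis by (simp add: elim_f_def twisted_def)
  next
    case aX: True
    show ?thesis
    proof (rule ccontr)
      assume "\<not> \<not> twisted (elim_f f s X) (elim_l l s X) a"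
      with lc aX have lt: "rk a c < rk a (s a)" by (simp add: elim_f_def twisted_def)
      have "c = f a"
      proof (rule ccontr)
        assume "c \<noteq> f a"
        with ge assms(1) cn(1) marriageD(1)[OF m assms(1)] have "rk a (f a) < rk a c"
          by (simp add: le_less)
        with rotD'(7)[OF aX cn(1) this lt] cn(5) c show False by simp
      qed
      then have "f a \<in> X" "s (f a) = a" using c by simp_all
      with aX assms(3) show False by (simp add: flipped_def)
    qed
  qed
qed

lemma twisted_elim:
  assumes "a < n" "twisted f l a"
  shows "elim_f f s X a = f a" "elim_l l s X a = l a"
  using assms rotation_not_twisted rotation_s_not_twisted by (auto simp: elim_f_def elim_l_def)

lemma elim_worst_le:
  assumes "a < n"
  shows "worst (elim_f f s X) (elim_l l s X) a \<le> worst f l a"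
proof (cases "a \<in> flipped \<or> twisted f l a")
  case True
  then show ?thesis using flipped_elim[of a] twisted_elim[OF assms] by (auto simp: worst_def)
next
  case False
  with not_flipped_elim[OF assms] elim_l_le[OF m rot assms] show ?thesis
    by (auto simp: worst_def twisted_def)
qed

lemma twisted_elim_iff:
  assumes "a < n"
  shows "twisted (elim_f f s X) (elim_l l s X) a \<longleftrightarrow> twisted f l a \<or> a \<in> flipped"
proof -
  have "twisted (elim_f f s X) (elim_l l s X) a" if "a \<in> flipped"
    using flipped_elim[OF that] rotation_active flippedE(3)[OF that]
    by (auto simp: twisted_def active_def)
  moreover have "twisted (elim_f f s X) (elim_l l s X) a" if "twisted f l a"
    using that twisted_elim[OF assms that] by (simp add: twisted_def)
  ultimately show ?thesis using not_flipped_elim[OF assms] by blast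
qed

lemma elim_table: "table (elim_f f s X) (elim_l l s X)"
  unfolding table_def
proof (intro conjI allI impI)
  let ?f = "elim_f f s X" and ?l = "elim_l l s X"
  show "marriage ?f ?l" using elim_marriage[OF m rot] .
  fix a assume an: "a < n" and tw: "twisted ?f ?l a"
  note ma = marriageD[OF m an]
  consider (old) "twisted f l a" | (new) "a \<in> flipped"
    using tw twisted_elim_iff[OF an] by blast
  then have "twisted ?f ?l (?f a) \<and> twisted ?f ?l (?l a) \<and> {?f a, ?l a} = {f a, l a}"
  proof cases
    case old
    then show ?thesis
      using twisted_elim[OF an old] tableD(2,3)[OF t an old] twisted_elim_iff ma by auto
  next
    case new
    then show ?thesis
      using flipped_elim[OF new] flippedE[OF new] flipped_closed[OF new] twisted_elim_iff ma by auto
  qed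
  then show "twisted ?f ?l (?f a)" "twisted ?f ?l (?l a)" by auto
  from \<open>_ \<and> _ \<and> _\<close> have eq: "{?f a, ?l a} = {f a, l a}" by auto
  fix b assume b: "b < n" "rk a b \<le> worst ?f ?l a" "rk b a \<le> worst ?f ?l b"
  then have b': "rk a b \<le> worst f l a" "rk b a \<le> worst f l b"
    using elim_worst_le an b le_trans by blast+
  have "b = f a \<or> b = l a"
  proof (cases "twisted f l a")
    case True
    then show ?thesis using tableD(4)[OF t an True b(1) b'] by simp
  next
    case False
    with tw an have new: "a \<in> flipped" using twisted_elim_iff by blast
    show ?thesis
    proof (cases "twisted f l b")
      case True
      then show ?thesis using tableD(4)[OF t b(1) True an b'(2,1)] marriageD[OF m b(1)] by auto
    next
      case nb: False
      have "worst f l a = rk a (l a)" "worst f l b = rk b (l b)"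
        using False nb by (auto simp: worst_def twisted_def)
      with flippedE(4)[OF new b(1)] b' show ?thesis by simp
    qed
  qed
  with eq show "b = ?f a \<or> b = ?l a" by blast
qed

end

section \<open>Comparison with a stable partition\<close>

definition partition :: "(nat \<Rightarrow> nat) \<Rightarrow> (nat \<Rightarrow> nat) \<Rightarrow> bool" where
  "partition g h \<longleftrightarrow> marriage g h \<and> (\<forall>a<n. rk a (g a) \<le> rk a (h a))"

definition above :: "(nat \<Rightarrow> nat) \<Rightarrow> (nat \<Rightarrow> nat) \<Rightarrow> bool" where
  "above f g \<longleftrightarrow> (\<forall>a<n. rk a (f a) \<le> rk a (g a))"

text \<open>The opposed interests of the two sides: if \<open>a\<close> preferred \<open>l a\<close>
  to \<open>h a\<close>, the man \<open>l a\<close> would also prefer \<open>a\<close> to his wife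
  in \<open>g\<close>, and the two would block \<open>g\<close>.\<close>

lemma above_converse:
  assumes m: "marriage f l" and g: "marriage g h" and ab: "above f g" and a: "a < n"
  shows "rk a (h a) \<le> rk a (l a)"
proof (rule ccontr)
  assume "\<not> ?thesis"
  then have lt: "rk a (l a) < rk a (h a)" by simp
  note ma = marriageD[OF m a] and ga = marriageD[OF g a]
  have "g (l a) \<noteq> a" using lt marriageD(3)[OF g ma(2)] by auto
  moreover have "rk (l a) a \<le> rk (l a) (g (l a))"
    using ab ma by (auto simp: above_def dest!: spec[of _ "l a"])
  ultimately have "rk (l a) a < rk (l a) (g (l a))"
    using a ma marriageD[OF g ma(2)] by (simp add: le_less)
  from marriage_stable[OF g ma(2) a this] lt show False by simp
qed

text \<open>This carries the property of having left the first entry along the search path. In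
  \<open>g\<close>, \<open>x\<close> cannot stop before \<open>b\<close>, since those entries are
  dead. By stability of \<open>g\<close>, the husband of \<open>b\<close> is then at least as good
  as \<open>x\<close>, and \<open>x\<close> is better than \<open>l b\<close>, so \<open>l b\<close>
  loses \<open>b\<close>.\<close>

lemma next_moved:
  assumes m: "marriage f l" and g: "marriage g h" and ab: "above f g" and x: "x < n" "g x \<noteq> f x"
    and b: "b < n" "rk x (f x) < rk x b" "rk b x \<le> rk b (l b)"
    and between: "\<And>c. c < n \<Longrightarrow> rk x (f x) < rk x c \<Longrightarrow> rk x c < rk x b \<Longrightarrow> rk c (l c) < rk c x"
  shows "rk x b \<le> rk x (g x)" "g (l b) \<noteq> f (l b)" "rk b (h b) \<le> rk b x"
proof -
  note mx = marriageD[OF m x(1)] and gx = marriageD[OF g x(1)] and mb = marriageD[OF m b(1)]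
    and gb = marriageD[OF g b(1)]
  have "rk x (f x) \<le> rk x (g x)" using ab x by (simp add: above_def)
  with x mx gx have lt: "rk x (f x) < rk x (g x)" by (simp add: le_less)
  show le: "rk x b \<le> rk x (g x)"
  proof (rule ccontr)
    assume "\<not> ?thesis"
    with between[OF gx(1) lt] have "rk (g x) (l (g x)) < rk (g x) x" by simp
    with above_converse[OF m g ab gx(1)] gx show False by simp
  qed
  show hb: "rk b (h b) \<le> rk b x"
  proof (cases "g x = b")
    case True
    then show ?thesis using gx by simp
  next
    case False
    with le b x gx have "rk x b < rk x (g x)" by (simp add: le_less)
    from marriage_stable[OF g x(1) b(1) this] show ?thesis by simp
  qed
  show "g (l b) \<noteq> f (l b)"
  proof
    assume "g (l b) = f (l b)"
    then have "h b = l b" using mb marriageD(3)[OF g mb(2)] by simp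
    with hb b(3) have "rk b x = rk b (l b)" by simp
    then have "x = l b" using b x mb by simp
    with mb b(2) show False by simp
  qed
qed

lemma elim_above:
  assumes t: "table f l" and rot: "rotation f l s X" and g: "marriage g h" and ab: "above f g"
    and moved: "\<And>x. x \<in> X \<Longrightarrow> g x \<noteq> f x"
  shows "above (elim_f f s X) g"
  unfolding above_def
proof (intro allI impI)
  fix a assume a: "a < n"
  note m = tableD(1)[OF t]
  show "rk a (elim_f f s X a) \<le> rk a (g a)"
  proof (cases "a \<in> X")
    case True
    note r = rotD[OF m rot True]
    have "rk a (s a) \<le> rk a (g a)"
      by (rule next_moved(1)[OF m g ab a moved[OF True] r(2,4,6)]) (rule r(7))
    with True show ?thesis by (simp add: elim_f_def)
  qed (use ab a in \<open>auto simp: elim_f_def above_def\<close>)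
qed

text \<open>
  On an odd party a partition that avoids all first entries is forced to be the inverse, which
  would rank successors below predecessors.
\<close>

lemma not_flipped_above:
  assumes t: "table f l" and rot: "rotation f l s X" and g: "partition g h" and ab: "above f g"
    and moved: "\<And>x. x \<in> X \<Longrightarrow> g x \<noteq> f x"
  shows "flipped f s X = {}"
proof (rule ccontr)
  note m = tableD(1)[OF t]
  have gm: "marriage g h" and gt: "\<And>a. a < n \<Longrightarrow> rk a (g a) \<le> rk a (h a)"
    using g by (auto simp: partition_def)
  have forced: "g a = l a" if "a \<in> flipped f s X" for a
  proof -
    note aX = flippedE(3)[OF t rot that]
    note an = rotD(1)[OF m rot aX]
    note ga = marriageD[OF gm an]
    have "rk a (g a) \<le> rk a (l a)" using gt[OF an] above_converse[OF m gm ab an] by simp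
    moreover have "rk (g a) a \<le> rk (g a) (l (g a))"
      using above_converse[OF m gm ab ga(1)] ga by simp
    ultimately show ?thesis using flippedE(4)[OF t rot that ga(1)] moved[OF aX] by blast
  qed
  assume "flipped f s X \<noteq> {}"
  then obtain a where a: "a \<in> flipped f s X" by auto
  note fa = flipped_closed[OF t rot a]
  note aX = flippedE(3)[OF t rot a]
  note an = rotD(1)[OF m rot aX]
  note fan = marriageD[OF m an]
  have "h a = f a" using forced[OF fa] fan marriageD(3)[OF gm fan(1)] by simp
  with gt[OF an] forced[OF a] have "\<not> active f l a" by (simp add: active_def)
  with rotation_active[OF t rot aX] show False by simp
qed

end

section \<open>The state of the search and its invariant\<close>

text \<open>\<open>ptr\<close> stores ranks but \<open>last\<close> stores agents: a first entry is
  found by reading one's own list, a last entry is assigned by the agent that moves.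
  \<open>scan\<close> is the rank at which the hunt for the next entry resumes.
  \<open>target\<close> names the lowest agent of the cycle being eliminated, and the value
  \<open>n\<close> means that there is none.\<close>

record search =
  ptr :: "nat \<Rightarrow> nat"
  last :: "nat \<Rightarrow> nat"
  scan :: "nat \<Rightarrow> nat"
  stack :: "nat \<Rightarrow> nat"
  mark :: "nat \<Rightarrow> nat"
  bound :: nat
  agent :: nat
  depth :: nat
  target :: nat

definition push :: "nat \<Rightarrow> search \<Rightarrow> search" where
  "push x \<alpha> = \<alpha>\<lparr>stack := (stack \<alpha>)(depth \<alpha> := x), mark := (mark \<alpha>)(x := 1), depth := depth \<alpha> + 1\<rparr>"

context preferences
begin

text \<open>An elimination is spread over several steps, one pop each, so that a step needs no loop
  and has constant cost. The same \<open>agent\<close> is examined again after its path has been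
  used up; the sweep moves on only when the pair is not of the worst rank or its root has no
  choice.\<close>

definition step :: "search \<Rightarrow> search" where
  "step \<alpha> =
     (if target \<alpha> < n then
        let u = stack \<alpha> (depth \<alpha> - 1); b = pr u (scan \<alpha> u) in
        \<alpha>\<lparr>ptr := (ptr \<alpha>)(u := scan \<alpha> u), last := (last \<alpha>)(b := u),
          scan := (scan \<alpha>)(u := scan \<alpha> u + 1), mark := (mark \<alpha>)(u := 0),
          depth := depth \<alpha> - 1, target := if u = target \<alpha> then n else target \<alpha>\<rparr>
      else if depth \<alpha> = 0 then
        let x = last \<alpha> (agent \<alpha>) in
        if rk (agent \<alpha>) x = bound \<alpha> \<and> ptr \<alpha> x < rk x (last \<alpha> x) then push x \<alpha>
        else if agent \<alpha> + 1 = n then \<alpha>\<lparr>bound := bound \<alpha> - 1, agent := 0\<rparr>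
        else \<alpha>\<lparr>agent := agent \<alpha> + 1\<rparr>
      else
        let u = stack \<alpha> (depth \<alpha> - 1) in
        if ptr \<alpha> u < rk u (last \<alpha> u) then
          let b = pr u (scan \<alpha> u) in
          if rk b (last \<alpha> b) < rk b u then \<alpha>\<lparr>scan := (scan \<alpha>)(u := scan \<alpha> u + 1)\<rparr>
          else if mark \<alpha> (last \<alpha> b) = 0 then push (last \<alpha> b) \<alpha>
          else \<alpha>\<lparr>target := last \<alpha> b\<rparr>
        else \<alpha>\<lparr>mark := (mark \<alpha>)(u := 0), depth := depth \<alpha> - 1\<rparr>)"

definition first :: "(nat \<Rightarrow> nat) \<Rightarrow> nat \<Rightarrow> nat" where
  "first p a = pr a (p a)"

abbreviation "act \<alpha> \<equiv> active (first (ptr \<alpha>)) (last \<alpha>)"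

definition candidate :: "search \<Rightarrow> nat \<Rightarrow> nat" where
  "candidate \<alpha> a = pr a (scan \<alpha> a)"

definition ready :: "search \<Rightarrow> nat \<Rightarrow> bool" where
  "ready \<alpha> a \<longleftrightarrow> scan \<alpha> a \<le> n \<and>
     rk (candidate \<alpha> a) a \<le> rk (candidate \<alpha> a) (last \<alpha> (candidate \<alpha> a))"

text \<open>
  Either a partition \<^term>\<open>g\<close> lies below the current table and the bound is still an upper bound
  for the table, or the regret of \<^term>\<open>g\<close> is already reached.
\<close>

definition compatible :: "search \<Rightarrow> (nat \<Rightarrow> nat) \<Rightarrow> bool" where
  "compatible \<alpha> g \<longleftrightarrow> (\<forall>a<n. \<not> twisted (first (ptr \<alpha>)) (last \<alpha>) a) \<and> above (first (ptr \<alpha>)) g \<and>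
     (\<forall>a<n. rk a (last \<alpha> a) \<le> bound \<alpha> \<and> (rk a (last \<alpha> a) = bound \<alpha> \<longrightarrow> agent \<alpha> \<le> a)) \<and>
     (\<forall>i<depth \<alpha>. g (stack \<alpha> i) \<noteq> first (ptr \<alpha>) (stack \<alpha> i))"

definition beaten :: "search \<Rightarrow> (nat \<Rightarrow> nat) \<Rightarrow> bool" where
  "beaten \<alpha> h \<longleftrightarrow> (\<forall>a<n. \<exists>b<n. worst (first (ptr \<alpha>)) (last \<alpha>) a \<le> rk b (h b))"

text \<open>Activity of the stacked agents is not asserted, because an elimination above them may
  destroy it. The clause with \<open>bound\<close> and \<open>agent\<close> records that pairs
  already swept end in inactive agents; at bound 0 it covers everybody.\<close>

definition normal :: "search \<Rightarrow> bool" where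
  "normal \<alpha> \<longleftrightarrow>
     agent \<alpha> < n \<and> bound \<alpha> \<le> n \<and>
     (\<forall>a<n. 1 \<le> ptr \<alpha> a \<and> ptr \<alpha> a \<le> n \<and> ptr \<alpha> a < scan \<alpha> a \<and> scan \<alpha> a \<le> n + 1) \<and>
     table (first (ptr \<alpha>)) (last \<alpha>) \<and>
     (\<forall>a<n. \<forall>b<n. ptr \<alpha> a < rk a b \<longrightarrow> rk a b < scan \<alpha> a \<longrightarrow> rk b (last \<alpha> b) < rk b a) \<and>
     (\<forall>i<depth \<alpha>. stack \<alpha> i < n) \<and> inj_on (stack \<alpha>) {..<depth \<alpha>} \<and>
     (\<forall>a<n. mark \<alpha> a = (if a \<in> stack \<alpha> ` {..<depth \<alpha>} then 1 else 0)) \<and>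
     (\<forall>i. Suc i < depth \<alpha> \<longrightarrow> ready \<alpha> (stack \<alpha> i) \<and>
        last \<alpha> (candidate \<alpha> (stack \<alpha> i)) = stack \<alpha> (Suc i)) \<and>
     (\<forall>a<n. bound \<alpha> < rk a (last \<alpha> a) \<or> bound \<alpha> = rk a (last \<alpha> a) \<and> a < agent \<alpha> \<longrightarrow>
        \<not> act \<alpha> (last \<alpha> a)) \<and>
     (\<forall>g h. partition g h \<longrightarrow> compatible \<alpha> g \<or> beaten \<alpha> h)"

lemma normalD:
  assumes "normal \<alpha>"
  shows "agent \<alpha> < n" "bound \<alpha> \<le> n"
    "a < n \<Longrightarrow> 1 \<le> ptr \<alpha> a" "a < n \<Longrightarrow> ptr \<alpha> a \<le> n" "a < n \<Longrightarrow> ptr \<alpha> a < scan \<alpha> a"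
    "a < n \<Longrightarrow> scan \<alpha> a \<le> n + 1"
    "table (first (ptr \<alpha>)) (last \<alpha>)"
    "a < n \<Longrightarrow> b < n \<Longrightarrow> ptr \<alpha> a < rk a b \<Longrightarrow> rk a b < scan \<alpha> a \<Longrightarrow> rk b (last \<alpha> b) < rk b a"
    "i < depth \<alpha> \<Longrightarrow> stack \<alpha> i < n" "inj_on (stack \<alpha>) {..<depth \<alpha>}"
    "a < n \<Longrightarrow> mark \<alpha> a = (if a \<in> stack \<alpha> ` {..<depth \<alpha>} then 1 else 0)"
    "Suc i < depth \<alpha> \<Longrightarrow> ready \<alpha> (stack \<alpha> i)"
    "Suc i < depth \<alpha> \<Longrightarrow> last \<alpha> (candidate \<alpha> (stack \<alpha> i)) = stack \<alpha> (Suc i)"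
    "a < n \<Longrightarrow> bound \<alpha> < rk a (last \<alpha> a) \<or> bound \<alpha> = rk a (last \<alpha> a) \<and> a < agent \<alpha> \<Longrightarrow>
      \<not> act \<alpha> (last \<alpha> a)"
    "partition g h \<Longrightarrow> compatible \<alpha> g \<or> beaten \<alpha> h"
  using assms unfolding normal_def by blast+

lemma rk_first: "normal \<alpha> \<Longrightarrow> a < n \<Longrightarrow> rk a (first (ptr \<alpha>) a) = ptr \<alpha> a"
  using normalD(3,4)[of \<alpha> a] by (simp add: first_def rk_pr)

lemma act_iff: "normal \<alpha> \<Longrightarrow> a < n \<Longrightarrow> act \<alpha> a \<longleftrightarrow> ptr \<alpha> a < rk a (last \<alpha> a)"
  by (simp add: active_def rk_first)

lemma depth_le:
  assumes "normal \<alpha>"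
  shows "depth \<alpha> \<le> n"
  using card_inj_on_le[OF normalD(10)[OF assms], of "{..<n}"] normalD(9)[OF assms] by auto

text \<open>An agent and its last entry always form a live pair. If the scan had passed it,
  \<open>last \<alpha> a\<close> would be twisted, and with it \<open>a\<close>.\<close>

lemma scan_le:
  assumes N: "normal \<alpha>" and a: "a < n" "act \<alpha> a"
  shows "scan \<alpha> a \<le> rk a (last \<alpha> a)"
proof (rule ccontr)
  assume "\<not> ?thesis"
  then have lt: "rk a (last \<alpha> a) < scan \<alpha> a" by simp
  let ?b = "last \<alpha> a"
  note t = normalD(7)[OF N]
  note m = tableD(1)[OF t]
  note ma = marriageD[OF m a(1)]
  have "ptr \<alpha> a < rk a ?b" using a act_iff[OF N] by simp
  from normalD(8)[OF N a(1) ma(2) this lt] ma have "twisted (first (ptr \<alpha>)) (last \<alpha>) ?b"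
    by (simp add: twisted_def)
  then have "twisted (first (ptr \<alpha>)) (last \<alpha>) a" using tableD(2)[OF t ma(2)] ma by simp
  with a show False by (simp add: twisted_def active_def)
qed

lemma candidate_less:
  assumes "normal \<alpha>" "a < n" "scan \<alpha> a \<le> n"
  shows "candidate \<alpha> a < n" "rk a (candidate \<alpha> a) = scan \<alpha> a"
  using assms normalD(3,5)[OF assms(1,2)] by (auto simp: candidate_def pr_less rk_pr)

lemma beaten_le:
  assumes "beaten \<alpha> h"
    and "\<And>a. a < n \<Longrightarrow> worst (first (ptr \<beta>)) (last \<beta>) a \<le> worst (first (ptr \<alpha>)) (last \<alpha>) a"
  shows "beaten \<beta> h"
  using assms unfolding beaten_def by (meson le_trans)

text \<open>A partition that keeps this pair has a predecessor of rank
  \<open>bound \<alpha>\<close>, and the table has no worse entry anywhere.\<close>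

lemma compatible_beaten:
  assumes N: "normal \<alpha>" and g: "partition g h" and c: "compatible \<alpha> g"
    and y: "y < n" "rk y (last \<alpha> y) = bound \<alpha>" "g (last \<alpha> y) = y"
  shows "beaten \<alpha> h"
proof -
  have "h y = last \<alpha> y"
    using g y marriageD[OF tableD(1)[OF normalD(7)[OF N]] y(1)] by (auto simp: partition_def marriage_def)
  moreover have "worst (first (ptr \<alpha>)) (last \<alpha>) a \<le> bound \<alpha>" if "a < n" for a
    using c that by (auto simp: compatible_def worst_def twisted_def not_less max_def)
  ultimately show ?thesis using y by (auto simp: beaten_def)
qed

section \<open>Elimination of a cycle on the stack\<close>

text \<open>For \<open>k\<close> strictly inside a cycle the result need not be a marriage. It
  describes the memory in the middle of an elimination, seen as an update of the state in which the
  cycle was found.\<close>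

definition popped :: "search \<Rightarrow> nat \<Rightarrow> search" where
  "popped \<alpha> k = (let X = stack \<alpha> ` {k..<depth \<alpha>} in
     \<alpha>\<lparr>ptr := elim_f (ptr \<alpha>) (scan \<alpha>) X, last := elim_l (last \<alpha>) (candidate \<alpha>) X,
       scan := elim_f (scan \<alpha>) (\<lambda>a. scan \<alpha> a + 1) X, mark := elim_f (mark \<alpha>) (\<lambda>a. 0) X,
       depth := k\<rparr>)"

definition cycle_at :: "search \<Rightarrow> nat \<Rightarrow> bool" where
  "cycle_at \<alpha> j \<longleftrightarrow> j < depth \<alpha> \<and> act \<alpha> (stack \<alpha> (depth \<alpha> - 1)) \<and>
     ready \<alpha> (stack \<alpha> (depth \<alpha> - 1)) \<and>
     last \<alpha> (candidate \<alpha> (stack \<alpha> (depth \<alpha> - 1))) = stack \<alpha> j"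

context
  fixes \<alpha> j
  assumes N: "normal \<alpha>" and cyc: "cycle_at \<alpha> j"
begin

lemma cycle_bounds: "j < depth \<alpha>" "0 < depth \<alpha>"
  using cyc by (auto simp: cycle_at_def)

lemma cycle_ready: "i < depth \<alpha> \<Longrightarrow> ready \<alpha> (stack \<alpha> i)"
  using cyc normalD(12)[OF N, of i] by (cases "Suc i < depth \<alpha>") (auto simp: cycle_at_def dest: less_antisym)

lemma cycle_next:
  assumes "i < depth \<alpha>"
  shows "last \<alpha> (candidate \<alpha> (stack \<alpha> i)) = stack \<alpha> (if Suc i < depth \<alpha> then Suc i else j)"
proof (cases "Suc i < depth \<alpha>")
  case False
  with assms have "i = depth \<alpha> - 1" by simp
  with False cyc show ?thesis by (simp add: cycle_at_def)
qed (use normalD(13)[OF N] in simp)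

lemma cycle_candidate:
  assumes "i < depth \<alpha>"
  shows "candidate \<alpha> (stack \<alpha> i) < n" "rk (stack \<alpha> i) (candidate \<alpha> (stack \<alpha> i)) = scan \<alpha> (stack \<alpha> i)"
  using candidate_less[OF N normalD(9)[OF N assms]] cycle_ready[OF assms] by (auto simp: ready_def)

lemma cycle_next_active:
  assumes "i < depth \<alpha>" "act \<alpha> (stack \<alpha> i)"
  shows "act \<alpha> (last \<alpha> (candidate \<alpha> (stack \<alpha> i)))"
proof (rule next_active[OF normalD(7)[OF N] normalD(9)[OF N assms(1)] assms(2)])
  note a = normalD(9)[OF N assms(1)]
  note c = cycle_candidate[OF assms(1)]
  show "candidate \<alpha> (stack \<alpha> i) < n" by (rule c)
  show "rk (stack \<alpha> i) (first (ptr \<alpha>) (stack \<alpha> i)) < rk (stack \<alpha> i) (candidate \<alpha> (stack \<alpha> i))"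
    using c rk_first[OF N a] normalD(5)[OF N a] by simp
  show "rk (stack \<alpha> i) (candidate \<alpha> (stack \<alpha> i)) \<le> rk (stack \<alpha> i) (last \<alpha> (stack \<alpha> i))"
    using c scan_le[OF N a assms(2)] by simp
  show "rk (candidate \<alpha> (stack \<alpha> i)) (stack \<alpha> i)
      \<le> rk (candidate \<alpha> (stack \<alpha> i)) (last \<alpha> (candidate \<alpha> (stack \<alpha> i)))"
    using cycle_ready[OF assms(1)] by (simp add: ready_def)
qed

text \<open>Only the tip has been tested. Its activity passes to the bottom of the cycle across the
  closing edge, and from there upwards along the stack.\<close>

lemma cycle_active:
  assumes "j \<le> i" "i < depth \<alpha>"
  shows "act \<alpha> (stack \<alpha> i)"
  using assms
proof (induction i rule: dec_induct)
  case base
  have "act \<alpha> (stack \<alpha> (depth \<alpha> - 1))" using cyc by (simp add: cycle_at_def)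
  from cycle_next_active[OF _ this] cycle_bounds cycle_next[of "depth \<alpha> - 1"] show ?case by simp
next
  case (step i)
  then show ?case using cycle_next_active[of i] cycle_next[of i] by simp
qed

lemma cycle_below: "i < j \<Longrightarrow> stack \<alpha> i \<notin> stack \<alpha> ` {j..<depth \<alpha>}"
  using inj_on_image_mem_iff[OF normalD(10)[OF N], of i "{j..<depth \<alpha>}"] cycle_bounds by force

text \<open>Equal candidates have the same last entry, which is the successor on the cycle, and
  distinct positions have distinct successors.\<close>

lemma cycle_inj: "inj_on (candidate \<alpha>) (stack \<alpha> ` {j..<depth \<alpha>})"
proof (rule inj_onI)
  fix a b assume "a \<in> stack \<alpha> ` {j..<depth \<alpha>}" "b \<in> stack \<alpha> ` {j..<depth \<alpha>}"
    and eq: "candidate \<alpha> a = candidate \<alpha> b"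
  then obtain i k where ik: "i < depth \<alpha>" "k < depth \<alpha>" "j \<le> i" "j \<le> k" "a = stack \<alpha> i" "b = stack \<alpha> k"
    by auto
  let ?nx = "\<lambda>i. if Suc i < depth \<alpha> then Suc i else j"
  have "stack \<alpha> (?nx i) = stack \<alpha> (?nx k)"
    using cycle_next[OF ik(1)] cycle_next[OF ik(2)] eq ik(5,6) by metis
  then have "?nx i = ?nx k"
    using inj_onD[OF normalD(10)[OF N], of "?nx i" "?nx k"] cycle_bounds by simp
  with ik have "i = k" by (auto split: if_splits)
  with ik show "a = b" by simp
qed

lemma cycle_rotation:
  "rotation (first (ptr \<alpha>)) (last \<alpha>) (candidate \<alpha>) (stack \<alpha> ` {j..<depth \<alpha>})"
  unfolding rotation_def
proof (intro conjI ballI)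
  show "stack \<alpha> ` {j..<depth \<alpha>} \<subseteq> {..<n}" using normalD(9)[OF N] by auto
  show "inj_on (candidate \<alpha>) (stack \<alpha> ` {j..<depth \<alpha>})" by (rule cycle_inj)
  fix a assume "a \<in> stack \<alpha> ` {j..<depth \<alpha>}"
  then obtain i where i: "j \<le> i" "i < depth \<alpha>" "a = stack \<alpha> i" by auto
  note a = normalD(9)[OF N i(2), folded i(3)]
  note c = cycle_candidate[OF i(2), folded i(3)]
  have ac: "act \<alpha> a" using cycle_active i by simp
  show "candidate \<alpha> a < n" by (rule c)
  show "last \<alpha> (candidate \<alpha> a) \<in> stack \<alpha> ` {j..<depth \<alpha>}"
    using cycle_next[OF i(2)] i cycle_bounds by auto
  show "rk a (first (ptr \<alpha>) a) < rk a (candidate \<alpha> a)"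
    using c rk_first[OF N a] normalD(5)[OF N a] by simp
  show "rk a (candidate \<alpha> a) \<le> rk a (last \<alpha> a)"
    using c scan_le[OF N a ac] by simp
  show "rk (candidate \<alpha> a) a \<le> rk (candidate \<alpha> a) (last \<alpha> (candidate \<alpha> a))"
    using cycle_ready[OF i(2)] i by (simp add: ready_def)
  show "\<forall>b<n. rk a (first (ptr \<alpha>) a) < rk a b \<longrightarrow> rk a b < rk a (candidate \<alpha> a) \<longrightarrow>
      rk b (last \<alpha> b) < rk b a"
    using c rk_first[OF N a] normalD(8)[OF N a] by simp
qed

lemma popped_simps:
  "ptr (popped \<alpha> k) = elim_f (ptr \<alpha>) (scan \<alpha>) (stack \<alpha> ` {k..<depth \<alpha>})"
  "last (popped \<alpha> k) = elim_l (last \<alpha>) (candidate \<alpha>) (stack \<alpha> ` {k..<depth \<alpha>})"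
  "scan (popped \<alpha> k) = elim_f (scan \<alpha>) (\<lambda>a. scan \<alpha> a + 1) (stack \<alpha> ` {k..<depth \<alpha>})"
  "mark (popped \<alpha> k) = elim_f (mark \<alpha>) (\<lambda>a. 0) (stack \<alpha> ` {k..<depth \<alpha>})"
  "depth (popped \<alpha> k) = k" "stack (popped \<alpha> k) = stack \<alpha>" "bound (popped \<alpha> k) = bound \<alpha>"
  "agent (popped \<alpha> k) = agent \<alpha>" "target (popped \<alpha> k) = target \<alpha>"
  "first (elim_f (ptr \<alpha>) (scan \<alpha>) X) = elim_f (first (ptr \<alpha>)) (candidate \<alpha>) X"
  by (auto simp: popped_def Let_def first_def elim_f_def candidate_def)

lemma normal_popped: "normal (popped \<alpha> j)"
  unfolding normal_def
proof (intro conjI allI impI)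
  let ?X = "stack \<alpha> ` {j..<depth \<alpha>}" and ?\<beta> = "popped \<alpha> j"
  note t = normalD(7)[OF N]
  note m = tableD(1)[OF t]
  note rot = cycle_rotation
  note jd = cycle_bounds
  note below = cycle_below
  have lle: "rk a (last ?\<beta> a) \<le> rk a (last \<alpha> a)" if "a < n" for a
    using elim_l_le[OF m rot that] by (simp add: popped_simps)
  have fge: "rk a (first (ptr \<alpha>) a) \<le> rk a (first (ptr ?\<beta>) a)" if "a < n" for a
    using elim_f_ge[OF m rot that] by (simp add: popped_simps)
  show "agent ?\<beta> < n" "bound ?\<beta> \<le> n" using normalD[OF N] by (simp_all add: popped_simps)
  fix a assume a: "a < n"
  have q: "scan \<alpha> a \<le> n" if "a \<in> ?X" using cycle_ready that by (auto simp: ready_def)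
  show "1 \<le> ptr ?\<beta> a" "ptr ?\<beta> a \<le> n" "ptr ?\<beta> a < scan ?\<beta> a" "scan ?\<beta> a \<le> n + 1"
    using normalD(3-6)[OF N a] q by (auto simp: popped_simps elim_f_def)
  show "mark ?\<beta> a = (if a \<in> stack ?\<beta> ` {..<depth ?\<beta>} then 1 else 0)"
  proof -
    have "{..<depth \<alpha>} = {..<j} \<union> {j..<depth \<alpha>}" using jd by auto
    then have "stack \<alpha> ` {..<depth \<alpha>} = stack \<alpha> ` {..<j} \<union> ?X" by (simp only: image_Un)
    moreover have "stack \<alpha> ` {..<j} \<inter> ?X = {}" using below by blast
    ultimately show ?thesis
      using normalD(11)[OF N a] unfolding popped_simps elim_f_def by (simp split: if_splits) blast
  qed
  { fix b assume b: "b < n" "ptr ?\<beta> a < rk a b" "rk a b < scan ?\<beta> a"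
    then have "a \<notin> ?X" by (auto simp: popped_simps elim_f_def)
    with b have "rk b (last \<alpha> b) < rk b a"
      using normalD(8)[OF N a b(1)] by (simp add: popped_simps elim_f_def)
    with lle[OF b(1)] show "rk b (last ?\<beta> b) < rk b a" by simp }
  show "\<not> act ?\<beta> (last ?\<beta> a)"
    if "bound ?\<beta> < rk a (last ?\<beta> a) \<or> bound ?\<beta> = rk a (last ?\<beta> a) \<and> a < agent ?\<beta>"
  proof -
    have "bound \<alpha> < rk a (last \<alpha> a) \<or> bound \<alpha> = rk a (last \<alpha> a) \<and> a < agent \<alpha>"
      using that lle[OF a] by (auto simp: popped_simps)
    then have na: "\<not> act \<alpha> (last \<alpha> a)" using normalD(14)[OF N a] by simp
    \<comment> \<open>The last entry of \<open>a\<close> can change only if the old one lies in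
      \<open>X\<close>, but members of \<open>X\<close> are active.\<close>
    have "a \<notin> candidate \<alpha> ` ?X"
    proof
      assume "a \<in> candidate \<alpha> ` ?X"
      then have "last \<alpha> a \<in> ?X" using rotD(3)[OF m rot] by blast
      with na rotation_active[OF t rot] show False by simp
    qed
    then have "last ?\<beta> a = last \<alpha> a" by (simp add: popped_simps elim_l_def)
    with na show ?thesis
      using lle[OF marriageD(2)[OF m a]] fge[OF marriageD(2)[OF m a]] by (simp add: active_def)
  qed
next
  let ?X = "stack \<alpha> ` {j..<depth \<alpha>}" and ?\<beta> = "popped \<alpha> j"
  note t = normalD(7)[OF N]
  note m = tableD(1)[OF t]
  note rot = cycle_rotation
  note jd = cycle_bounds
  note below = cycle_below
  show "table (first (ptr ?\<beta>)) (last ?\<beta>)"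
    using elim_table[OF t rot] by (simp add: popped_simps)
  show "inj_on (stack ?\<beta>) {..<depth ?\<beta>}"
    using inj_on_subset[OF normalD(10)[OF N], of "{..<j}"] jd by (auto simp: popped_simps)
  { fix i assume "i < depth ?\<beta>"
    then show "stack ?\<beta> i < n" using normalD(9)[OF N, of i] jd by (simp add: popped_simps) }
  { fix i assume "Suc i < depth ?\<beta>"
    then have i: "Suc i < j" by (simp add: popped_simps)
    let ?a = "stack \<alpha> i"
    have "?a \<notin> ?X" using below i by simp
    then have c: "scan ?\<beta> ?a = scan \<alpha> ?a" "candidate ?\<beta> ?a = candidate \<alpha> ?a"
      by (simp_all add: popped_simps elim_f_def candidate_def)
    have nx: "last \<alpha> (candidate \<alpha> ?a) = stack \<alpha> (Suc i)" using normalD(13)[OF N, of i] i jd by simp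
    \<comment> \<open>The path edges below position \<open>j\<close> survive: a candidate taken over
      by the cycle had its last entry in the cycle, whereas here it is
      \<open>stack \<alpha> (Suc i)\<close> below \<open>j\<close>. Only the edge into position
      \<open>j\<close> is lost, and its source becomes the tip.\<close>
    have "candidate \<alpha> ?a \<notin> candidate \<alpha> ` ?X"
    proof
      assume "candidate \<alpha> ?a \<in> candidate \<alpha> ` ?X"
      then have "last \<alpha> (candidate \<alpha> ?a) \<in> ?X" using rotD(3)[OF m rot] by auto
      with nx below[OF i] show False by simp
    qed
    then have l: "last ?\<beta> (candidate \<alpha> ?a) = last \<alpha> (candidate \<alpha> ?a)"
      by (simp add: popped_simps elim_l_def)
    show "ready ?\<beta> (stack ?\<beta> i)"
      using normalD(12)[OF N, of i] i jd c l by (simp add: ready_def popped_simps(6))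
    show "last ?\<beta> (candidate ?\<beta> (stack ?\<beta> i)) = stack ?\<beta> (Suc i)"
      using nx c l by (simp add: popped_simps(6)) }
  fix g h assume g: "partition g h"
  from normalD(15)[OF N g] show "compatible ?\<beta> g \<or> beaten ?\<beta> h"
  proof
    assume "beaten \<alpha> h"
    then have "beaten ?\<beta> h"
      by (rule beaten_le) (simp add: popped_simps elim_worst_le[OF t rot])
    then show ?thesis ..
  next
    assume c: "compatible \<alpha> g"
    have moved: "g x \<noteq> first (ptr \<alpha>) x" if "x \<in> ?X" for x
      using c that by (auto simp: compatible_def)
    have ab: "above (first (ptr \<alpha>)) g" using c by (simp add: compatible_def)
    have "flipped (first (ptr \<alpha>)) (candidate \<alpha>) ?X = {}"
      using not_flipped_above[OF t rot g ab moved] by simp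
    then have "\<forall>a<n. \<not> twisted (first (ptr ?\<beta>)) (last ?\<beta>) a"
      using twisted_elim_iff[OF t rot] c by (simp add: popped_simps compatible_def)
    moreover have "above (first (ptr ?\<beta>)) g"
      using elim_above[OF t rot _ ab moved] g unfolding popped_simps partition_def by blast
    moreover have "rk a (last ?\<beta> a) \<le> bound ?\<beta> \<and> (rk a (last ?\<beta> a) = bound ?\<beta> \<longrightarrow> agent ?\<beta> \<le> a)"
      if "a < n" for a
    proof -
      have "rk a (last ?\<beta> a) \<le> rk a (last \<alpha> a)"
        using elim_l_le[OF m rot that] by (simp add: popped_simps)
      with c that show ?thesis by (fastforce simp: compatible_def popped_simps)
    qed
    moreover have "g (stack ?\<beta> i) \<noteq> first (ptr ?\<beta>) (stack ?\<beta> i)" if "i < depth ?\<beta>" for i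
    proof -
      have i: "i < j" using that by (simp add: popped_simps)
      then show ?thesis using c below[OF i] jd by (simp add: popped_simps elim_f_def compatible_def)
    qed
    ultimately have "compatible ?\<beta> g" by (simp add: compatible_def)
    then show ?thesis ..
  qed
qed

end

end

section \<open>Single steps: preservation of the invariant and decrease of the potential\<close>

context preferences
begin

lemma target_indep [simp]:
  "ready (\<alpha>\<lparr>target := v\<rparr>) = ready \<alpha>" "candidate (\<alpha>\<lparr>target := v\<rparr>) = candidate \<alpha>"
  "compatible (\<alpha>\<lparr>target := v\<rparr>) = compatible \<alpha>" "beaten (\<alpha>\<lparr>target := v\<rparr>) = beaten \<alpha>"
  "normal (\<alpha>\<lparr>target := v\<rparr>) = normal \<alpha>"
  by (auto simp: fun_eq_iff ready_def candidate_def compatible_def beaten_def normal_def)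

text \<open>In the middle of an elimination the state is described through the earlier normal state
  \<open>\<beta>\<close>. The condition \<open>0 < bound \<beta>\<close> excludes this case when the
  loop stops at bound 0.\<close>

definition search_inv :: "search \<Rightarrow> bool" where
  "search_inv \<alpha> \<longleftrightarrow> target \<alpha> = n \<and> normal \<alpha> \<or>
     (\<exists>\<beta> j. normal \<beta> \<and> cycle_at \<beta> j \<and> 0 < bound \<beta> \<and> j < depth \<alpha> \<and> depth \<alpha> \<le> depth \<beta> \<and>
        \<alpha> = (popped \<beta> (depth \<alpha>))\<lparr>target := stack \<beta> j\<rparr>)"

text \<open>
  The weights pay for the stack: an agent is pushed only while it is active and off the stack,
  and it is popped either for good or together with an advance of its scan pointer.
\<close>

definition weight :: "search \<Rightarrow> nat \<Rightarrow> nat" where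
  "weight \<alpha> a = 3 * (n + 1 - scan \<alpha> a) +
     (if mark \<alpha> a = 1 then 1 else if ptr \<alpha> a < rk a (last \<alpha> a) then 2 else 0)"

text \<open>The final unit is spent when a cycle is recognised and has to be restored by the last
  pop of its elimination. A popped agent may also turn from weight 1 to weight 2, so with one more
  unit for strict decrease an advance of the scan must be worth 3.\<close>

definition potential :: "search \<Rightarrow> nat" where
  "potential \<alpha> = bound \<alpha> * n + (n - agent \<alpha>) + (\<Sum>a<n. weight \<alpha> a) + (if target \<alpha> = n then 1 else 0)"

lemma sum_weight_less:
  assumes "u < n" "weight \<beta> u + k \<le> weight \<alpha> u" "\<And>a. a < n \<Longrightarrow> a \<noteq> u \<Longrightarrow> weight \<beta> a \<le> weight \<alpha> a"
  shows "(\<Sum>a<n. weight \<beta> a) + k \<le> (\<Sum>a<n. weight \<alpha> a)"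
proof -
  have "(\<Sum>a\<in>{..<n} - {u}. weight \<beta> a) \<le> (\<Sum>a\<in>{..<n} - {u}. weight \<alpha> a)"
    using assms(3) by (intro sum_mono) auto
  with assms(1,2) show ?thesis
    by (simp add: sum.remove[of "{..<n}" u "weight \<beta>"] sum.remove[of "{..<n}" u "weight \<alpha>"])
qed

text \<open>Both kinds of push are instances. At the root, \<open>opt\<close> holds because a
  partition that keeps the worst pair is beaten; further up the path it comes from
  \<open>next_moved\<close>.\<close>

lemma normal_push:
  assumes N: "normal \<alpha>" and x: "x < n" "mark \<alpha> x = 0"
    and path: "0 < depth \<alpha> \<Longrightarrow> ready \<alpha> (stack \<alpha> (depth \<alpha> - 1)) \<and>
      last \<alpha> (candidate \<alpha> (stack \<alpha> (depth \<alpha> - 1))) = x"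
    and opt: "\<And>g h. partition g h \<Longrightarrow> compatible \<alpha> g \<Longrightarrow> g x \<noteq> first (ptr \<alpha>) x \<or> beaten \<alpha> h"
  shows "normal (push x \<alpha>)" "depth \<alpha> < n"
proof -
  let ?\<beta> = "push x \<alpha>"
  have same: "ptr ?\<beta> = ptr \<alpha>" "last ?\<beta> = last \<alpha>" "scan ?\<beta> = scan \<alpha>" "bound ?\<beta> = bound \<alpha>"
    "agent ?\<beta> = agent \<alpha>" "depth ?\<beta> = Suc (depth \<alpha>)" "ready ?\<beta> = ready \<alpha>"
    "candidate ?\<beta> = candidate \<alpha>" "beaten ?\<beta> = beaten \<alpha>"
    "\<And>i. i < depth \<alpha> \<Longrightarrow> stack ?\<beta> i = stack \<alpha> i" "stack ?\<beta> (depth \<alpha>) = x"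
    "mark ?\<beta> = (mark \<alpha>)(x := 1)"
    by (simp_all add: push_def fun_eq_iff ready_def candidate_def beaten_def)
  have xn: "x \<notin> stack \<alpha> ` {..<depth \<alpha>}" using normalD(11)[OF N x(1)] x(2) by (auto split: if_splits)
  have img: "stack ?\<beta> ` {..<depth \<alpha>} = stack \<alpha> ` {..<depth \<alpha>}"
    using same(10) by (intro image_cong) auto
  have "card (stack \<alpha> ` {..<depth \<alpha>}) < card {..<n}"
    using xn x normalD(9)[OF N] by (intro psubset_card_mono) auto
  then show "depth \<alpha> < n" using normalD(10)[OF N] by (simp add: card_image)
  have comp: "compatible ?\<beta> g \<or> beaten \<alpha> h" if "partition g h" for g h
    using normalD(15)[OF N that] opt[OF that] same(1-6,10,11)
    by (auto simp: compatible_def less_Suc_eq)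
  show "normal ?\<beta>"
    unfolding normal_def same(1-9)
  proof (intro conjI allI impI)
    show "inj_on (stack ?\<beta>) {..<Suc (depth \<alpha>)}"
      unfolding lessThan_Suc inj_on_insert img same(11)
      using xn normalD(10)[OF N] same(10) by (auto simp: inj_on_def)
    show "mark ?\<beta> a = (if a \<in> stack ?\<beta> ` {..<Suc (depth \<alpha>)} then 1 else 0)" if "a < n" for a
      unfolding lessThan_Suc image_insert img same(11,12) using normalD(11)[OF N that] by auto
    show "stack ?\<beta> i < n" if "i < Suc (depth \<alpha>)" for i
      using that normalD(9)[OF N] x same(10,11) by (auto simp: less_Suc_eq)
    show "ready \<alpha> (stack ?\<beta> i)" "last \<alpha> (candidate \<alpha> (stack ?\<beta> i)) = stack ?\<beta> (Suc i)"
      if "Suc i < Suc (depth \<alpha>)" for i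
    proof -
      note i = that
      consider "Suc i < depth \<alpha>" | "Suc i = depth \<alpha>" "i = depth \<alpha> - 1" "0 < depth \<alpha>"
        using i by linarith
      then have "ready \<alpha> (stack ?\<beta> i) \<and> last \<alpha> (candidate \<alpha> (stack ?\<beta> i)) = stack ?\<beta> (Suc i)"
      proof cases
        case 1
        then show ?thesis using normalD(12,13)[OF N 1] by (simp add: same(10))
      next
        case 2
        then have "stack ?\<beta> i = stack \<alpha> (depth \<alpha> - 1)" using same(10)[of i] by simp
        with path[OF 2(3)] same(11) 2(1) show ?thesis by simp
      qed
      then show "ready \<alpha> (stack ?\<beta> i)" "last \<alpha> (candidate \<alpha> (stack ?\<beta> i)) = stack ?\<beta> (Suc i)"
        by auto
    qed
    show "compatible ?\<beta> g \<or> beaten \<alpha> h" if "partition g h" for g h by (rule comp[OF that])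
  qed (use N[unfolded normal_def] in blast)+
qed

lemma sum_weight_push:
  assumes "x < n" "mark \<alpha> x = 0" "ptr \<alpha> x < rk x (last \<alpha> x)"
  shows "(\<Sum>a<n. weight (push x \<alpha>) a) + 1 \<le> (\<Sum>a<n. weight \<alpha> a)"
  by (rule sum_weight_less[OF assms(1)]) (use assms in \<open>auto simp: weight_def push_def\<close>)

text \<open>The bounds that keep all memory accesses of one step inside their rows.\<close>

definition in_range :: "search \<Rightarrow> bool" where
  "in_range \<alpha> \<longleftrightarrow>
     (\<forall>a<n. last \<alpha> a < n \<and> 1 \<le> scan \<alpha> a \<and> scan \<alpha> a \<le> n + 1) \<and>
     agent \<alpha> < n \<and> target \<alpha> \<le> n \<and> depth \<alpha> \<le> n \<and> (\<forall>i<depth \<alpha>. stack \<alpha> i < n) \<and>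
     (target \<alpha> < n \<longrightarrow> 0 < depth \<alpha>) \<and>
     (let u = stack \<alpha> (depth \<alpha> - 1) in
      (target \<alpha> < n \<longrightarrow> scan \<alpha> u \<le> n) \<and>
      (target \<alpha> = n \<longrightarrow> 0 < depth \<alpha> \<longrightarrow> ptr \<alpha> u < rk u (last \<alpha> u) \<longrightarrow> scan \<alpha> u \<le> n) \<and>
      (target \<alpha> = n \<longrightarrow> 0 < depth \<alpha> \<longrightarrow> ptr \<alpha> u < rk u (last \<alpha> u) \<longrightarrow>
        \<not> rk (pr u (scan \<alpha> u)) (last \<alpha> (pr u (scan \<alpha> u))) < rk (pr u (scan \<alpha> u)) u \<longrightarrow>
        mark \<alpha> (last \<alpha> (pr u (scan \<alpha> u))) = 0 \<longrightarrow> depth \<alpha> < n))"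

context
  fixes \<alpha>
  assumes N: "normal \<alpha>" and e: "target \<alpha> = n" and pos: "0 < bound \<alpha>"
begin

private lemmas normal_table = normalD(7)[OF N]
private lemmas normal_marriage = tableD(1)[OF normal_table]

text \<open>If the predecessor \<open>x\<close> of the worst pair is inactive, its entry in a
  compatible partition is squeezed between its first and last ones. The partition keeps the pair,
  and the table has already reached its regret.\<close>

lemma next_agent:
  assumes d: "depth \<alpha> = 0"
    and skip: "\<not> (rk (agent \<alpha>) (last \<alpha> (agent \<alpha>)) = bound \<alpha> \<and> act \<alpha> (last \<alpha> (agent \<alpha>)))"
  defines "\<beta> \<equiv> if agent \<alpha> + 1 = n then \<alpha>\<lparr>bound := bound \<alpha> - 1, agent := 0\<rparr>
    else \<alpha>\<lparr>agent := agent \<alpha> + 1\<rparr>"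
  shows "normal \<beta>"
proof -
  have ln: "last \<alpha> a < n" if "a < n" for a using marriageD(2)[OF normal_marriage that] .
  have same: "ptr \<beta> = ptr \<alpha>" "last \<beta> = last \<alpha>" "scan \<beta> = scan \<alpha>" "mark \<beta> = mark \<alpha>"
    "stack \<beta> = stack \<alpha>" "depth \<beta> = 0" "ready \<beta> = ready \<alpha>"
    "candidate \<beta> = candidate \<alpha>" "beaten \<beta> = beaten \<alpha>"
    using d by (simp_all add: \<beta>_def fun_eq_iff ready_def candidate_def beaten_def)
  \<comment> \<open>Both branches are the same move in the lexicographic order of falling bound and
    rising agent, so they need no separate treatment below.\<close>
  have b: "bound \<beta> < k \<or> bound \<beta> = k \<and> a < agent \<beta> \<longleftrightarrow>
      bound \<alpha> < k \<or> bound \<alpha> = k \<and> a \<le> agent \<alpha>" if "a < n" for a k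
    using that pos by (auto simp: \<beta>_def)
  show ?thesis
    unfolding normal_def same
  proof (intro conjI allI impI)
    show "agent \<beta> < n" "bound \<beta> \<le> n" using normalD(1,2)[OF N] by (auto simp: \<beta>_def)
    show "\<not> act \<alpha> (last \<alpha> a)"
      if "a < n" "bound \<beta> < rk a (last \<alpha> a) \<or> bound \<beta> = rk a (last \<alpha> a) \<and> a < agent \<beta>" for a
      using that(2) skip normalD(14)[OF N that(1)] unfolding b[OF that(1)]
      by (cases "a = agent \<alpha>") auto
    show "mark \<alpha> a = (if a \<in> stack \<alpha> ` {..<0} then 1 else 0)" if "a < n" for a
      using normalD(11)[OF N that] d by simp
    fix g h assume g: "partition g h"
    show "compatible \<beta> g \<or> beaten \<alpha> h"
      using normalD(15)[OF N g]
    proof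
      assume c: "compatible \<alpha> g"
      show ?thesis
      proof (cases "rk (agent \<alpha>) (last \<alpha> (agent \<alpha>)) = bound \<alpha>")
        case True
        let ?y = "agent \<alpha>" and ?x = "last \<alpha> (agent \<alpha>)"
        note y = normalD(1)[OF N]
        note my = marriageD[OF normal_marriage y]
        have gm: "marriage g h" and gx: "rk ?x (g ?x) \<le> rk ?x (h ?x)"
          using g my by (auto simp: partition_def)
        have "rk ?x (first (ptr \<alpha>) ?x) \<le> rk ?x (g ?x)" using c my(2) unfolding compatible_def above_def by blast
        moreover have "rk ?x (h ?x) \<le> rk ?x (last \<alpha> ?x)"
          using above_converse[OF normal_marriage gm _ my(2)] c by (simp add: compatible_def)
        moreover have "rk ?x (last \<alpha> ?x) \<le> rk ?x (first (ptr \<alpha>) ?x)"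
          using True skip by (simp add: active_def)
        ultimately have "rk ?x (g ?x) = rk ?x (first (ptr \<alpha>) ?x)" using gx by simp
        then have "g ?x = ?y" using my marriageD[OF gm my(2)] y by simp
        with compatible_beaten[OF N g c y True] show ?thesis by simp
      next
        case False
        have "rk a (last \<alpha> a) \<le> bound \<beta> \<and> (rk a (last \<alpha> a) = bound \<beta> \<longrightarrow> agent \<beta> \<le> a)"
          if "a < n" for a
        proof -
          have "\<not> (bound \<alpha> < rk a (last \<alpha> a) \<or> bound \<alpha> = rk a (last \<alpha> a) \<and> a \<le> agent \<alpha>)"
            using c that False unfolding compatible_def by (metis le_antisym not_less)
          then show ?thesis unfolding b[OF that, symmetric] by auto
        qed
        with c show ?thesis unfolding compatible_def same by simp
      qed
    qed simp
  qed (use N[unfolded normal_def] in \<open>simp | blast\<close>)+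
qed

lemma root_opt:
  assumes "rk (agent \<alpha>) (last \<alpha> (agent \<alpha>)) = bound \<alpha>" "partition g h" "compatible \<alpha> g"
  shows "g (last \<alpha> (agent \<alpha>)) \<noteq> first (ptr \<alpha>) (last \<alpha> (agent \<alpha>)) \<or> beaten \<alpha> h"
  using compatible_beaten[OF N assms(2,3) normalD(1)[OF N] assms(1)]
    marriageD(4)[OF normal_marriage normalD(1)[OF N]] by metis

context
  assumes d: "0 < depth \<alpha>"
begin

abbreviation "tip \<equiv> stack \<alpha> (depth \<alpha> - 1)"

lemma tip_less: "tip < n"
  using normalD(9)[OF N] d by simp

lemma tip_mark: "mark \<alpha> tip = 1"
  using normalD(11)[OF N tip_less] d by auto

lemma tip_only: "i < depth \<alpha> - 1 \<Longrightarrow> stack \<alpha> i \<noteq> tip"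
  using inj_onD[OF normalD(10)[OF N], of i "depth \<alpha> - 1"] by force

lemma tip_scan_le: "act \<alpha> tip \<Longrightarrow> scan \<alpha> tip \<le> n"
  using scan_le[OF N tip_less] rk_le_n[OF tip_less marriageD(2)[OF normal_marriage tip_less]] by simp

lemma normal_pop: "normal (\<alpha>\<lparr>mark := (mark \<alpha>)(tip := 0), depth := depth \<alpha> - 1\<rparr>)"
  (is "normal ?\<beta>")
proof -
  have same: "ready ?\<beta> = ready \<alpha>" "candidate ?\<beta> = candidate \<alpha>" "beaten ?\<beta> = beaten \<alpha>"
    by (simp_all add: fun_eq_iff ready_def candidate_def beaten_def)
  have img: "stack \<alpha> ` {..<depth \<alpha>} = insert tip (stack \<alpha> ` {..<depth \<alpha> - 1})"
    using d lessThan_Suc[of "depth \<alpha> - 1"] by simp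
  have tn: "tip \<notin> stack \<alpha> ` {..<depth \<alpha> - 1}" using tip_only by (metis imageE lessThan_iff)
  show ?thesis
    unfolding normal_def same
  proof (intro conjI allI impI, goal_cases)
    case (11 a)
    then show ?case using normalD(11)[OF N] img tn by simp
  next
    case 10
    then show ?case using inj_on_subset[OF normalD(10)[OF N]] by auto
  next
    case (15 g h)
    then have "partition g h" by simp
    from normalD(15)[OF N this] show ?case by (auto simp: compatible_def)
  qed (use normalD[OF N] in auto)
qed

lemma normal_advance:
  assumes ac: "act \<alpha> tip"
    and far: "rk (candidate \<alpha> tip) (last \<alpha> (candidate \<alpha> tip)) < rk (candidate \<alpha> tip) tip"
  shows "normal (\<alpha>\<lparr>scan := (scan \<alpha>)(tip := scan \<alpha> tip + 1)\<rparr>)" (is "normal ?\<beta>")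
proof -
  have same: "agent ?\<beta> = agent \<alpha>" "bound ?\<beta> = bound \<alpha>" "ptr ?\<beta> = ptr \<alpha>" "last ?\<beta> = last \<alpha>"
    "stack ?\<beta> = stack \<alpha>" "depth ?\<beta> = depth \<alpha>" "mark ?\<beta> = mark \<alpha>"
    "beaten ?\<beta> = beaten \<alpha>" "compatible ?\<beta> = compatible \<alpha>"
    by (simp_all add: fun_eq_iff beaten_def compatible_def)
  have path: "ready ?\<beta> (stack \<alpha> i) = ready \<alpha> (stack \<alpha> i)"
    "candidate ?\<beta> (stack \<alpha> i) = candidate \<alpha> (stack \<alpha> i)" if "Suc i < depth \<alpha>" for i
    using tip_only[of i] that by (auto simp: ready_def candidate_def)
  have sc: "rk b (last \<alpha> b) < rk b a"
    if "a < n" "b < n" "ptr \<alpha> a < rk a b" "rk a b < scan ?\<beta> a" for a b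
  proof (cases "a = tip \<and> rk a b = scan \<alpha> tip")
    case True
    then have "b = candidate \<alpha> tip" using pr_rk[OF that(1,2)] by (metis candidate_def)
    with far True show ?thesis by simp
  next
    case False
    then have "rk a b < scan \<alpha> a" using that(4) by (auto split: if_splits)
    with normalD(8)[OF N that(1-3)] show ?thesis by simp
  qed
  show ?thesis
    unfolding normal_def same
  proof (intro conjI allI impI, goal_cases)
    case (8 a b)
    then show ?case using sc[of a b] by simp
  next
    case (12 i)
    then show ?case using normalD(12)[OF N, of i] path[of i] by simp
  next
    case (13 i)
    then show ?case using normalD(13)[OF N, of i] path[of i] by simp
  next
    case (6 a)
    then show ?case using normalD(6)[OF N] tip_scan_le[OF ac] by simp
  next
    case (5 a)
    then show ?case using normalD(5)[OF N, of a] by auto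
  qed (use N[unfolded normal_def] in blast)+
qed

lemma candidate_opt:
  assumes ac: "act \<alpha> tip" and rd: "ready \<alpha> tip" and g: "partition g h" and c: "compatible \<alpha> g"
  shows "g (last \<alpha> (candidate \<alpha> tip)) \<noteq> first (ptr \<alpha>) (last \<alpha> (candidate \<alpha> tip))"
proof (rule next_moved(2)[OF normal_marriage, where x = tip])
  note cn = candidate_less[OF N tip_less tip_scan_le[OF ac]]
  show "marriage g h" using g by (simp add: partition_def)
  show "above (first (ptr \<alpha>)) g" using c by (simp add: compatible_def)
  show "tip < n" by (rule tip_less)
  show "g tip \<noteq> first (ptr \<alpha>) tip" using c d by (simp add: compatible_def)
  show "candidate \<alpha> tip < n" by (rule cn)
  show "rk tip (first (ptr \<alpha>) tip) < rk tip (candidate \<alpha> tip)"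
    using cn rk_first[OF N tip_less] normalD(5)[OF N tip_less] by simp
  show "rk (candidate \<alpha> tip) tip \<le> rk (candidate \<alpha> tip) (last \<alpha> (candidate \<alpha> tip))"
    using rd by (simp add: ready_def)
  show "rk b (last \<alpha> b) < rk b tip"
    if "b < n" "rk tip (first (ptr \<alpha>) tip) < rk tip b" "rk tip b < rk tip (candidate \<alpha> tip)" for b
    using normalD(8)[OF N tip_less that(1)] that cn rk_first[OF N tip_less] by simp
qed

lemma candidate_active:
  assumes ac: "act \<alpha> tip" and rd: "ready \<alpha> tip"
  shows "act \<alpha> (last \<alpha> (candidate \<alpha> tip))" "last \<alpha> (candidate \<alpha> tip) < n"
proof -
  note cn = candidate_less[OF N tip_less tip_scan_le[OF ac]]
  show "last \<alpha> (candidate \<alpha> tip) < n" by (rule marriageD(2)[OF normal_marriage cn(1)])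
  show "act \<alpha> (last \<alpha> (candidate \<alpha> tip))"
    by (rule next_active[OF normal_table tip_less ac cn(1)])
      (use cn rk_first[OF N tip_less] normalD(5)[OF N tip_less] scan_le[OF N tip_less ac] rd
        in \<open>auto simp: ready_def\<close>)
qed

end

lemma normal_in_range: "in_range \<alpha>"
proof -
  have "depth \<alpha> < n"
    if "0 < depth \<alpha>" "act \<alpha> tip" "ready \<alpha> tip" "mark \<alpha> (last \<alpha> (candidate \<alpha> tip)) = 0"
    using normal_push(2)[OF N candidate_active(2)[OF that(1-3)] that(4)] candidate_opt[OF that(1-3)]
      that by blast
  moreover have "ptr \<alpha> tip < rk tip (last \<alpha> tip) \<longleftrightarrow> act \<alpha> tip" if "0 < depth \<alpha>"
    using act_iff[OF N tip_less[OF that]] by simp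
  moreover have "1 \<le> scan \<alpha> a \<and> scan \<alpha> a \<le> n + 1" if "a < n" for a
    using normalD(5,6)[OF N that] by linarith
  ultimately show ?thesis
    unfolding in_range_def Let_def e
    using normalD(1)[OF N] normalD(9)[OF N] marriageD(2)[OF normal_marriage] depth_le[OF N] tip_scan_le
    by (intro conjI allI impI) (auto simp: ready_def candidate_def not_less)
qed

lemma normal_step: "search_inv (step \<alpha>)" "potential (step \<alpha>) < potential \<alpha>"
proof -
  note an = normalD(1)[OF N]
  have "search_inv (step \<alpha>) \<and> potential (step \<alpha>) < potential \<alpha>"
  proof (cases "depth \<alpha> = 0")
    case d: True
    let ?x = "last \<alpha> (agent \<alpha>)"
    have xn: "?x < n" using marriageD(2)[OF normal_marriage an] .
    show ?thesis
    proof (cases "rk (agent \<alpha>) ?x = bound \<alpha> \<and> act \<alpha> ?x")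
      case True
      then have st: "step \<alpha> = push ?x \<alpha>"
        using d e act_iff[OF N xn] by (simp add: step_def Let_def)
      have mk: "mark \<alpha> ?x = 0" using normalD(11)[OF N xn] d by simp
      have "normal (push ?x \<alpha>)"
        by (rule normal_push(1)[OF N xn mk]) (use d root_opt True in auto)
      moreover have "(\<Sum>a<n. weight (push ?x \<alpha>) a) + 1 \<le> (\<Sum>a<n. weight \<alpha> a)"
        by (rule sum_weight_push[OF xn mk]) (use True act_iff[OF N xn] in simp)
      ultimately show ?thesis
        using e by (simp add: st search_inv_def potential_def push_def)
    next
      case False
      then have st: "step \<alpha> = (if agent \<alpha> + 1 = n then \<alpha>\<lparr>bound := bound \<alpha> - 1, agent := 0\<rparr>
          else \<alpha>\<lparr>agent := agent \<alpha> + 1\<rparr>)"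
        using d e act_iff[OF N xn] by (auto simp: step_def Let_def)
      have "normal (step \<alpha>)" using next_agent[OF d False] st by simp
      moreover have "target (step \<alpha>) = n" using e by (simp add: st)
      moreover have "weight (step \<alpha>) = weight \<alpha>" by (simp add: st fun_eq_iff weight_def)
      moreover have "bound (step \<alpha>) * n + (n - agent (step \<alpha>)) < bound \<alpha> * n + (n - agent \<alpha>)"
        using an pos by (cases "bound \<alpha>") (auto simp: st)
      ultimately show ?thesis using e by (simp add: search_inv_def potential_def)
    qed
  next
    case False
    then have d: "0 < depth \<alpha>" by simp
    note tn = tip_less[OF d]
    show ?thesis
    proof (cases "act \<alpha> tip")
      case False
      then have st: "step \<alpha> = \<alpha>\<lparr>mark := (mark \<alpha>)(tip := 0), depth := depth \<alpha> - 1\<rparr>"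
        using d e act_iff[OF N tn] by (simp add: step_def Let_def)
      have "(\<Sum>a<n. weight (step \<alpha>) a) + 1 \<le> (\<Sum>a<n. weight \<alpha> a)"
        by (rule sum_weight_less[OF tn])
          (use False act_iff[OF N tn] tip_mark[OF d] in \<open>auto simp: st weight_def\<close>)
      with normal_pop[OF d] e show ?thesis by (simp add: st search_inv_def potential_def)
    next
      case ac: True
      note cn = candidate_less[OF N tn tip_scan_le[OF d ac]]
      show ?thesis
      proof (cases "ready \<alpha> tip")
        case False
        then have far: "rk (candidate \<alpha> tip) (last \<alpha> (candidate \<alpha> tip)) < rk (candidate \<alpha> tip) tip"
          using tip_scan_le[OF d ac] by (simp add: ready_def)
        then have st: "step \<alpha> = \<alpha>\<lparr>scan := (scan \<alpha>)(tip := scan \<alpha> tip + 1)\<rparr>"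
          using d e ac act_iff[OF N tn] by (simp add: step_def Let_def candidate_def)
        have "(\<Sum>a<n. weight (step \<alpha>) a) + 1 \<le> (\<Sum>a<n. weight \<alpha> a)"
          by (rule sum_weight_less[OF tn])
            (use tip_scan_le[OF d ac] in \<open>auto simp: st weight_def\<close>)
        with normal_advance[OF d ac far] e show ?thesis
          by (simp add: st search_inv_def potential_def)
      next
        case rd: True
        let ?v = "last \<alpha> (candidate \<alpha> tip)"
        note va = candidate_active[OF d ac rd]
        have close: "\<not> rk (candidate \<alpha> tip) ?v < rk (candidate \<alpha> tip) tip"
          using rd by (simp add: ready_def)
        show ?thesis
        proof (cases "mark \<alpha> ?v = 0")
          case mk: True
          with close have st: "step \<alpha> = push ?v \<alpha>"
            using d e ac act_iff[OF N tn] by (simp add: step_def Let_def candidate_def)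
          have "normal (push ?v \<alpha>)"
            by (rule normal_push(1)[OF N va(2) mk]) (use rd candidate_opt[OF d ac rd] in auto)
          moreover have "(\<Sum>a<n. weight (push ?v \<alpha>) a) + 1 \<le> (\<Sum>a<n. weight \<alpha> a)"
            by (rule sum_weight_push[OF va(2) mk]) (use va act_iff[OF N va(2)] in simp)
          ultimately show ?thesis
            using e by (simp add: st search_inv_def potential_def push_def)
        next
          case mk: False
          with close have st: "step \<alpha> = \<alpha>\<lparr>target := ?v\<rparr>"
            using d e ac act_iff[OF N tn] by (simp add: step_def Let_def candidate_def)
          from mk obtain j where j: "j < depth \<alpha>" "?v = stack \<alpha> j"
            using normalD(11)[OF N va(2)] by (auto split: if_splits)
          have "cycle_at \<alpha> j" using j ac rd by (simp add: cycle_at_def)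
          moreover have "popped \<alpha> (depth \<alpha>) = \<alpha>"
            by (simp add: popped_def elim_f_def[abs_def] elim_l_def[abs_def])
          ultimately have "search_inv (step \<alpha>)"
            unfolding search_inv_def using N pos j by (intro disjI2 exI[of _ \<alpha>] exI[of _ j]) (simp add: st)
          moreover have "weight (step \<alpha>) = weight \<alpha>" by (simp add: st fun_eq_iff weight_def)
          ultimately show ?thesis using va(2) e by (simp add: st potential_def)
        qed
      qed
    qed
  qed
  then show "search_inv (step \<alpha>)" "potential (step \<alpha>) < potential \<alpha>" by auto
qed

end

lemma elim_f_insert: "elim_f f s (insert u X) = (elim_f f s X)(u := s u)"
  by (auto simp: elim_f_def)

text \<open>A pop adds one agent to the eliminated set; thus the single assignments of the program
  compose to the simultaneous elimination.\<close>

lemma elim_l_insert: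
  assumes "inj_on s (insert u X)"
  shows "elim_l l s (insert u X) = (elim_l l s X)(s u := u)"
proof
  fix b
  show "elim_l l s (insert u X) b = ((elim_l l s X)(s u := u)) b"
  proof (cases "b \<in> s ` X")
    case True
    then obtain c where c: "c \<in> X" "b = s c" by auto
    have "inv_into (insert u X) s b = c" "inv_into X s b = c"
      using assms c by (auto intro!: inv_into_f_eq intro: inj_on_subset)
    moreover have "b = s u \<Longrightarrow> c = u" using assms c by (auto simp: inj_on_def)
    ultimately show ?thesis using True by (auto simp: elim_l_def)
  next
    case False
    then show ?thesis using inv_into_f_f[OF assms, of u] by (auto simp: elim_l_def)
  qed
qed

context
  fixes \<alpha> \<beta> j k
  assumes N: "normal \<beta>" and cyc: "cycle_at \<beta> j" and pos: "0 < bound \<beta>"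
    and k: "j \<le> k" "Suc k \<le> depth \<beta>"
    and \<alpha>: "\<alpha> = (popped \<beta> (Suc k))\<lparr>target := stack \<beta> j\<rparr>"
begin

private abbreviation "u \<equiv> stack \<beta> k"
private abbreviation "X \<equiv> stack \<beta> ` {Suc k..<depth \<beta>}"

private lemma u: "u < n" "u \<notin> X" "insert u X = stack \<beta> ` {k..<depth \<beta>}" "u = stack \<beta> j \<longleftrightarrow> k = j"
proof -
  show "u < n" using normalD(9)[OF N] k by simp
  show "u \<notin> X"
    using inj_on_image_mem_iff[OF normalD(10)[OF N], of k "{Suc k..<depth \<beta>}"] k by force
  have "{k..<depth \<beta>} = insert k {Suc k..<depth \<beta>}" using k by auto
  then show "insert u X = stack \<beta> ` {k..<depth \<beta>}" by simp
  show "u = stack \<beta> j \<longleftrightarrow> k = j"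
    using inj_onD[OF normalD(10)[OF N], of k j] k by auto
qed

private lemma X_inj: "inj_on (candidate \<beta>) (insert u X)"
  by (rule inj_on_subset[OF cycle_inj[OF N cyc]]) (use u(3) k in auto)

private lemma target_less: "stack \<beta> j < n"
  using normalD(9)[OF N] k by simp

private lemma cand: "scan \<beta> u \<le> n" "candidate \<beta> u < n"
  using cycle_ready[OF N cyc, of k] cycle_candidate[OF N cyc, of k] k by (auto simp: ready_def)

lemma elim_fields:
  "depth \<alpha> = Suc k" "stack \<alpha> = stack \<beta>" "target \<alpha> = stack \<beta> j" "scan \<alpha> u = scan \<beta> u"
  "bound \<alpha> = bound \<beta>" "agent \<alpha> = agent \<beta>" "ptr \<alpha> = elim_f (ptr \<beta>) (scan \<beta>) X"
  "last \<alpha> = elim_l (last \<beta>) (candidate \<beta>) X" "mark \<alpha> = elim_f (mark \<beta>) (\<lambda>a. 0) X"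
  "scan \<alpha> = elim_f (scan \<beta>) (\<lambda>a. scan \<beta> a + 1) X"
  using u by (simp_all add: \<alpha> popped_simps[OF N cyc] elim_f_def)

lemma elim_step_fields:
  "step \<alpha> = \<alpha>\<lparr>ptr := (ptr \<alpha>)(u := scan \<beta> u), last := (last \<alpha>)(candidate \<beta> u := u),
     scan := (scan \<alpha>)(u := scan \<beta> u + 1), mark := (mark \<alpha>)(u := 0),
     depth := k, target := if k = j then n else stack \<beta> j\<rparr>"
  using target_less u(4) by (simp add: step_def Let_def elim_fields(1-4) candidate_def)

lemma elim_step: "step \<alpha> = (popped \<beta> k)\<lparr>target := if k = j then n else stack \<beta> j\<rparr>"
  unfolding elim_step_fields
  by (rule search.equality)
    (simp_all add: elim_fields popped_simps[OF N cyc] u(3)[symmetric] elim_f_insert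
      elim_l_insert[OF X_inj])

lemma elim_search_inv: "search_inv (step \<alpha>)"
proof (cases "k = j")
  case True
  then show ?thesis using normal_popped[OF N cyc] by (simp add: elim_step search_inv_def)
next
  case False
  then show ?thesis unfolding search_inv_def
    by (intro disjI2 exI[of _ \<beta>] exI[of _ j]) (use N cyc pos k in \<open>simp add: elim_step popped_simps[OF N cyc]\<close>)
qed

private lemma last_other: "candidate \<beta> u \<notin> candidate \<beta> ` X"
  using inj_on_image_mem_iff[OF X_inj, of u X] u(2) by auto

lemma elim_potential: "potential (step \<alpha>) < potential \<alpha>"
proof -
  let ?b = "candidate \<beta> u"
  note st = elim_step_fields
  have le: "rk ?b u \<le> rk ?b (last \<alpha> ?b)"
    using cycle_ready[OF N cyc, of k] k last_other by (simp add: elim_fields elim_l_def ready_def)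
  have mk: "mark \<alpha> u = 1"
    using normalD(11)[OF N u(1)] u(2) k by (auto simp: elim_fields elim_f_def)
  \<comment> \<open>The scan pointer yields 3, and losing the mark costs at most 1. Of the remaining
    2 one may go into resetting the target.\<close>
  have "(\<Sum>a<n. weight (step \<alpha>) a) + 2 \<le> (\<Sum>a<n. weight \<alpha> a)"
  proof (rule sum_weight_less[OF u(1)])
    show "weight (step \<alpha>) u + 2 \<le> weight \<alpha> u"
      using cand(1) mk by (simp add: weight_def st elim_fields(4) Suc_diff_le)
    \<comment> \<open>The last entry of the candidate only improves, so no other agent becomes
      active.\<close>
    show "weight (step \<alpha>) a \<le> weight \<alpha> a" if "a < n" "a \<noteq> u" for a
      using that le by (auto simp: weight_def st)
  qed
  moreover have "bound (step \<alpha>) = bound \<alpha>" "agent (step \<alpha>) = agent \<alpha>" by (simp_all add: st)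
  ultimately show ?thesis by (simp add: potential_def)
qed

lemma elim_in_range: "in_range \<alpha>"
proof -
  have l: "last \<alpha> a < n" if "a < n" for a
  proof (cases "a \<in> candidate \<beta> ` X")
    case True
    then have "inv_into X (candidate \<beta>) a \<in> X" by (rule inv_into_into)
    moreover have "X \<subseteq> {..<n}" using normalD(9)[OF N] by auto
    ultimately show ?thesis using True by (auto simp: elim_fields elim_l_def)
  next
    case False
    then show ?thesis
      using marriageD(2)[OF tableD(1)[OF normalD(7)[OF N]] that] by (simp add: elim_fields elim_l_def)
  qed
  have s: "1 \<le> scan \<alpha> a \<and> scan \<alpha> a \<le> n + 1" if "a < n" for a
  proof -
    have "a \<in> X \<Longrightarrow> scan \<beta> a \<le> n" using cycle_ready[OF N cyc] by (auto simp: ready_def)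
    then show ?thesis
      using normalD(3,5,6)[OF N that] by (auto simp: elim_fields elim_f_def)
  qed
  show ?thesis
    using l s normalD(1,9)[OF N] depth_le[OF N] less_imp_le[OF target_less]
      less_imp_neq[OF target_less] less_imp_neq[OF target_less, symmetric] cand k
    by (auto simp: in_range_def elim_fields(1-6) Let_def)
qed

end

lemma search_step:
  assumes "search_inv \<alpha>" "0 < bound \<alpha>"
  shows "in_range \<alpha>" "search_inv (step \<alpha>)" "potential (step \<alpha>) < potential \<alpha>"
proof -
  from assms(1) consider "target \<alpha> = n" "normal \<alpha>"
    | \<beta> j where "normal \<beta>" "cycle_at \<beta> j" "0 < bound \<beta>" "j < depth \<alpha>" "depth \<alpha> \<le> depth \<beta>"
        "\<alpha> = (popped \<beta> (depth \<alpha>))\<lparr>target := stack \<beta> j\<rparr>"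
    unfolding search_inv_def by blast
  then have "in_range \<alpha> \<and> search_inv (step \<alpha>) \<and> potential (step \<alpha>) < potential \<alpha>"
  proof cases
    case 1
    then show ?thesis using normal_in_range normal_step assms(2) by blast
  next
    case (2 \<beta> j)
    then obtain k where k: "depth \<alpha> = Suc k" by (cases "depth \<alpha>") auto
    have h: "j \<le> k" "Suc k \<le> depth \<beta>" "\<alpha> = (popped \<beta> (Suc k))\<lparr>target := stack \<beta> j\<rparr>"
      using 2(4,5) k 2(6)[unfolded k] by auto
    show ?thesis
      by (intro conjI elim_in_range[OF 2(1-3) h] elim_search_inv[OF 2(1-3) h] elim_potential[OF 2(1-3) h])
  qed
  then show "in_range \<alpha>" "search_inv (step \<alpha>)" "potential (step \<alpha>) < potential \<alpha>" by auto
qed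

text \<open>Ranks start at 1. At bound 0 every last entry is therefore beyond the bound, which makes
  every agent inactive and \<open>compatible\<close> impossible.\<close>

lemma search_done:
  assumes "search_inv \<alpha>" "bound \<alpha> = 0"
  shows "table (first (ptr \<alpha>)) (last \<alpha>)" "\<And>a. a < n \<Longrightarrow> \<not> act \<alpha> a"
    "\<And>g h. partition g h \<Longrightarrow> beaten \<alpha> h" "\<And>a. a < n \<Longrightarrow> 1 \<le> ptr \<alpha> a \<and> ptr \<alpha> a \<le> n"
proof -
  have N: "normal \<alpha>"
  proof -
    have False if "normal \<beta>" "cycle_at \<beta> j" "0 < bound \<beta>"
      "\<alpha> = (popped \<beta> (depth \<alpha>))\<lparr>target := stack \<beta> j\<rparr>" for \<beta> j
    proof -
      have "bound \<alpha> = bound \<beta>" by (subst that(4)) (simp add: popped_simps[OF that(1,2)])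
      with that(3) assms(2) show False by simp
    qed
    then show ?thesis using assms(1) unfolding search_inv_def by blast
  qed
  note m = tableD(1)[OF normalD(7)[OF N]]
  show "table (first (ptr \<alpha>)) (last \<alpha>)" by (rule normalD(7)[OF N])
  show "1 \<le> ptr \<alpha> a \<and> ptr \<alpha> a \<le> n" if "a < n" for a using normalD(3,4)[OF N that] by simp
  show "\<not> act \<alpha> a" if "a < n" for a
  proof -
    note ma = marriageD[OF m that]
    have "0 < rk (first (ptr \<alpha>) a) (last \<alpha> (first (ptr \<alpha>) a))"
      using rk_ge_1[OF ma(1)] ma that by (simp add: Suc_le_eq)
    with normalD(14)[OF N ma(1)] ma assms(2) show ?thesis by simp
  qed
  fix g h assume g: "partition g h"
  have "\<not> compatible \<alpha> g"
  proof
    assume "compatible \<alpha> g"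
    then have "rk (agent \<alpha>) (last \<alpha> (agent \<alpha>)) = 0"
      using assms(2) normalD(1)[OF N] by (simp add: compatible_def)
    then show False using rk_ge_1[OF normalD(1)[OF N] marriageD(2)[OF m normalD(1)[OF N]]] by simp
  qed
  with normalD(15)[OF N g] show "beaten \<alpha> h" by simp
qed

end

section \<open>The man-optimal marriage as the starting point of the search\<close>

record courtship =
  cptr :: "nat \<Rightarrow> nat"
  holder :: "nat \<Rightarrow> nat"
  cscan :: "nat \<Rightarrow> nat"
  entered :: nat
  free :: nat

context preferences
begin

text \<open>
  The proposals of Gale and Shapley in the order of McVitie and Wilson: agents enter one after
  the other, and there is a single free man at any time. A woman \<^term>\<open>b\<close> without a proposal has
  \<^term>\<open>holder \<gamma> b = n\<close>.
\<close>

definition propose :: "courtship \<Rightarrow> courtship" where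
  "propose \<gamma> =
     (let a = free \<gamma>; b = pr a (cptr \<gamma> a); c = holder \<gamma> b;
          \<delta> = \<gamma>\<lparr>cscan := (cscan \<gamma>)(a := cptr \<gamma> a + 1)\<rparr> in
      if c = n then \<delta>\<lparr>holder := (holder \<gamma>)(b := a), entered := entered \<gamma> + 1, free := entered \<gamma> + 1\<rparr>
      else if rk b a < rk b c
      then \<delta>\<lparr>holder := (holder \<gamma>)(b := a), cptr := (cptr \<gamma>)(c := cptr \<gamma> c + 1), free := c\<rparr>
      else \<delta>\<lparr>cptr := (cptr \<gamma>)(a := cptr \<gamma> a + 1)\<rparr>)"

definition engaged :: "courtship \<Rightarrow> nat set" where
  "engaged \<gamma> = {a. a < n \<and> a \<le> entered \<gamma> \<and> a \<noteq> free \<gamma>}"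

text \<open>The last clause is man-optimality: nobody has been rejected by a wife he has in some
  stable marriage. The clause on \<open>cscan\<close> prepares the scan pointers of the
  search.\<close>

definition courtship_inv :: "courtship \<Rightarrow> bool" where
  "courtship_inv \<gamma> \<longleftrightarrow> entered \<gamma> \<le> n \<and> (entered \<gamma> < n \<longrightarrow> free \<gamma> \<le> entered \<gamma>) \<and>
     (entered \<gamma> = n \<longrightarrow> free \<gamma> = n) \<and>
     (\<forall>a<n. 1 \<le> cptr \<gamma> a \<and> cptr \<gamma> a \<le> n) \<and>
     (\<forall>a\<in>engaged \<gamma>. holder \<gamma> (first (cptr \<gamma>) a) = a \<and> cscan \<gamma> a = cptr \<gamma> a + 1) \<and>
     (\<forall>b<n. holder \<gamma> b = n \<or> holder \<gamma> b \<in> engaged \<gamma> \<and> first (cptr \<gamma>) (holder \<gamma> b) = b) \<and>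
     (\<forall>a<n. \<forall>b<n. rk a b < cptr \<gamma> a \<longrightarrow> holder \<gamma> b < n \<and> rk b (holder \<gamma> b) < rk b a) \<and>
     (\<forall>g h. marriage g h \<longrightarrow> (\<forall>a<n. cptr \<gamma> a \<le> rk a (g a)))"

lemma courtship_invD:
  assumes "courtship_inv \<gamma>"
  shows "entered \<gamma> \<le> n" "entered \<gamma> < n \<Longrightarrow> free \<gamma> \<le> entered \<gamma>" "entered \<gamma> = n \<Longrightarrow> free \<gamma> = n"
    "a < n \<Longrightarrow> 1 \<le> cptr \<gamma> a" "a < n \<Longrightarrow> cptr \<gamma> a \<le> n"
    "a \<in> engaged \<gamma> \<Longrightarrow> holder \<gamma> (first (cptr \<gamma>) a) = a"
    "a \<in> engaged \<gamma> \<Longrightarrow> cscan \<gamma> a = cptr \<gamma> a + 1"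
    "b < n \<Longrightarrow> holder \<gamma> b = n \<or> holder \<gamma> b \<in> engaged \<gamma> \<and> first (cptr \<gamma>) (holder \<gamma> b) = b"
    "a < n \<Longrightarrow> b < n \<Longrightarrow> rk a b < cptr \<gamma> a \<Longrightarrow> holder \<gamma> b < n \<and> rk b (holder \<gamma> b) < rk b a"
    "marriage g h \<Longrightarrow> a < n \<Longrightarrow> cptr \<gamma> a \<le> rk a (g a)"
  using assms unfolding courtship_inv_def by blast+

definition courtship_potential :: "courtship \<Rightarrow> nat" where
  "courtship_potential \<gamma> = (n - entered \<gamma>) + (\<Sum>a<n. n + 1 - cptr \<gamma> a)"

context
  fixes \<gamma>
  assumes I: "courtship_inv \<gamma>" and lt: "entered \<gamma> < n"
begin

lemma free_less: "free \<gamma> < n"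
  using courtship_invD(2)[OF I lt] lt by simp

private abbreviation "a \<equiv> free \<gamma>"
private abbreviation "b \<equiv> first (cptr \<gamma>) (free \<gamma>)"

lemma proposed_less: "first (cptr \<gamma>) x < n" if "x < n" for x
  using courtship_invD(4,5)[OF I that] that by (simp add: first_def pr_less)

lemma proposed_rk: "rk x (first (cptr \<gamma>) x) = cptr \<gamma> x" if "x < n" for x
  using courtship_invD(4,5)[OF I that] that by (simp add: first_def rk_pr)

text \<open>A man who has been rejected by everybody would leave \<^term>\<open>n\<close> women to \<^term>\<open>n - 1\<close> men.\<close>

lemma rejected_ptr:
  assumes x: "x < n" "holder \<gamma> (first (cptr \<gamma>) x) \<noteq> n"
  shows "cptr \<gamma> x < n"
proof (rule ccontr)
  assume "\<not> ?thesis"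
  then have px: "cptr \<gamma> x = n" using courtship_invD(5)[OF I x(1)] by simp
  have all: "holder \<gamma> c \<in> engaged \<gamma> \<and> first (cptr \<gamma>) (holder \<gamma> c) = c" if "c < n" for c
  proof -
    have "holder \<gamma> c \<noteq> n"
    proof (cases "c = first (cptr \<gamma>) x")
      case False
      then have "rk x c \<noteq> n" using that x proposed_rk[of x] proposed_less[of x] px by (metis rk_inject)
      then have "rk x c < cptr \<gamma> x" using rk_le_n[OF x(1) that] px by simp
      with courtship_invD(9)[OF I x(1) that] show ?thesis by simp
    qed (use x in simp)
    with courtship_invD(8)[OF I that] show ?thesis by simp
  qed
  have "inj_on (holder \<gamma>) {..<n}" by (rule inj_onI) (metis all lessThan_iff)
  moreover have "holder \<gamma> ` {..<n} \<subseteq> {..<n} - {a}" using all by (auto simp: engaged_def)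
  ultimately have "card {..<n} \<le> card ({..<n} - {a})" by (intro card_inj_on_le) auto
  then show False using free_less by simp
qed

text \<open>Here \<open>z\<close> wins and \<open>x\<close> loses the comparison at an engaged
  woman. This treats both outcomes at once; if the proposer loses, the updates of
  \<open>holder\<close> and \<open>free\<close> change nothing.\<close>

lemma courtship_reject:
  assumes zx: "{z, x} = {a, holder \<gamma> b}" "holder \<gamma> b \<noteq> n" "rk b z < rk b x"
    and \<gamma>': "\<gamma>' = \<gamma>\<lparr>cscan := (cscan \<gamma>)(a := cptr \<gamma> a + 1), holder := (holder \<gamma>)(b := z),
      cptr := (cptr \<gamma>)(x := cptr \<gamma> x + 1), free := x\<rparr>"
  shows "courtship_inv \<gamma>'" "courtship_potential \<gamma>' < courtship_potential \<gamma>"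
proof -
  note an = free_less
  note bn = proposed_less[OF an]
  have c: "holder \<gamma> b \<in> engaged \<gamma>" "first (cptr \<gamma>) (holder \<gamma> b) = b"
    using courtship_invD(8)[OF I bn] zx(2) by auto
  then have ca: "holder \<gamma> b \<noteq> a" "holder \<gamma> b < n" "holder \<gamma> b \<le> entered \<gamma>" by (auto simp: engaged_def)
  have zx': "z = a \<and> x = holder \<gamma> b \<or> x = a \<and> z = holder \<gamma> b"
    using zx(1) by (auto simp: doubleton_eq_iff)
  have zn: "z < n" and xn: "x < n" and zne: "z \<noteq> x" and fz: "first (cptr \<gamma>) z = b"
    and fx: "first (cptr \<gamma>) x = b"
    using zx' ca an c by auto
  have px: "cptr \<gamma> x < n" using rejected_ptr[OF xn] fx zx(2) by simp
  have eng: "engaged \<gamma>' = insert z (engaged \<gamma> - {x})"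
    using zx' ca an courtship_invD(2)[OF I lt] by (auto simp: engaged_def \<gamma>')
  have firsts: "first (cptr \<gamma>') y = first (cptr \<gamma>) y" if "y \<noteq> x" for y
    using that by (simp add: \<gamma>' first_def)
  show "courtship_inv \<gamma>'"
    unfolding courtship_inv_def
  proof (intro conjI allI impI ballI)
    show "entered \<gamma>' \<le> n" "entered \<gamma>' = n \<Longrightarrow> free \<gamma>' = n" using lt by (simp_all add: \<gamma>')
    show "free \<gamma>' \<le> entered \<gamma>'" using zx' ca courtship_invD(2)[OF I lt] by (auto simp: \<gamma>')
    fix y assume y: "y < n"
    show "1 \<le> cptr \<gamma>' y" "cptr \<gamma>' y \<le> n"
      using courtship_invD(4,5)[OF I y] px by (auto simp: \<gamma>')
    show "holder \<gamma>' y = n \<or> holder \<gamma>' y \<in> engaged \<gamma>' \<and> first (cptr \<gamma>') (holder \<gamma>' y) = y"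
    proof (cases "y = b")
      case True
      then show ?thesis using firsts[OF zne] fz eng by (simp add: \<gamma>')
    next
      case False
      then have "holder \<gamma>' y = holder \<gamma> y" by (simp add: \<gamma>')
      moreover have "holder \<gamma> y \<noteq> x" if "holder \<gamma> y \<noteq> n"
        using courtship_invD(8)[OF I y] that False fx by auto
      ultimately show ?thesis using courtship_invD(8)[OF I y] firsts eng by auto
    qed
    show "cptr \<gamma>' y \<le> rk y (g y)" if g: "marriage g h" for g h
    proof (cases "y = x")
      case False
      then show ?thesis using courtship_invD(10)[OF I g y] by (simp add: \<gamma>')
    next
      case True
      have gx: "cptr \<gamma> x \<le> rk x (g x)" by (rule courtship_invD(10)[OF I g xn])
      \<comment> \<open>If a stable marriage gave \<open>b\<close> to the loser, the winner
        \<open>z\<close> could have nobody better than \<open>b\<close> there, and the two would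
        block it.\<close>
      have "g x \<noteq> b"
      proof
        assume "g x = b"
        then have hb: "h b = x" using marriageD[OF g xn] by auto
        then have "g z \<noteq> b" using zne marriageD(3)[OF g zn] by auto
        then have "rk z b < rk z (g z)"
          using courtship_invD(10)[OF I g zn] proposed_rk[OF zn] fz marriageD(1)[OF g zn] zn bn
          by (metis le_neq_implies_less rk_inject)
        from marriage_stable[OF g zn bn this] hb zx(3) show False by simp
      qed
      then have "rk x (g x) \<noteq> cptr \<gamma> x"
        using proposed_rk[OF xn] fx xn bn marriageD(1)[OF g xn] by (metis rk_inject)
      with gx True show ?thesis by (simp add: \<gamma>')
    qed
    fix d assume d: "d < n" "rk y d < cptr \<gamma>' y"
    show "holder \<gamma>' d < n" "rk d (holder \<gamma>' d) < rk d y"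
    proof -
      have "holder \<gamma>' d < n \<and> rk d (holder \<gamma>' d) < rk d y"
      proof (cases "d = b")
        case db: True
        then have h: "holder \<gamma>' d = z" by (simp add: \<gamma>')
        have "rk b z < rk b y"
        proof (cases "y = x")
          case False
          then have "rk y b < cptr \<gamma> y" using d db by (simp add: \<gamma>')
          from courtship_invD(9)[OF I y bn this] have "rk b (holder \<gamma> b) < rk b y" by simp
          with zx' zx(3) show ?thesis by auto
        qed (use zx in simp)
        with h db zn show ?thesis by simp
      next
        case False
        then have h: "holder \<gamma>' d = holder \<gamma> d" by (simp add: \<gamma>')
        have "rk y d < cptr \<gamma> y"
        proof (cases "y = x")
          case True
          with d have "rk x d \<le> cptr \<gamma> x" by (simp add: \<gamma>')
          moreover have "rk x d \<noteq> cptr \<gamma> x"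
            using proposed_rk[OF xn] fx xn bn d(1) False by (metis rk_inject)
          ultimately show ?thesis using True by simp
        qed (use d in \<open>simp add: \<gamma>'\<close>)
        with courtship_invD(9)[OF I y d(1)] h show ?thesis by simp
      qed
      then show "holder \<gamma>' d < n" "rk d (holder \<gamma>' d) < rk d y" by auto
    qed
  next
    fix y assume y: "y \<in> engaged \<gamma>'"
    then have yx: "y \<noteq> x" using eng zne by auto
    show "holder \<gamma>' (first (cptr \<gamma>') y) = y"
    proof (cases "y = z")
      case True
      then show ?thesis using firsts[OF yx] fz by (simp add: \<gamma>')
    next
      case False
      then have "y \<in> engaged \<gamma>" using y eng by auto
      then have "holder \<gamma> (first (cptr \<gamma>) y) = y" "y \<noteq> a"
        using courtship_invD(6)[OF I] by (auto simp: engaged_def)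
      moreover from this have "first (cptr \<gamma>) y \<noteq> b" using zx' False yx by metis
      ultimately show ?thesis using firsts[OF yx] by (simp add: \<gamma>')
    qed
    show "cscan \<gamma>' y = cptr \<gamma>' y + 1"
      using courtship_invD(7)[OF I, of y] y eng yx zx' c(1) by (auto simp: \<gamma>')
  qed
  have "(\<Sum>y\<in>{..<n}. n + 1 - cptr \<gamma>' y) < (\<Sum>y\<in>{..<n}. n + 1 - cptr \<gamma> y)"
  proof (rule sum_strict_mono_ex1)
    show "\<exists>y\<in>{..<n}. n + 1 - cptr \<gamma>' y < n + 1 - cptr \<gamma> y"
      by (rule bexI[of _ x]) (use px xn in \<open>auto simp: \<gamma>'\<close>)
  qed (auto simp: \<gamma>')
  then show "courtship_potential \<gamma>' < courtship_potential \<gamma>"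
    by (simp add: courtship_potential_def \<gamma>')
qed

lemma courtship_step: "courtship_inv (propose \<gamma>)" "courtship_potential (propose \<gamma>) < courtship_potential \<gamma>"
proof -
  note an = free_less
  note bn = proposed_less[OF an]
  have b: "pr a (cptr \<gamma> a) = b" by (simp add: first_def)
  have "courtship_inv (propose \<gamma>) \<and> courtship_potential (propose \<gamma>) < courtship_potential \<gamma>"
  proof (cases "holder \<gamma> b = n")
    case True
    let ?\<gamma>' = "\<gamma>\<lparr>cscan := (cscan \<gamma>)(a := cptr \<gamma> a + 1), holder := (holder \<gamma>)(b := a),
      entered := entered \<gamma> + 1, free := entered \<gamma> + 1\<rparr>"
    have st: "propose \<gamma> = ?\<gamma>'" using True by (simp add: propose_def Let_def b)
    have eng: "engaged ?\<gamma>' = insert a (engaged \<gamma>)"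
      using courtship_invD(2)[OF I lt] an by (auto simp: engaged_def)
    have "courtship_inv ?\<gamma>'"
      unfolding courtship_inv_def
    proof (intro conjI allI impI ballI)
      show "entered ?\<gamma>' \<le> n" "free ?\<gamma>' \<le> entered ?\<gamma>'" "entered ?\<gamma>' = n \<Longrightarrow> free ?\<gamma>' = n"
        using lt by simp_all
      fix y assume y: "y < n"
      show "1 \<le> cptr ?\<gamma>' y" "cptr ?\<gamma>' y \<le> n" using courtship_invD(4,5)[OF I y] by auto
      show "holder ?\<gamma>' y = n \<or> holder ?\<gamma>' y \<in> engaged ?\<gamma>' \<and> first (cptr ?\<gamma>') (holder ?\<gamma>' y) = y"
        using courtship_invD(8)[OF I y] eng by auto
      show "cptr ?\<gamma>' y \<le> rk y (g y)" if "marriage g h" for g h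
        using courtship_invD(10)[OF I that y] by simp
      fix d assume d: "d < n" "rk y d < cptr ?\<gamma>' y"
      then have "holder \<gamma> d < n \<and> rk d (holder \<gamma> d) < rk d y"
        using courtship_invD(9)[OF I y d(1)] by simp
      with True show "holder ?\<gamma>' d < n" "rk d (holder ?\<gamma>' d) < rk d y" by auto
    next
      fix y assume "y \<in> engaged ?\<gamma>'"
      then consider "y = a" | "y \<in> engaged \<gamma>" "y \<noteq> a" using eng by (auto simp: engaged_def)
      then have "holder ?\<gamma>' (first (cptr ?\<gamma>') y) = y \<and> cscan ?\<gamma>' y = cptr ?\<gamma>' y + 1"
      proof cases
        case 2
        then have "holder \<gamma> (first (cptr \<gamma>) y) = y" "y < n"
          using courtship_invD(6)[OF I] by (auto simp: engaged_def)
        with True have "first (cptr \<gamma>) y \<noteq> b" by auto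
        with 2 courtship_invD(6,7)[OF I 2(1)] show ?thesis by simp
      qed simp
      then show "holder ?\<gamma>' (first (cptr ?\<gamma>') y) = y" "cscan ?\<gamma>' y = cptr ?\<gamma>' y + 1" by auto
    qed
    then show ?thesis using lt by (simp add: st courtship_potential_def)
  next
    case False
    let ?c = "holder \<gamma> b"
    have c: "?c \<in> engaged \<gamma>" using courtship_invD(8)[OF I bn] False by auto
    show ?thesis
    proof (cases "rk b a < rk b ?c")
      case True
      then have st: "propose \<gamma> = \<gamma>\<lparr>cscan := (cscan \<gamma>)(a := cptr \<gamma> a + 1),
          holder := (holder \<gamma>)(b := a), cptr := (cptr \<gamma>)(?c := cptr \<gamma> ?c + 1), free := ?c\<rparr>"
        using False by (simp add: propose_def Let_def b)
      show ?thesis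
        using courtship_reject[of a ?c "propose \<gamma>", OF _ False True st] by auto
    next
      case ge: False
      then have st: "propose \<gamma> = \<gamma>\<lparr>cscan := (cscan \<gamma>)(a := cptr \<gamma> a + 1),
          holder := (holder \<gamma>)(b := ?c), cptr := (cptr \<gamma>)(a := cptr \<gamma> a + 1), free := a\<rparr>"
        using False by (simp add: propose_def Let_def b)
      have "?c \<noteq> a" "?c < n" using c by (auto simp: engaged_def)
      then have "rk b ?c < rk b a" using ge an bn by (metis nat_neq_iff rk_inject)
      then show ?thesis
        using courtship_reject[of ?c a "propose \<gamma>", OF _ False _ st] by auto
    qed
  qed
  then show "courtship_inv (propose \<gamma>)" "courtship_potential (propose \<gamma>) < courtship_potential \<gamma>"
    by auto
qed

lemma courtship_range:
  "a < n" "1 \<le> cptr \<gamma> a" "cptr \<gamma> a \<le> n" "pr a (cptr \<gamma> a) < n"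
  "holder \<gamma> (pr a (cptr \<gamma> a)) \<le> n"
  "holder \<gamma> (pr a (cptr \<gamma> a)) < n \<Longrightarrow> cptr \<gamma> (holder \<gamma> (pr a (cptr \<gamma> a))) \<le> n"
proof -
  show an: "a < n" by (rule free_less)
  show "1 \<le> cptr \<gamma> a" "cptr \<gamma> a \<le> n" using courtship_invD(4,5)[OF I an] .
  show b: "pr a (cptr \<gamma> a) < n" using proposed_less[OF an] by (simp add: first_def)
  show "holder \<gamma> (pr a (cptr \<gamma> a)) \<le> n"
    using courtship_invD(8)[OF I b] by (auto simp: engaged_def)
  show "cptr \<gamma> (holder \<gamma> (pr a (cptr \<gamma> a))) \<le> n" if "holder \<gamma> (pr a (cptr \<gamma> a)) < n"
    using courtship_invD(5)[OF I that] .
qed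

end

lemma courtship_start:
  assumes "\<forall>a<n. cptr \<gamma> a = 1 \<and> holder \<gamma> a = n" "entered \<gamma> = 0" "free \<gamma> = 0"
  shows "courtship_inv \<gamma>" "courtship_potential \<gamma> \<le> n + n * n"
proof -
  have "(\<Sum>a<n. n + 1 - cptr \<gamma> a) = (\<Sum>a<n. n)" using assms by (intro sum.cong) auto
  then show "courtship_potential \<gamma> \<le> n + n * n" using assms by (simp add: courtship_potential_def)
  have "1 \<le> rk a b" if "a < n" "b < n" for a b using rk_ge_1 that by simp
  then show "courtship_inv \<gamma>"
    using assms unfolding courtship_inv_def engaged_def
    by (auto simp: marriage_def Suc_le_eq not_less dest: leD)
qed

lemma courtship_done:
  assumes I: "courtship_inv \<gamma>" and e: "entered \<gamma> = n" and n: "0 < n"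
    and \<alpha>: "\<forall>a<n. ptr \<alpha> a = cptr \<gamma> a \<and> last \<alpha> a = holder \<gamma> a \<and> scan \<alpha> a = cscan \<gamma> a \<and> mark \<alpha> a = 0"
    "bound \<alpha> = n" "agent \<alpha> = 0" "depth \<alpha> = 0" "target \<alpha> = n"
  shows "search_inv \<alpha>" "potential \<alpha> \<le> 4 * n * n + 6 * n + 1"
proof -
  let ?f = "first (ptr \<alpha>)" and ?l = "last \<alpha>"
  have eng: "engaged \<gamma> = {..<n}" using e courtship_invD(3)[OF I e] by (auto simp: engaged_def)
  have f: "?f a = first (cptr \<gamma>) a" if "a < n" for a using \<alpha> that by (simp add: first_def)
  have fn: "?f a < n" "rk a (?f a) = ptr \<alpha> a" if "a < n" for a
    using courtship_invD(4,5)[OF I that] that \<alpha> by (simp_all add: f first_def pr_less rk_pr)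
  have lf: "?l (?f a) = a" if "a < n" for a
    using courtship_invD(6)[OF I, of a] that eng f fn(1)[OF that] \<alpha> by auto
  have "inj_on ?f {..<n}" by (rule inj_onI) (metis lessThan_iff lf)
  then have surj: "?f ` {..<n} = {..<n}" using fn by (intro endo_inj_surj) auto
  have ln: "?l a < n" "?f (?l a) = a" if "a < n" for a
  proof -
    have "a \<in> ?f ` {..<n}" using that by (simp add: surj)
    then obtain c where "c < n" "a = ?f c" by blast
    then show "?l a < n" "?f (?l a) = a" using lf by auto
  qed
  have m: "marriage ?f ?l"
    unfolding marriage_def
  proof (intro conjI allI impI)
    fix a b assume "a < n" "b < n" "rk a b < rk a (?f a)"
    then show "rk b (?l b) < rk b a" using courtship_invD(9)[OF I, of a b] \<alpha> fn by simp
  qed (use fn ln lf in auto)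
  \<comment> \<open>Man-optimality applied to the marriage with its sides exchanged: the husband of
    the copy is also a possible wife, hence no better than the actual one.\<close>
  have nt: "\<not> twisted ?f ?l a" if "a < n" for a
    using courtship_invD(10)[OF I marriage_swap[OF m] that] fn(2)[OF that] \<alpha> that
    by (simp add: twisted_def)
  have t: "table ?f ?l" using m nt by (simp add: table_def)
  have sc: "scan \<alpha> a = ptr \<alpha> a + 1" "1 \<le> ptr \<alpha> a" "ptr \<alpha> a \<le> n" if "a < n" for a
    using courtship_invD(4,5,7)[OF I, of a] that eng \<alpha> by auto
  have rl: "rk a (?l a) \<le> n" if "a < n" for a using rk_le_n[OF that ln(1)[OF that]] .
  have "compatible \<alpha> g" if g: "partition g h" for g h
  proof -
    have "above ?f g"
      using courtship_invD(10)[OF I, of g h] g \<alpha> fn(2) by (auto simp: above_def partition_def)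
    with nt rl \<alpha> show ?thesis by (simp add: compatible_def)
  qed
  moreover have "\<not> bound \<alpha> < rk a (?l a)" if "a < n" for a using rl[OF that] \<alpha> by simp
  ultimately have "normal \<alpha>"
    using t sc n \<alpha> unfolding normal_def by (simp add: less_Suc_eq_le not_less leD)
  with \<alpha> show "search_inv \<alpha>" by (simp add: search_inv_def)
  have "(\<Sum>a<n. weight \<alpha> a) \<le> (\<Sum>a<n. 3 * n + 2)"
    using sc \<alpha>(1) by (intro sum_mono) (auto simp: weight_def)
  then show "potential \<alpha> \<le> 4 * n * n + 6 * n + 1" using \<alpha> by (simp add: potential_def algebra_simps)
qed

end

section \<open>The regret of the outcome\<close>

lemma rank_less_iff:
  fixes n :: nat
  assumes I: "sr_instance {..<n} P" and "a < n" "x < n" "y < n"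
  shows "rank {..<n} P a x < rank {..<n} P a y \<longleftrightarrow> (x, y) \<in> P a"
proof -
  have lin: "trans (P a)" "irrefl (P a)" "total_on {..<n} (P a)"
    using I assms by (auto simp: sr_instance_def strict_linear_order_on_def)
  have less: "rank {..<n} P a u < rank {..<n} P a v" if "(u, v) \<in> P a" "u < n" for u v
  proof -
    have "{z \<in> {..<n}. (z, u) \<in> P a} \<subset> {z \<in> {..<n}. (z, v) \<in> P a}"
      using that lin by (auto simp: irrefl_def dest: transD)
    moreover have "finite {z \<in> {..<n}. (z, v) \<in> P a}" by simp
    ultimately have "card {z \<in> {..<n}. (z, u) \<in> P a} < card {z \<in> {..<n}. (z, v) \<in> P a}"
      by (rule psubset_card_mono[rotated])
    then show ?thesis by (simp add: rank_def)
  qed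
  show ?thesis
  proof
    assume lt: "rank {..<n} P a x < rank {..<n} P a y"
    show "(x, y) \<in> P a"
    proof (rule ccontr)
      assume "(x, y) \<notin> P a"
      with lin assms have "x = y \<or> (y, x) \<in> P a" by (auto simp: total_on_def)
      with less[of y x] assms lt show False by auto
    qed
  qed (use less assms in simp)
qed

lemma sr_instance_preferences:
  fixes n :: nat
  assumes I: "sr_instance {..<n} P"
  shows "preferences n (rank {..<n} P)"
proof
  fix a assume a: "a < n"
  have irr: "(x, x) \<notin> P a" for x
    using I a by (auto simp: sr_instance_def strict_linear_order_on_def irrefl_def)
  have inj: "inj_on (rank {..<n} P a) {..<n}"
  proof (rule inj_onI)
    fix x y assume "x \<in> {..<n}" "y \<in> {..<n}" and eq: "rank {..<n} P a x = rank {..<n} P a y"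
    then have "(x, y) \<notin> P a" "(y, x) \<notin> P a"
      using rank_less_iff[OF I a, of x y] rank_less_iff[OF I a, of y x] by auto
    moreover have "total_on {..<n} (P a)"
      using I a by (auto simp: sr_instance_def strict_linear_order_on_def)
    ultimately show "x = y" using \<open>x \<in> {..<n}\<close> \<open>y \<in> {..<n}\<close> by (auto simp: total_on_def)
  qed
  have range: "rank {..<n} P a x \<in> {1..n}" if "x < n" for x
  proof -
    have "card {y \<in> {..<n}. (y, x) \<in> P a} \<le> card ({..<n} - {x})"
      using irr by (intro card_mono) auto
    with that show ?thesis by (simp add: rank_def)
  qed
  have "rank {..<n} P a ` {..<n} = {1..n}"
    by (rule card_subset_eq) (use range inj in \<open>auto simp: card_image\<close>)
  with inj show "bij_betw (rank {..<n} P a) {..<n} {1..n}" by (simp add: bij_betw_def)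
  have "{y \<in> {..<n}. (y, a) \<in> P a} = {..<n} - {a}"
    using I a irr by (auto simp: sr_instance_def)
  with a show "rank {..<n} P a a = n" by (simp add: rank_def)
qed

context preferences
begin

text \<open>The inner test is the negation of \<open>twisted\<close>, so inverted odd parties are
  turned back.\<close>

definition succ_of :: "search \<Rightarrow> nat \<Rightarrow> nat" where
  "succ_of \<alpha> a = (if a < n then
     if ptr \<alpha> a \<le> rk a (last \<alpha> a) then first (ptr \<alpha>) a else last \<alpha> a else a)"

definition pred_of :: "search \<Rightarrow> nat \<Rightarrow> nat" where
  "pred_of \<alpha> a = (if a < n then
     if ptr \<alpha> a \<le> rk a (last \<alpha> a) then last \<alpha> a else first (ptr \<alpha>) a else a)"

context
  fixes \<alpha> :: search
  assumes inv: "search_inv \<alpha>" and zero: "bound \<alpha> = 0"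
begin

private lemmas final_table = search_done(1)[OF inv zero]
private lemmas final_marriage = tableD(1)[OF final_table]

lemma twisted_iff: "a < n \<Longrightarrow> twisted (first (ptr \<alpha>)) (last \<alpha>) a \<longleftrightarrow> \<not> ptr \<alpha> a \<le> rk a (last \<alpha> a)"
  using search_done(4)[OF inv zero, of a] by (simp add: twisted_def first_def rk_pr not_le)

lemma succ_pred:
  assumes "a < n"
  shows "succ_of \<alpha> a < n" "pred_of \<alpha> a < n" "succ_of \<alpha> (pred_of \<alpha> a) = a"
    "pred_of \<alpha> (succ_of \<alpha> a) = a" "rk a (succ_of \<alpha> a) \<le> rk a (pred_of \<alpha> a)"
    "rk a (pred_of \<alpha> a) = worst (first (ptr \<alpha>)) (last \<alpha>) a"
proof -
  note ma = marriageD[OF final_marriage assms]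
  \<comment> \<open>A cycle is twisted as a whole or not at all, so the two orientations never
    meet.\<close>
  have tw: "twisted (first (ptr \<alpha>)) (last \<alpha>) (first (ptr \<alpha>) a) \<longleftrightarrow> twisted (first (ptr \<alpha>)) (last \<alpha>) a"
    "twisted (first (ptr \<alpha>)) (last \<alpha>) (last \<alpha> a) \<longleftrightarrow> twisted (first (ptr \<alpha>)) (last \<alpha>) a"
    using tableD(2,3)[OF final_table] ma assms by metis+
  show "succ_of \<alpha> a < n" "pred_of \<alpha> a < n" "succ_of \<alpha> (pred_of \<alpha> a) = a" "pred_of \<alpha> (succ_of \<alpha> a) = a"
    using ma assms tw twisted_iff[OF assms] twisted_iff[OF ma(1)] twisted_iff[OF ma(2)]
    by (auto simp: succ_of_def pred_of_def)
  show "rk a (succ_of \<alpha> a) \<le> rk a (pred_of \<alpha> a)"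
    "rk a (pred_of \<alpha> a) = worst (first (ptr \<alpha>)) (last \<alpha>) a"
    using assms twisted_iff[OF assms] by (auto simp: succ_of_def pred_of_def twisted_def worst_def)
qed

lemma succ_permutes: "succ_of \<alpha> permutes {..<n}" "inv (succ_of \<alpha>) = pred_of \<alpha>"
proof -
  have 1: "succ_of \<alpha> (pred_of \<alpha> a) = a" "pred_of \<alpha> (succ_of \<alpha> a) = a" for a
    using succ_pred[of a] by (auto simp: succ_of_def pred_of_def)
  have "\<exists>!x. succ_of \<alpha> x = y" for y by (metis 1)
  then show "succ_of \<alpha> permutes {..<n}" by (simp add: permutes_def succ_of_def)
  show "inv (succ_of \<alpha>) = pred_of \<alpha>" by (rule inv_equality) (simp_all add: 1)
qed

text \<open>The only agent that a twisted \<open>a\<close> could still improve to is its successor,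
  whose own worst entry is \<open>a\<close>. For two untwisted agents inactivity makes first and
  last entries agree in rank, and stability of the marriage applies.\<close>

lemma no_blocking_pair:
  assumes "a < n" "b < n" "rk a b < rk a (pred_of \<alpha> a)" "rk b a < rk b (pred_of \<alpha> b)"
  shows False
proof -
  have twisted_case: False
    if ab: "a < n" "b < n" "rk a b < worst (first (ptr \<alpha>)) (last \<alpha>) a"
      "rk b a < worst (first (ptr \<alpha>)) (last \<alpha>) b" and tw: "twisted (first (ptr \<alpha>)) (last \<alpha>) a" for a b
  proof -
    note ma = marriageD[OF final_marriage ab(1)]
    have "b = first (ptr \<alpha>) a \<or> b = last \<alpha> a" using tableD(4)[OF final_table ab(1) tw ab(2)] ab by simp
    moreover have "b \<noteq> first (ptr \<alpha>) a" using ab(3) tw by (auto simp: worst_def twisted_def)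
    ultimately have b: "b = last \<alpha> a" by simp
    then have "twisted (first (ptr \<alpha>)) (last \<alpha>) b" using tableD(3)[OF final_table ab(1) tw] by simp
    then have "worst (first (ptr \<alpha>)) (last \<alpha>) b = rk b a"
      using b ma by (simp add: twisted_def worst_def)
    with ab(4) show False by simp
  qed
  have w: "rk a b < worst (first (ptr \<alpha>)) (last \<alpha>) a" "rk b a < worst (first (ptr \<alpha>)) (last \<alpha>) b"
    using assms succ_pred(6) by simp_all
  have nt: "\<not> twisted (first (ptr \<alpha>)) (last \<alpha>) a" "\<not> twisted (first (ptr \<alpha>)) (last \<alpha>) b"
    using twisted_case[OF assms(1,2) w] twisted_case[OF assms(2,1) w(2,1)] by blast+
  then have "rk a b < rk a (first (ptr \<alpha>) a)" "rk b a < rk b (last \<alpha> b)"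
    using w search_done(2)[OF inv zero assms(1)]
    by (auto simp: worst_def twisted_def active_def)
  with marriage_stable[OF final_marriage assms(1,2)] show False by simp
qed

end

end

context
  fixes n :: nat and P :: "nat \<Rightarrow> nat rel"
  assumes I: "sr_instance {..<n} P"
begin

interpretation preferences n "rank {..<n} P"
  using sr_instance_preferences[OF I] .

lemma stable_partition_partition:
  assumes "stable_partition {..<n} P \<sigma>"
  shows "partition \<sigma> (inv \<sigma>)"
proof -
  have p: "\<sigma> permutes {..<n}"
    and t1: "\<And>a. a < n \<Longrightarrow> \<sigma> a = inv \<sigma> a \<or> (\<sigma> a, inv \<sigma> a) \<in> P a"
    and t2: "\<And>a b. a < n \<Longrightarrow> b < n \<Longrightarrow> a \<noteq> b \<Longrightarrow> (b, inv \<sigma> a) \<in> P a \<Longrightarrow> (a, inv \<sigma> b) \<notin> P b"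
    using assms unfolding stable_partition_def by auto
  have in_n: "\<sigma> a < n" "inv \<sigma> a < n" if "a < n" for a
    using that permutes_in_image[OF p] permutes_in_image[OF permutes_inv[OF p]] by auto
  have le: "rank {..<n} P a (\<sigma> a) \<le> rank {..<n} P a (inv \<sigma> a)" if "a < n" for a
    using t1[OF that] rank_less_iff[OF I that in_n[OF that]] by auto
  have "rank {..<n} P b (inv \<sigma> b) < rank {..<n} P b a"
    if ab: "a < n" "b < n" "rank {..<n} P a b < rank {..<n} P a (\<sigma> a)" for a b
  proof (rule ccontr)
    assume "\<not> ?thesis"
    moreover have "inv \<sigma> b \<noteq> a" using ab(3) permutes_inverses(1)[OF p] by auto
    ultimately have ba: "rank {..<n} P b a < rank {..<n} P b (inv \<sigma> b)"
      using ab in_n by (metis nat_neq_iff rk_inject)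
    \<comment> \<open>Stability in the double cover also concerns the two copies of one agent,
      whereas condition T2 is about distinct agents. That an agent ranks itself last closes the
      gap.\<close>
    have "a \<noteq> b" using ab(3) rk_self[OF ab(1)] rk_le_n[OF ab(1) in_n(1)[OF ab(1)]] by auto
    with t2[OF ab(1,2)] rank_less_iff[OF I ab(1,2) in_n(2)[OF ab(1)]]
      rank_less_iff[OF I ab(2,1) in_n(2)[OF ab(2)]] le[OF ab(1)] ab(3) ba show False by simp
  qed
  with le in_n permutes_inverses[OF p] show ?thesis by (simp add: partition_def marriage_def)
qed

lemma succ_of_min_regret:
  assumes inv: "search_inv \<alpha>" and zero: "bound \<alpha> = 0"
  shows "min_regret_stable_partition {..<n} P (succ_of \<alpha>)"
proof -
  let ?\<pi> = "succ_of \<alpha>"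
  note sp = succ_pred[OF inv zero]
  note perm = succ_permutes[OF inv zero]
  have stable: "stable_partition {..<n} P ?\<pi>"
    unfolding stable_partition_def perm(2)
  proof (intro conjI ballI notI)
    show "?\<pi> permutes {..<n}" by (rule perm)
    show "?\<pi> a = pred_of \<alpha> a \<or> (?\<pi> a, pred_of \<alpha> a) \<in> P a" if "a \<in> {..<n}" for a
      using sp(1,2,5)[of a] that rank_less_iff[OF I, of a "?\<pi> a" "pred_of \<alpha> a"]
        rk_inject[of a "?\<pi> a" "pred_of \<alpha> a"] by (auto simp: le_less simp del: rk_inject)
    assume "\<exists>a\<in>{..<n}. \<exists>b\<in>{..<n}. a \<noteq> b \<and> (b, pred_of \<alpha> a) \<in> P a \<and> (a, pred_of \<alpha> b) \<in> P b"
    then obtain a b where "a < n" "b < n" "(b, pred_of \<alpha> a) \<in> P a" "(a, pred_of \<alpha> b) \<in> P b" by auto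
    with no_blocking_pair[OF inv zero, of a b] rank_less_iff[OF I] sp(2) show False by simp
  qed
  have "regret {..<n} P ?\<pi> \<le> regret {..<n} P \<sigma>" if st: "stable_partition {..<n} P \<sigma>" for \<sigma>
  proof (cases "n = 0")
    case True
    \<comment> \<open>Without agents both regrets are the same \<open>Max\<close> of the empty
      set.\<close>
    then show ?thesis by (simp add: regret_def)
  next
    case False
    let ?S = "\<lambda>\<pi>. {i \<in> {1..card {..<n}}. 0 < profile {..<n} P \<pi> i}"
    have S: "i \<in> ?S \<pi> \<longleftrightarrow> i \<in> {1..n} \<and> (\<exists>a<n. rank {..<n} P a (\<pi> a) = i \<or> rank {..<n} P a (inv \<pi> a) = i)"
      for \<pi> i
      by (auto simp: profile_def card_gt_0_iff)
    have beat: "\<exists>k\<in>?S \<sigma>. i \<le> k" if "i \<in> ?S ?\<pi>" for i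
    proof -
      note i = that
      obtain a where a: "a < n" "rank {..<n} P a (?\<pi> a) = i \<or> rank {..<n} P a (pred_of \<alpha> a) = i"
        using i perm(2) unfolding S by auto
      then have "i \<le> worst (first (ptr \<alpha>)) (last \<alpha>) a" using sp(5,6)[of a] by auto
      moreover obtain b where "b < n" "worst (first (ptr \<alpha>)) (last \<alpha>) a \<le> rank {..<n} P b (inv \<sigma> b)"
        using search_done(3)[OF inv zero stable_partition_partition[OF st]] a(1)
        by (auto simp: beaten_def)
      moreover have "inv \<sigma> b < n"
        using \<open>b < n\<close> st permutes_in_image[OF permutes_inv, of \<sigma> "{..<n}" b]
        by (auto simp: stable_partition_def)
      ultimately show ?thesis unfolding Bex_def S using rk_ge_1[of b] rk_le_n[of b]
        by (intro exI[of _ "rank {..<n} P b (inv \<sigma> b)"]) auto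
    qed
    have "rank {..<n} P 0 (?\<pi> 0) \<in> ?S ?\<pi>"
      unfolding S using False sp(1)[of 0] rk_ge_1[of 0] rk_le_n[of 0]
      by (intro conjI exI[of _ 0]) auto
    then have "Max (?S ?\<pi>) \<in> ?S ?\<pi>" by (intro Max_in) auto
    from beat[OF this] obtain k where k: "k \<in> ?S \<sigma>" "Max (?S ?\<pi>) \<le> k" by blast
    then have "k \<le> Max (?S \<sigma>)" by (intro Max_ge) auto
    with k(2) show ?thesis unfolding regret_def by (rule le_trans)
  qed
  with stable show ?thesis
    by (auto simp: min_regret_stable_partition_def is_arg_min_def not_less)
qed

end

section \<open>Running time of programs built from simple loops\<close>

primrec loop_free :: "prog \<Rightarrow> bool" where
  "loop_free Skip = True"
| "loop_free (Assign r e) = True"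
| "loop_free (Store e f) = True"
| "loop_free (Seq c d) = (loop_free c \<and> loop_free d)"
| "loop_free (If e c d) = (loop_free c \<and> loop_free d)"
| "loop_free (While e c) = False"

primrec run :: "nat \<Rightarrow> prog \<Rightarrow> state \<Rightarrow> state" where
  "run w Skip s = s"
| "run w (Assign r e) s = ((fst s)(r := val w s e), snd s)"
| "run w (Store e f) s = (fst s, (snd s)(val w s e := val w s f))"
| "run w (Seq c d) s = run w d (run w c s)"
| "run w (If e c d) s = (if val w s e \<noteq> 0 then run w c s else run w d s)"
| "run w (While e c) s = s"

text \<open>An upper bound because of the maximum over branches. The value at a loop is a dummy that
  \<open>loop_free\<close> excludes, as it is for \<open>run\<close>.\<close>

primrec duration :: "prog \<Rightarrow> nat" where
  "duration Skip = 1"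
| "duration (Assign r e) = cost e + 1"
| "duration (Store e f) = cost e + cost f + 1"
| "duration (Seq c d) = duration c + duration d + 1"
| "duration (If e c d) = cost e + max (duration c) (duration d) + 1"
| "duration (While e c) = 0"

definition runs :: "nat \<Rightarrow> prog \<Rightarrow> state \<Rightarrow> nat \<Rightarrow> (state \<Rightarrow> bool) \<Rightarrow> bool" where
  "runs w c s T Q \<longleftrightarrow> (\<exists>t s'. exec w c s t s' \<and> t \<le> T \<and> Q s')"

lemma exec_loop_free:
  "loop_free c \<Longrightarrow> \<exists>t\<le>duration c. exec w c s t (run w c s)"
proof (induction c arbitrary: s)
  case Skip
  show ?case using exec.Skip[of w s] by (intro exI[of _ 1]) simp
next
  case (Assign r e)
  show ?case using exec.Assign[of w r e s] by (intro exI[of _ "cost e + 1"]) simp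
next
  case (Store e f)
  show ?case using exec.Store[of w e f s] by (intro exI[of _ "cost e + cost f + 1"]) simp
next
  case (Seq c d)
  then obtain t u where tu: "t \<le> duration c" "exec w c s t (run w c s)"
    "u \<le> duration d" "exec w d (run w c s) u (run w d (run w c s))"
    by (metis loop_free.simps(4))
  from exec.Seq[OF tu(2,4)] tu(1,3) show ?case by (intro exI[of _ "t + u + 1"]) simp
next
  case (If e c d)
  then obtain t u where "t \<le> duration c" "exec w c s t (run w c s)"
    "u \<le> duration d" "exec w d s u (run w d s)"
    by (metis loop_free.simps(5))
  then show ?case
    using exec.If_False[of w s e d u "run w d s" c] exec.If_True[of w s e c t "run w c s" d]
    by (cases "val w s e = 0") (force intro: exI[of _ "cost e + u + 1"] exI[of _ "cost e + t + 1"])+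
qed simp

lemma runs_loop_free: "loop_free c \<Longrightarrow> Q (run w c s) \<Longrightarrow> runs w c s (duration c) Q"
  using exec_loop_free[of c w s] unfolding runs_def by blast

lemma runs_Seq:
  assumes "runs w c s T Q" "\<And>s'. Q s' \<Longrightarrow> runs w d s' U R"
  shows "runs w (Seq c d) s (T + U + 1) R"
proof -
  obtain t s' where c: "exec w c s t s'" "t \<le> T" "Q s'" using assms(1) by (auto simp: runs_def)
  obtain u s'' where d: "exec w d s' u s''" "u \<le> U" "R s''"
    using assms(2)[OF c(3)] by (auto simp: runs_def)
  show ?thesis unfolding runs_def
    by (intro exI conjI, rule exec.Seq[OF c(1) d(1)]) (use c d in auto)
qed

lemma runs_weaken:
  "runs w c s T Q \<Longrightarrow> T \<le> U \<Longrightarrow> (\<And>s'. Q s' \<Longrightarrow> R s') \<Longrightarrow> runs w c s U R"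
  unfolding runs_def by (meson le_trans)

text \<open>\<open>R\<close> relates machine states to abstract ones, so correctness and the number
  of iterations are settled by the abstract step alone.\<close>

lemma runs_While:
  fixes \<phi> :: "'b \<Rightarrow> nat"
  assumes "loop_free c"
    and step: "\<And>s x. R s x \<Longrightarrow> val w s e \<noteq> 0 \<Longrightarrow> \<exists>y. R (run w c s) y \<and> \<phi> y < \<phi> x"
    and "R s x"
  shows "runs w (While e c) s (\<phi> x * (duration c + cost e + 1) + cost e + 1)
    (\<lambda>s'. (\<exists>y. R s' y) \<and> val w s' e = 0)"
  using assms(3)
proof (induction "\<phi> x" arbitrary: s x rule: less_induct)
  case less
  let ?K = "duration c + cost e + 1"
  show ?case
  proof (cases "val w s e = 0")
    case True
    show ?thesis
      unfolding runs_def
      by (intro exI conjI, rule exec.While_False[OF True]) (use less(2) True in auto)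
  next
    case False
    obtain y where y: "R (run w c s) y" "\<phi> y < \<phi> x" using step[OF less(2) False] by blast
    obtain t where t: "t \<le> duration c" "exec w c s t (run w c s)"
      using exec_loop_free[OF assms(1)] by blast
    obtain u s' where u: "exec w (While e c) (run w c s) u s'" "u \<le> \<phi> y * ?K + cost e + 1"
      "\<exists>y. R s' y" "val w s' e = 0"
      using less(1)[OF y(2,1)] unfolding runs_def by auto
    have "\<phi> y * ?K + ?K \<le> \<phi> x * ?K"
      using y(2) mult_le_mono1[of "Suc (\<phi> y)" "\<phi> x" ?K] by simp
    then have "cost e + t + u + 1 \<le> \<phi> x * ?K + cost e + 1" using t(1) u(2) by simp
    with exec.While_True[OF False t(2) u(1)] u(3,4) show ?thesis unfolding runs_def by blast
  qed
qed

section \<open>The program\<close>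

text \<open>
  Register 0 holds \<^term>\<open>n\<close>, and the memory is used as a matrix with rows of length \<^term>\<open>n\<close>,
  starting at cell 1: rows below \<^term>\<open>n\<close> are the preference lists, the next \<^term>\<open>n\<close> rows the
  ranks, and the rows from \<^term>\<open>2 * n + 2\<close> on the arrays of the search.
\<close>

definition addr :: "expr \<Rightarrow> expr \<Rightarrow> expr" where
  "addr c i = Add (Add (Mul (Reg 0) c) i) (Const 1)"

definition pref_at :: "expr \<Rightarrow> expr \<Rightarrow> expr" where
  "pref_at a i = addr a (Sub i (Const 1))"

definition rank_at :: "expr \<Rightarrow> expr \<Rightarrow> expr" where
  "rank_at a b = addr (Add (Reg 0) a) b"

definition array_at :: "nat \<Rightarrow> expr \<Rightarrow> expr" where
  "array_at k i = addr (Add (Add (Reg 0) (Reg 0)) (Const k)) i"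

abbreviation "ptr_at \<equiv> array_at 2"
abbreviation "last_at \<equiv> array_at 3"
abbreviation "scan_at \<equiv> array_at 4"
abbreviation "stack_at \<equiv> array_at 5"
abbreviation "mark_at \<equiv> array_at 6"

fun seq :: "prog list \<Rightarrow> prog" where
  "seq [] = Skip"
| "seq [c] = c"
| "seq (c # d # cs) = Seq c (seq (d # cs))"

text \<open>The double loop over rows and columns is flattened, with an explicit carry, since loop
  bodies must be loop-free. The initial values for the proposals are written along the way.\<close>

definition rank_body :: prog where
  "rank_body = seq [
     Store (rank_at (Reg 1) (Load (addr (Reg 1) (Reg 2)))) (Add (Reg 2) (Const 1)),
     Store (ptr_at (Reg 1)) (Const 1),
     Store (last_at (Reg 1)) (Reg 0),
     Assign 2 (Add (Reg 2) (Const 1)),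
     If (Equal (Reg 2) (Reg 0)) (Seq (Assign 2 (Const 0)) (Assign 1 (Add (Reg 1) (Const 1)))) Skip]"

text \<open>Register 3 saves the proposer: register 2 may already hold the next free man when the
  scan pointer is written.\<close>

definition courtship_body :: prog where
  "courtship_body = seq [
     Assign 3 (Reg 2),
     Assign 5 (Load (ptr_at (Reg 2))),
     Assign 6 (Load (pref_at (Reg 2) (Reg 5))),
     Assign 7 (Load (last_at (Reg 6))),
     If (Equal (Reg 7) (Reg 0))
       (seq [Store (last_at (Reg 6)) (Reg 2),
             Assign 1 (Add (Reg 1) (Const 1)),
             Assign 2 (Reg 1)])
       (If (Less (Load (rank_at (Reg 6) (Reg 2))) (Load (rank_at (Reg 6) (Reg 7))))
         (seq [Assign 8 (Load (ptr_at (Reg 7))),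
               Store (last_at (Reg 6)) (Reg 2),
               Store (ptr_at (Reg 7)) (Add (Reg 8) (Const 1)),
               Assign 2 (Reg 7)])
         (Store (ptr_at (Reg 2)) (Add (Reg 5) (Const 1)))),
     Store (scan_at (Reg 3)) (Add (Reg 5) (Const 1))]"

definition push_prog :: prog where
  "push_prog = seq [
     Store (stack_at (Reg 3)) (Reg 5),
     Store (mark_at (Reg 5)) (Const 1),
     Assign 3 (Add (Reg 3) (Const 1))]"

definition elim_prog :: prog where
  "elim_prog = seq [
     Assign 3 (Sub (Reg 3) (Const 1)),
     Assign 5 (Load (stack_at (Reg 3))),
     Assign 6 (Load (scan_at (Reg 5))),
     Assign 7 (Load (pref_at (Reg 5) (Reg 6))),
     Store (last_at (Reg 7)) (Reg 5),
     Store (ptr_at (Reg 5)) (Reg 6),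
     Store (scan_at (Reg 5)) (Add (Reg 6) (Const 1)),
     Store (mark_at (Reg 5)) (Const 0),
     If (Equal (Reg 5) (Reg 4)) (Assign 4 (Reg 0)) Skip]"

definition next_prog :: prog where
  "next_prog = Seq (Assign 2 (Add (Reg 2) (Const 1)))
     (If (Equal (Reg 2) (Reg 0))
       (Seq (Assign 2 (Const 0)) (Assign 1 (Sub (Reg 1) (Const 1)))) Skip)"

definition active_expr :: expr where
  "active_expr = Less (Load (ptr_at (Reg 5))) (Load (rank_at (Reg 5) (Load (last_at (Reg 5)))))"

definition search_body :: prog where
  "search_body =
     If (Less (Reg 4) (Reg 0)) elim_prog
      (If (Equal (Reg 3) (Const 0))
        (Seq (Assign 5 (Load (last_at (Reg 2))))
          (If (Mul (Equal (Load (rank_at (Reg 2) (Reg 5))) (Reg 1)) active_expr)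
            push_prog next_prog))
        (Seq (Assign 5 (Load (stack_at (Sub (Reg 3) (Const 1)))))
          (If active_expr
            (seq [Assign 6 (Load (scan_at (Reg 5))),
                  Assign 7 (Load (pref_at (Reg 5) (Reg 6))),
                  Assign 8 (Load (last_at (Reg 7))),
                  If (Less (Load (rank_at (Reg 7) (Reg 8))) (Load (rank_at (Reg 7) (Reg 5))))
                    (Store (scan_at (Reg 5)) (Add (Reg 6) (Const 1)))
                    (If (Equal (Load (mark_at (Reg 8))) (Const 0))
                      (Seq (Assign 5 (Reg 8)) push_prog)
                      (Assign 4 (Reg 8)))])
            (Seq (Store (mark_at (Reg 5)) (Const 0)) (Assign 3 (Sub (Reg 3) (Const 1)))))))"

definition output_body :: prog where
  "output_body = seq [
     Assign 5 (Load (ptr_at (Reg 1))),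
     Assign 6 (Load (last_at (Reg 1))),
     If (Less (Load (rank_at (Reg 1) (Reg 6))) (Reg 5)) Skip
       (Assign 6 (Load (pref_at (Reg 1) (Reg 5)))),
     Store (Reg 1) (Reg 6),
     Assign 1 (Add (Reg 1) (Const 1))]"

lemmas body_defs = rank_body_def courtship_body_def push_prog_def elim_prog_def next_prog_def
  search_body_def output_body_def

section \<open>Word arithmetic and the layout of the memory\<close>

locale word_ram = preferences +
  fixes w :: nat
  assumes word_length: "(n + 2) ^ 6 \<le> 2 ^ w"
begin

text \<open>The highest address is \<open>n * (2 * n + 6) + n\<close>. Four of the six factors
  \<open>n + 2\<close> supply the coefficient 16, and the constant 64 leaves room for small
  \<open>n\<close>.\<close>

lemma word_bound: "2 * n * n + 8 * n + 64 \<le> 2 ^ w"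
proof -
  have "(2::nat) ^ 4 \<le> (n + 2) ^ 4" by (rule power_mono) auto
  then have "16 * (n + 2) ^ 2 \<le> (n + 2) ^ 4 * (n + 2) ^ 2" by (intro mult_right_mono) auto
  also have "\<dots> = (n + 2) ^ 6" by (simp flip: power_add)
  finally show ?thesis using word_length by (simp add: power2_eq_square algebra_simps)
qed

lemma word_pos [simp]: "0 < w"
  using word_bound by (cases w) auto

lemma word_mod: "x < 8 * n + 64 \<Longrightarrow> x mod 2 ^ w = x"
  using word_bound by simp

lemma word_Suc: "x \<le> n + 1 \<Longrightarrow> Suc x mod 2 ^ w = Suc x"
  by (rule word_mod) simp

definition cell :: "nat \<Rightarrow> nat \<Rightarrow> nat" where
  "cell c i = n * c + i + 1"

definition rank_row :: "nat \<Rightarrow> nat" where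
  "rank_row a = n + a"

definition array_row :: "nat \<Rightarrow> nat" where
  "array_row k = 2 * n + k"

lemma cell_eq_iff:
  assumes "i < n" "j < n"
  shows "cell c i = cell d j \<longleftrightarrow> c = d \<and> i = j"
proof
  assume "cell c i = cell d j"
  then have eq: "n * c + i = n * d + j" by (simp add: cell_def)
  have "(n * c + i) div n = c" "(n * d + j) div n = d" using assms by auto
  with eq have "c = d" by simp
  with eq show "c = d \<and> i = j" by simp
qed simp

lemma val_addr:
  assumes "fst s 0 = n" "val w s c \<le> 2 * n + 6" "val w s i < n"
  shows "val w s (addr c i) = cell (val w s c) (val w s i)"
proof -
  have "n * val w s c \<le> n * (2 * n + 6)" using assms(2) by (rule mult_le_mono2)
  then have "n * val w s c + val w s i + 1 < 2 ^ w"
    using assms(3) word_bound by (simp add: algebra_simps)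
  moreover from this have "n * val w s c + val w s i < 2 ^ w" "n * val w s c < 2 ^ w" by simp_all
  ultimately show ?thesis using assms(1) by (simp add: addr_def cell_def)
qed

lemma val_pref_at:
  assumes "fst s 0 = n" "val w s a < n" "0 < val w s i" "val w s i \<le> n"
  shows "val w s (pref_at a i) = cell (val w s a) (val w s i - Suc 0)"
proof -
  have "val w s (Sub i (Const 1)) = val w s i - Suc 0" by simp
  with val_addr[of s a "Sub i (Const 1)"] assms show ?thesis by (simp add: pref_at_def)
qed

lemma val_rank_at:
  assumes "fst s 0 = n" "val w s a < n" "val w s b < n"
  shows "val w s (rank_at a b) = cell (rank_row (val w s a)) (val w s b)"
proof -
  have "val w s (Add (Reg 0) a) = n + val w s a"
    using assms word_mod[of "n + val w s a"] by simp
  with val_addr[of s "Add (Reg 0) a" b] assms show ?thesis by (simp add: rank_at_def rank_row_def)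
qed

lemma val_array_at:
  assumes "fst s 0 = n" "k \<le> 6" "val w s i < n"
  shows "val w s (array_at k i) = cell (array_row k) (val w s i)"
proof -
  have "val w s (Add (Add (Reg 0) (Reg 0)) (Const k)) = 2 * n + k"
    using assms word_mod[of "n + n"] word_mod[of k] word_mod[of "n + n + k"] by (simp add: mult_2)
  with val_addr[of s "Add (Add (Reg 0) (Reg 0)) (Const k)" i] assms show ?thesis
    by (simp add: array_at_def array_row_def)
qed

definition array :: "(nat \<Rightarrow> nat) \<Rightarrow> nat \<Rightarrow> (nat \<Rightarrow> nat) \<Rightarrow> bool" where
  "array \<mu> k f \<longleftrightarrow> (\<forall>i<n. \<mu> (cell (array_row k) i) = f i)"

definition prefs :: "(nat \<Rightarrow> nat) \<Rightarrow> bool" where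
  "prefs \<mu> \<longleftrightarrow> (\<forall>a<n. \<forall>i. 0 < i \<longrightarrow> i \<le> n \<longrightarrow> \<mu> (cell a (i - Suc 0)) = pr a i)"

definition ranks :: "(nat \<Rightarrow> nat) \<Rightarrow> bool" where
  "ranks \<mu> \<longleftrightarrow> (\<forall>a<n. \<forall>b<n. \<mu> (cell (rank_row a) b) = rk a b)"

lemma array_upd_same: "i < n \<Longrightarrow> array \<mu> k f \<Longrightarrow> array (\<mu>(cell (array_row k) i := v)) k (f(i := v))"
  by (auto simp: array_def cell_eq_iff)

lemma array_upd_other:
  "i < n \<Longrightarrow> j \<noteq> k \<Longrightarrow> array (\<mu>(cell (array_row k) i := v)) j f = array \<mu> j f"
  by (auto simp: array_def cell_eq_iff array_row_def)

lemma array_upd_rank: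
  "i < n \<Longrightarrow> a < n \<Longrightarrow> array (\<mu>(cell (rank_row a) i := v)) k f = array \<mu> k f"
  by (auto simp: array_def cell_eq_iff array_row_def rank_row_def)

lemma prefs_upd_array: "i < n \<Longrightarrow> prefs (\<mu>(cell (array_row k) i := v)) = prefs \<mu>"
  by (auto simp: prefs_def cell_eq_iff array_row_def)

lemma prefs_upd_rank: "i < n \<Longrightarrow> prefs (\<mu>(cell (rank_row a) i := v)) = prefs \<mu>"
  by (auto simp: prefs_def cell_eq_iff rank_row_def)

lemma ranks_upd_array: "i < n \<Longrightarrow> ranks (\<mu>(cell (array_row k) i := v)) = ranks \<mu>"
  by (auto simp: ranks_def cell_eq_iff array_row_def rank_row_def)

lemmas upd = array_upd_same array_upd_other prefs_upd_array ranks_upd_array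

lemmas val_at = val_pref_at val_rank_at val_array_at

section \<open>The search\<close>

definition rep :: "state \<Rightarrow> search \<Rightarrow> bool" where
  "rep s \<alpha> \<longleftrightarrow> prefs (snd s) \<and> ranks (snd s) \<and> fst s 0 = n \<and> fst s 1 = bound \<alpha> \<and>
     fst s 2 = agent \<alpha> \<and> fst s 3 = depth \<alpha> \<and> fst s 4 = target \<alpha> \<and>
     array (snd s) 2 (ptr \<alpha>) \<and> array (snd s) 3 (last \<alpha>) \<and> array (snd s) 4 (scan \<alpha>) \<and>
     array (snd s) 5 (stack \<alpha>) \<and> array (snd s) 6 (mark \<alpha>)"

lemma rep_read:
  assumes "rep (\<rho>, \<mu>) \<alpha>"
  shows "a < n \<Longrightarrow> 0 < i \<Longrightarrow> i \<le> n \<Longrightarrow> \<mu> (cell a (i - Suc 0)) = pr a i"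
    "a < n \<Longrightarrow> b < n \<Longrightarrow> \<mu> (cell (rank_row a) b) = rk a b"
    "\<rho> 0 = n" "\<rho> (Suc 0) = bound \<alpha>" "\<rho> 2 = agent \<alpha>" "\<rho> 3 = depth \<alpha>" "\<rho> 4 = target \<alpha>"
    "a < n \<Longrightarrow> \<mu> (cell (array_row 2) a) = ptr \<alpha> a" "a < n \<Longrightarrow> \<mu> (cell (array_row 3) a) = last \<alpha> a"
    "a < n \<Longrightarrow> \<mu> (cell (array_row 4) a) = scan \<alpha> a" "a < n \<Longrightarrow> \<mu> (cell (array_row 5) a) = stack \<alpha> a"
    "a < n \<Longrightarrow> \<mu> (cell (array_row 6) a) = mark \<alpha> a"
  using assms by (auto simp: rep_def prefs_def ranks_def array_def)


lemma rep_step: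
  assumes r: "rep (\<rho>, \<mu>) \<alpha>" and I: "in_range \<alpha>"
  shows "rep (run w search_body (\<rho>, \<mu>)) (step \<alpha>)"
proof -
  note read = rep_read[OF r]
  let ?u = "stack \<alpha> (depth \<alpha> - 1)"
  have arr: "\<And>a. a < n \<Longrightarrow> last \<alpha> a < n" "\<And>a. a < n \<Longrightarrow> 0 < scan \<alpha> a"
    "\<And>a. a < n \<Longrightarrow> scan \<alpha> a \<le> n + 1"
    and reg: "agent \<alpha> < n" "target \<alpha> \<le> n" "depth \<alpha> \<le> n"
    and st: "\<And>i. i < depth \<alpha> \<Longrightarrow> stack \<alpha> i < n"
    using I by (auto simp: in_range_def Suc_le_eq)
  note simps = body_defs active_expr_def read val_at upd step_def Let_def
  show ?thesis
  proof (cases "target \<alpha> < n")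
    case True
    have d: "0 < depth \<alpha>" "scan \<alpha> ?u \<le> n" using I True by (auto simp: in_range_def Let_def)
    have u: "?u < n" "0 < scan \<alpha> ?u" using st arr d by auto
    obtain v b where vb: "stack \<alpha> (depth \<alpha> - Suc 0) = v" "pr v (scan \<alpha> v) = b" by blast
    have v: "v < n" "0 < scan \<alpha> v" "scan \<alpha> v \<le> n" using u d by (simp_all add: vb)
    have b: "b < n" using pr_less[OF v(1) _ v(3)] v(2) by (simp add: vb)
    have "depth \<alpha> - Suc 0 < n" "Suc (scan \<alpha> v) mod 2 ^ w = Suc (scan \<alpha> v)"
      using d reg v word_Suc[of "scan \<alpha> v"] by simp_all
    then show ?thesis
      using r by (simp add: simps vb True d v b) (simp add: rep_def upd v b True)
  next
    case False
    then have e: "target \<alpha> = n" using reg by simp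
    show ?thesis
    proof (cases "depth \<alpha> = 0")
      case True
      then show ?thesis
        using e arr reg r word_Suc[of "agent \<alpha>"] by (simp add: simps) (simp add: rep_def upd push_def)
    next
      case False
      then have d: "0 < depth \<alpha>" "depth \<alpha> \<noteq> 0" "depth \<alpha> - Suc 0 < n" "?u < n" using reg st by auto
      show ?thesis
      proof (cases "ptr \<alpha> ?u < rk ?u (last \<alpha> ?u)")
        case False
        then show ?thesis
          using e d arr reg r by (simp add: simps) (simp add: rep_def upd)
      next
        case True
        then have s: "scan \<alpha> ?u \<le> n" using I d(1) e by (auto simp: in_range_def Let_def)
        obtain u b v where ubv: "stack \<alpha> (depth \<alpha> - Suc 0) = u" "pr u (scan \<alpha> u) = b" "last \<alpha> b = v"
          by blast
        have u: "u < n" "0 < scan \<alpha> u" "scan \<alpha> u \<le> n" "last \<alpha> u < n" "ptr \<alpha> u < rk u (last \<alpha> u)"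
          using d(4) s arr True by (simp_all add: ubv)
        have b: "b < n" using pr_less[OF u(1) _ u(3)] u(2) by (simp add: ubv)
        have v: "v < n" using arr(1)[OF b] by (simp add: ubv)
        have w: "Suc (scan \<alpha> u) mod 2 ^ w = Suc (scan \<alpha> u)" "Suc (depth \<alpha>) mod 2 ^ w = Suc (depth \<alpha>)"
          using word_Suc[of "scan \<alpha> u"] word_Suc[of "depth \<alpha>"] u reg by simp_all
        note facts = e d(1-3) u b v w
        show ?thesis
        proof (cases "rk b v < rk b u")
          case True
          show ?thesis
            using r by (simp add: simps ubv facts True) (simp add: rep_def upd u)
        next
          case near: False
          show ?thesis
          proof (cases "mark \<alpha> v = 0")
            case mark: True
            then have "depth \<alpha> < n"
              using I d(1) e u near ubv by (simp add: in_range_def Let_def)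
            with near mark show ?thesis
              using r by (simp add: simps ubv facts) (simp add: rep_def upd push_def v)
          next
            case False
            with near show ?thesis using r by (simp add: simps ubv facts) (simp add: rep_def)
          qed
        qed
      qed
    qed
  qed
qed


lemma row_eq_iff:
  "array_row j = array_row k \<longleftrightarrow> j = k" "rank_row a = rank_row b \<longleftrightarrow> a = b"
  "a < n \<Longrightarrow> rank_row a \<noteq> array_row k" "a < n \<Longrightarrow> array_row k \<noteq> rank_row a"
  by (auto simp: array_row_def rank_row_def)

section \<open>The proposals\<close>

definition crep :: "state \<Rightarrow> courtship \<Rightarrow> bool" where
  "crep s \<gamma> \<longleftrightarrow> prefs (snd s) \<and> ranks (snd s) \<and> fst s 0 = n \<and> fst s 1 = entered \<gamma> \<and>
     fst s 2 = free \<gamma> \<and> array (snd s) 2 (cptr \<gamma>) \<and> array (snd s) 3 (holder \<gamma>) \<and>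
     array (snd s) 4 (cscan \<gamma>) \<and> array (snd s) 6 (\<lambda>a. 0)"

lemma crep_step:
  assumes r: "crep (\<rho>, \<mu>) \<gamma>" and I: "courtship_inv \<gamma>" and lt: "entered \<gamma> < n"
  shows "crep (run w courtship_body (\<rho>, \<mu>)) (propose \<gamma>)"
proof -
  have read: "\<And>a i. a < n \<Longrightarrow> 0 < i \<Longrightarrow> i \<le> n \<Longrightarrow> \<mu> (cell a (i - Suc 0)) = pr a i"
    "\<And>a b. a < n \<Longrightarrow> b < n \<Longrightarrow> \<mu> (cell (rank_row a) b) = rk a b"
    "\<rho> 0 = n" "\<rho> (Suc 0) = entered \<gamma>" "\<rho> 2 = free \<gamma>"
    "\<And>a. a < n \<Longrightarrow> \<mu> (cell (array_row 2) a) = cptr \<gamma> a"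
    "\<And>a. a < n \<Longrightarrow> \<mu> (cell (array_row 3) a) = holder \<gamma> a"
    using r by (auto simp: crep_def prefs_def ranks_def array_def)
  obtain a b c where abc: "free \<gamma> = a" "pr a (cptr \<gamma> a) = b" "holder \<gamma> b = c" by blast
  note range = courtship_range[OF I lt, unfolded abc]
  have a: "a < n" "0 < cptr \<gamma> a" "cptr \<gamma> a \<le> n" "b < n" using range by simp_all
  have w: "Suc (entered \<gamma>) mod 2 ^ w = Suc (entered \<gamma>)" "Suc (cptr \<gamma> a) mod 2 ^ w = Suc (cptr \<gamma> a)"
    using word_Suc[of "entered \<gamma>"] word_Suc[of "cptr \<gamma> a"] lt a by simp_all
  note simps = courtship_body_def read abc a val_at w
  show ?thesis
  proof (cases "c = n")
    case True
    show ?thesis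
      using r by (simp add: simps True propose_def) (simp add: crep_def upd a)
  next
    case False
    then have c: "c < n" using range(5) by simp
    have wc: "Suc (cptr \<gamma> c) mod 2 ^ w = Suc (cptr \<gamma> c)"
      using word_Suc[of "cptr \<gamma> c"] range(6)[OF c] by simp
    show ?thesis
    proof (cases "rk b a < rk b c")
      case True
      show ?thesis
        using r by (simp add: simps False c wc True propose_def Let_def) (simp add: crep_def upd a c)
    next
      case near: False
      show ?thesis
        using r by (simp add: simps False c near propose_def Let_def) (simp add: crep_def upd a)
    qed
  qed
qed

lemma runs_courtship:
  assumes "crep s \<gamma>" "courtship_inv \<gamma>"
  shows "runs w (While (Less (Reg 1) (Reg 0)) courtship_body) s
    (courtship_potential \<gamma> * (duration courtship_body + 4) + 4)
    (\<lambda>s'. \<exists>\<gamma>. crep s' \<gamma> \<and> courtship_inv \<gamma> \<and> entered \<gamma> = n)"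
proof -
  have "runs w (While (Less (Reg 1) (Reg 0)) courtship_body) s
    (courtship_potential \<gamma> * (duration courtship_body + cost (Less (Reg 1) (Reg 0)) + 1) +
      cost (Less (Reg 1) (Reg 0)) + 1)
    (\<lambda>s'. (\<exists>\<gamma>. crep s' \<gamma> \<and> courtship_inv \<gamma>) \<and> val w s' (Less (Reg 1) (Reg 0)) = 0)"
  proof (rule runs_While[where R = "\<lambda>s \<gamma>. crep s \<gamma> \<and> courtship_inv \<gamma>"])
    show "loop_free courtship_body" by (simp add: courtship_body_def)
    fix s \<gamma> assume R: "crep s \<gamma> \<and> courtship_inv \<gamma>" and "val w s (Less (Reg 1) (Reg 0)) \<noteq> 0"
    then have lt: "entered \<gamma> < n" by (auto simp: crep_def split: if_splits)
    show "\<exists>\<delta>. (crep (run w courtship_body s) \<delta> \<and> courtship_inv \<delta>) \<and>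
        courtship_potential \<delta> < courtship_potential \<gamma>"
      using crep_step[of "fst s" "snd s" \<gamma>] courtship_step[of \<gamma>] R lt by auto
  qed (use assms in simp)
  moreover have "entered \<gamma> = n"
    if "crep s' \<gamma>" "courtship_inv \<gamma>" "val w s' (Less (Reg 1) (Reg 0)) = 0" for s' \<gamma>
    using that courtship_invD(1)[OF that(2)] by (simp add: crep_def split: if_splits)
  ultimately show ?thesis
    by (elim runs_weaken; (simp add: eval_nat_numeral; fail)?) blast
qed

text \<open>For \<open>n = 0\<close> the invariant fails, as it demands
  \<open>agent \<alpha> < n\<close>; the bound is then 0 and the loop is not entered.\<close>

lemma runs_search:
  assumes "rep s \<alpha>" "if n = 0 then bound \<alpha> = 0 else search_inv \<alpha>"
  shows "runs w (While (Reg 1) search_body) s (potential \<alpha> * (duration search_body + 2) + 2)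
    (\<lambda>s'. \<exists>\<alpha>. rep s' \<alpha> \<and> (n = 0 \<or> search_inv \<alpha>) \<and> bound \<alpha> = 0)"
proof -
  let ?J = "\<lambda>\<alpha>. if n = 0 then bound \<alpha> = 0 else search_inv \<alpha>"
  have "runs w (While (Reg 1) search_body) s
    (potential \<alpha> * (duration search_body + cost (Reg 1) + 1) + cost (Reg 1) + 1)
    (\<lambda>s'. (\<exists>\<alpha>. rep s' \<alpha> \<and> ?J \<alpha>) \<and> val w s' (Reg 1) = 0)"
  proof (rule runs_While[where R = "\<lambda>s \<alpha>. rep s \<alpha> \<and> ?J \<alpha>"])
    show "loop_free search_body" by (simp add: body_defs)
    fix s \<alpha> assume R: "rep s \<alpha> \<and> ?J \<alpha>" and "val w s (Reg 1) \<noteq> 0"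
    then have b: "0 < bound \<alpha>" by (simp add: rep_def)
    with R have J: "n \<noteq> 0" "search_inv \<alpha>" by (auto split: if_splits)
    show "\<exists>\<beta>. (rep (run w search_body s) \<beta> \<and> ?J \<beta>) \<and> potential \<beta> < potential \<alpha>"
      using rep_step[of "fst s" "snd s" \<alpha>] search_step[OF J(2) b] R J(1) by auto
  qed (use assms in simp)
  moreover have "bound \<alpha> = 0" if "rep s' \<alpha>" "val w s' (Reg 1) = 0" for s' \<alpha>
    using that by (simp add: rep_def)
  ultimately show ?thesis
    by (elim runs_weaken; (simp add: eval_nat_numeral; fail)?) metis
qed

section \<open>Tabulating the ranks\<close>

text \<open>In row \<open>a\<close> the ranks up to \<open>i\<close> are tabulated. The other arrays
  get their entry for \<open>a\<close> together with the first rank, hence \<open>0 < i\<close>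
  there.\<close>

definition ranked :: "state \<Rightarrow> nat \<times> nat \<Rightarrow> bool" where
  "ranked s = (\<lambda>(a, i). fst s 0 = n \<and> fst s 1 = a \<and> fst s 2 = i \<and> a \<le> n \<and> (a < n \<longrightarrow> i < n) \<and>
     (a = n \<longrightarrow> i = 0) \<and> prefs (snd s) \<and> array (snd s) 6 (\<lambda>a. 0) \<and>
     (\<forall>c<n. \<forall>b<n. c < a \<or> c = a \<and> rk c b \<le> i \<longrightarrow> snd s (cell (rank_row c) b) = rk c b) \<and>
     (\<forall>c<n. c < a \<or> c = a \<and> 0 < i \<longrightarrow>
        snd s (cell (array_row 2) c) = 1 \<and> snd s (cell (array_row 3) c) = n))"

lemma ranked_step:
  assumes R: "ranked (\<rho>, \<mu>) (a, i)" and lt: "a < n"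
  shows "ranked (run w rank_body (\<rho>, \<mu>)) (if i + 1 = n then (a + 1, 0) else (a, i + 1))"
proof -
  let ?b = "pr a (Suc i)"
  have reg: "\<rho> 0 = n" "\<rho> (Suc 0) = a" "\<rho> 2 = i" and i: "i < n" and p: "prefs \<mu>"
    and z: "array \<mu> 6 (\<lambda>a. 0)"
    and rr: "\<And>c b. c < n \<Longrightarrow> b < n \<Longrightarrow> c < a \<or> c = a \<and> rk c b \<le> i \<Longrightarrow> \<mu> (cell (rank_row c) b) = rk c b"
    and ra: "\<And>c. c < n \<Longrightarrow> c < a \<Longrightarrow> \<mu> (cell (array_row 2) c) = 1 \<and> \<mu> (cell (array_row 3) c) = n"
    using R lt by (auto simp: ranked_def)
  have b: "?b < n" "rk a ?b = Suc i" using i lt by (simp_all add: pr_less rk_pr)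
  have m: "\<mu> (cell a i) = ?b"
    using p lt i unfolding prefs_def by (metis Suc_leI diff_Suc_1' zero_less_Suc)
  have wi: "Suc i mod 2 ^ w = Suc i" "Suc a mod 2 ^ w = Suc a"
    using word_Suc[of i] word_Suc[of a] i lt by simp_all
  define \<nu> where "\<nu> = \<mu>(cell (rank_row a) ?b := Suc i, cell (array_row 2) a := 1, cell (array_row 3) a := n)"
  have run: "run w rank_body (\<rho>, \<mu>) =
      (if i + 1 = n then \<rho>(2 := 0, 1 := Suc a) else \<rho>(2 := Suc i), \<nu>)"
    using lt i b by (simp add: rank_body_def reg val_addr val_at m wi \<nu>_def)
  have 1: "prefs \<nu>" using p lt b by (simp add: prefs_upd_array prefs_upd_rank \<nu>_def)
  have 2: "array \<nu> 6 (\<lambda>a. 0)" using z lt b by (simp add: array_upd_other array_upd_rank \<nu>_def)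
  have 3: "\<nu> (cell (rank_row c) d) = rk c d"
    if "c < n" "d < n" "c < a \<or> c = a \<and> rk c d \<le> Suc i" for c d
  proof (cases "c = a \<and> d = ?b")
    case True
    then show ?thesis using b lt by (simp add: cell_eq_iff row_eq_iff \<nu>_def)
  next
    case False
    moreover have "rk a d \<noteq> Suc i" if "c = a" using False that b \<open>d < n\<close> lt by (metis rk_inject)
    ultimately show ?thesis
      using rr[OF that(1,2)] that b lt by (auto simp: cell_eq_iff row_eq_iff le_Suc_eq \<nu>_def)
  qed
  have 4: "\<nu> (cell (array_row 2) c) = 1 \<and> \<nu> (cell (array_row 3) c) = n"
    if "c < n" "c \<le> a" for c
    using ra[OF that(1)] that b lt by (auto simp: cell_eq_iff row_eq_iff \<nu>_def)
  show ?thesis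
  proof (cases "i + 1 = n")
    case True
    have "\<forall>c<n. \<forall>d<n. c < Suc a \<or> c = Suc a \<and> rk c d \<le> 0 \<longrightarrow> \<nu> (cell (rank_row c) d) = rk c d"
    proof (intro allI impI)
      fix c d assume cd: "c < n" "d < n" "c < Suc a \<or> c = Suc a \<and> rk c d \<le> 0"
      \<comment> \<open>With column 0 nothing is claimed about the new row, because no rank is
        0.\<close>
      then have "c \<le> a" using rk_ge_1[OF cd(1,2)] by auto
      then show "\<nu> (cell (rank_row c) d) = rk c d"
        using 3[OF cd(1,2)] rk_le_n[OF cd(1,2)] True by (auto simp: le_less)
    qed
    then show ?thesis
      unfolding run ranked_def using True reg lt 1 2 4 by (simp add: less_Suc_eq_le) blast
  next
    case False
    then show ?thesis
      unfolding run ranked_def using reg lt i 1 2 3 4 by auto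
  qed
qed

lemma runs_rank:
  assumes "ranked s (0, 0)"
  shows "runs w (While (Less (Reg 1) (Reg 0)) rank_body) s ((n * n + n) * (duration rank_body + 4) + 4)
    (\<lambda>s'. ranked s' (n, 0))"
proof -
  let ?\<phi> = "\<lambda>(a, i). n * (n - a) + (n - i)"
  have "runs w (While (Less (Reg 1) (Reg 0)) rank_body) s
    (?\<phi> (0, 0) * (duration rank_body + cost (Less (Reg 1) (Reg 0)) + 1) +
      cost (Less (Reg 1) (Reg 0)) + 1)
    (\<lambda>s'. (\<exists>x. ranked s' x) \<and> val w s' (Less (Reg 1) (Reg 0)) = 0)"
  proof (rule runs_While[where R = ranked and \<phi> = ?\<phi> and x = "(0, 0)"])
    show "loop_free rank_body" by (simp add: rank_body_def)
    show "ranked s (0, 0)" by (rule assms)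
    fix s x assume R: "ranked s x" and v: "val w s (Less (Reg 1) (Reg 0)) \<noteq> 0"
    obtain a i where x: "x = (a, i)" by fastforce
    have a: "a < n" "i < n" using R v by (auto simp: ranked_def x split: if_splits)
    have "n * (n - Suc a) + n = n * (n - a)" using a by (metis Suc_diff_Suc add.commute mult_Suc_right)
    then have "?\<phi> (if i + 1 = n then (a + 1, 0) else (a, i + 1)) < ?\<phi> x"
      using a by (auto simp: x)
    moreover have "ranked (run w rank_body s) (if i + 1 = n then (a + 1, 0) else (a, i + 1))"
      using ranked_step[of "fst s" "snd s" a i] R a(1) by (simp add: x)
    ultimately show "\<exists>y. ranked (run w rank_body s) y \<and> ?\<phi> y < ?\<phi> x" by blast
  qed
  moreover have "x = (n, 0)" if "ranked s' x" "val w s' (Less (Reg 1) (Reg 0)) = 0" for s' x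
    using that by (auto simp: ranked_def split: if_splits)
  ultimately show ?thesis
    by (elim runs_weaken; (simp add: eval_nat_numeral; fail)?) blast
qed

section \<open>The output\<close>

text \<open>The output overwrites the number of agents and the preference lists. All data about
  agent \<open>a\<close> lie in cells from \<open>a\<close> on, so they are intact when its turn
  comes, and \<open>n\<close> is kept in a register.\<close>

lemma runs_output:
  assumes r: "rep s \<alpha>" and I: "n = 0 \<or> search_inv \<alpha>" and zero: "bound \<alpha> = 0"
  shows "runs w (While (Less (Reg 1) (Reg 0)) output_body) s (n * (duration output_body + 4) + 4)
    (output_state n (succ_of \<alpha>))"
proof -
  obtain \<rho>0 \<mu>0 where s: "s = (\<rho>0, \<mu>0)" by fastforce
  note read = rep_read[OF r[unfolded s]]
  let ?R = "\<lambda>s a. fst s 0 = n \<and> fst s 1 = a \<and> a \<le> n \<and> (\<forall>j\<ge>a. snd s j = \<mu>0 j) \<and>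
    (\<forall>j<a. snd s j = succ_of \<alpha> j)"
  have "runs w (While (Less (Reg 1) (Reg 0)) output_body) s
    ((n - 0) * (duration output_body + cost (Less (Reg 1) (Reg 0)) + 1) +
      cost (Less (Reg 1) (Reg 0)) + 1)
    (\<lambda>s'. (\<exists>a. ?R s' a) \<and> val w s' (Less (Reg 1) (Reg 0)) = 0)"
  proof (rule runs_While[where R = ?R and \<phi> = "\<lambda>a. n - a" and x = 0])
    show "loop_free output_body" by (simp add: output_body_def)
    show "?R s 0" using r zero s by (simp add: rep_def)
    fix s' a assume R: "?R s' a" and v: "val w s' (Less (Reg 1) (Reg 0)) \<noteq> 0"
    obtain \<rho> \<mu> where s': "s' = (\<rho>, \<mu>)" by fastforce
    have reg: "\<rho> 0 = n" "\<rho> (Suc 0) = a" and a: "a < n" and \<mu>: "\<And>j. a \<le> j \<Longrightarrow> \<mu> j = \<mu>0 j"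
      using R v by (auto simp: s' split: if_splits)
    have "search_inv \<alpha>" using I a by simp
    note fin = search_done[OF this zero]
    have l: "last \<alpha> a < n" using marriageD(2)[OF tableD(1)[OF fin(1)] a] .
    have p: "0 < ptr \<alpha> a" "ptr \<alpha> a \<le> n" using fin(4)[OF a] by auto
    have low: "a \<le> cell (array_row k) a" "a \<le> cell (rank_row a) d" "a \<le> cell a (ptr \<alpha> a - Suc 0)" for k d
    proof -
      have "1 * a \<le> n * a" "1 * a \<le> n * (n + a)" using a by (intro mult_le_mono; simp)+
      then show "a \<le> cell (array_row k) a" "a \<le> cell (rank_row a) d" "a \<le> cell a (ptr \<alpha> a - Suc 0)"
        unfolding cell_def rank_row_def array_row_def by (simp_all only: distrib_left mult_1)
    qed
    have rd: "\<mu> (cell (array_row 2) a) = ptr \<alpha> a" "\<mu> (cell (array_row 3) a) = last \<alpha> a"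
      "\<mu> (cell (rank_row a) (last \<alpha> a)) = rk a (last \<alpha> a)"
      "\<mu> (cell a (ptr \<alpha> a - Suc 0)) = pr a (ptr \<alpha> a)"
      using read a l p low by (simp_all add: \<mu>)
    have wa: "Suc a mod 2 ^ w = Suc a" using word_Suc[of a] a by simp
    have "\<exists>\<rho>'. run w output_body (\<rho>, \<mu>) = (\<rho>', \<mu>(a := succ_of \<alpha> a)) \<and> \<rho>' 0 = n \<and> \<rho>' 1 = Suc a"
      using a l p by (simp add: output_body_def reg val_at rd wa succ_of_def first_def not_less)
    then show "\<exists>b. ?R (run w output_body s') b \<and> n - b < n - a"
      using R a by (intro exI[of _ "Suc a"]) (auto simp: s' less_Suc_eq)
  qed
  then show ?thesis
    by (rule runs_weaken) (auto simp: eval_nat_numeral output_state_def split: if_splits)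
qed

end

section \<open>The whole program and its running time\<close>

definition min_regret_prog :: prog where
  "min_regret_prog =
     Seq (Assign 0 (Load (Const 0)))
    (Seq (While (Less (Reg 1) (Reg 0)) rank_body)
    (Seq (Assign 1 (Const 0))
    (Seq (While (Less (Reg 1) (Reg 0)) courtship_body)
    (Seq (seq [Assign 1 (Reg 0), Assign 2 (Const 0), Assign 3 (Const 0), Assign 4 (Reg 0)])
    (Seq (While (Reg 1) search_body)
         (While (Less (Reg 1) (Reg 0)) output_body))))))"

definition step_cost :: nat where
  "step_cost = duration rank_body + duration courtship_body + duration search_body +
     duration output_body + 20"

text \<open>The loops run at most \<open>n * n + n\<close>, \<open>n + n * n\<close>,
  \<open>4 * n * n + 6 * n + 1\<close> and \<open>n\<close> times; the coefficients 7 and 10 round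
  up their sum. The summand 20 in \<open>step_cost\<close> pays for the loop tests, and 50 for the
  code outside the loops.\<close>

definition total_time :: "nat \<Rightarrow> nat" where
  "total_time n = (7 * n * n + 10 * n + 1) * step_cost + 50"

lemma total_time_bigo: "(\<lambda>n. real (total_time n)) \<in> O(\<lambda>n. real n ^ 2)"
proof (rule bigoI[where c = "real (18 * step_cost + 50)"])
  show "\<forall>\<^sub>F n in at_top. norm (real (total_time n)) \<le> real (18 * step_cost + 50) * norm (real n ^ 2)"
  proof (rule eventually_at_top_linorderI[of 1])
    fix n :: nat assume n: "1 \<le> n"
    then have "n \<le> n * n" "1 \<le> n * n" by simp_all
    then have "7 * n * n + 10 * n + 1 \<le> 18 * (n * n)" unfolding mult.assoc by linarith
    then have "(7 * n * n + 10 * n + 1) * step_cost \<le> 18 * (n * n) * step_cost" by (rule mult_le_mono1)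
    with \<open>1 \<le> n * n\<close> have "total_time n \<le> 18 * (n * n) * step_cost + 50 * (n * n)"
      unfolding total_time_def by linarith
    also have "\<dots> = (18 * step_cost + 50) * (n * n)" by (simp add: algebra_simps)
    finally have "total_time n \<le> (18 * step_cost + 50) * (n * n)" .
    then have "real (total_time n) \<le> real ((18 * step_cost + 50) * (n * n))" by (rule of_nat_mono)
    then show "norm (real (total_time n)) \<le> real (18 * step_cost + 50) * norm (real n ^ 2)"
      by (simp add: power2_eq_square)
  qed
qed

context word_ram begin

lemma input_ranked:
  assumes s: "fst s = (\<lambda>r. 0)" "snd s 0 = n" "\<And>i. n * n < i \<Longrightarrow> snd s i = 0"
    and p: "\<And>a x. a < n \<Longrightarrow> x < n \<Longrightarrow> snd s (n * a + rk a x) = x"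
  shows "ranked (run w (Assign 0 (Load (Const 0))) s) (0, 0)"
proof -
  have "prefs (snd s)"
    unfolding prefs_def
  proof (intro allI impI)
    fix a i assume ai: "a < n" "0 < i" "i \<le> n"
    then have "snd s (n * a + rk a (pr a i)) = pr a i" by (intro p) (simp_all add: pr_less)
    with ai show "snd s (cell a (i - Suc 0)) = pr a i" by (simp add: rk_pr cell_def)
  qed
  \<comment> \<open>The row of the marks lies beyond cell \<open>n * n\<close>, where the input is
    zero.\<close>
  moreover have "array (snd s) 6 (\<lambda>a. 0)"
    unfolding array_def by (auto simp: cell_def array_row_def algebra_simps intro!: s(3))
  moreover have "\<forall>c<n. \<forall>b<n. c = 0 \<longrightarrow> rk c b \<noteq> 0" using rk_ge_1 by fastforce
  ultimately show ?thesis using s(1,2) by (simp add: ranked_def) (metis less_irrefl)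
qed

lemma runs_min_regret_prog:
  assumes s: "fst s = (\<lambda>r. 0)" "snd s 0 = n" "\<And>i. n * n < i \<Longrightarrow> snd s i = 0"
    "\<And>a x. a < n \<Longrightarrow> x < n \<Longrightarrow> snd s (n * a + rk a x) = x"
  shows "runs w min_regret_prog s (total_time n)
    (\<lambda>s'. \<exists>\<alpha>. output_state n (succ_of \<alpha>) s' \<and> (n = 0 \<or> search_inv \<alpha>) \<and> bound \<alpha> = 0)"
proof -
  let ?lt = "Less (Reg 1) (Reg 0)" and ?Q = "\<lambda>s'. \<exists>\<alpha>. output_state n (succ_of \<alpha>) s' \<and> (n = 0 \<or> search_inv \<alpha>) \<and> bound \<alpha> = 0"
  let ?init = "seq [Assign 1 (Reg 0), Assign 2 (Const 0), Assign 3 (Const 0), Assign 4 (Reg 0)]"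
  let ?tr = "duration rank_body" and ?tc = "duration courtship_body"
    and ?ts = "duration search_body" and ?to = "duration output_body"
  have 1: "runs w (While ?lt output_body) s (n * (?to + 4) + 4) ?Q"
    if S: "\<exists>\<alpha>. rep s \<alpha> \<and> (n = 0 \<or> search_inv \<alpha>) \<and> bound \<alpha> = 0" for s
  proof -
    obtain \<alpha> where \<alpha>: "rep s \<alpha>" "n = 0 \<or> search_inv \<alpha>" "bound \<alpha> = 0" using S by blast
    show ?thesis
      by (rule runs_weaken[OF runs_output[OF \<alpha>] order_refl], rule exI[of _ \<alpha>]) (use \<alpha>(2,3) in simp)
  qed
  have 2: "runs w (Seq (While (Reg 1) search_body) (While ?lt output_body)) s
      ((4 * n * n + 6 * n + 1) * (?ts + 2) + 2 + (n * (?to + 4) + 4) + 1) ?Q"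
    if S: "\<exists>\<alpha>. rep s \<alpha> \<and> (if n = 0 then bound \<alpha> = 0 else search_inv \<alpha>) \<and>
      potential \<alpha> \<le> 4 * n * n + 6 * n + 1" for s
  proof -
    obtain \<alpha> where \<alpha>: "rep s \<alpha>" "if n = 0 then bound \<alpha> = 0 else search_inv \<alpha>"
      "potential \<alpha> \<le> 4 * n * n + 6 * n + 1" using S by blast
    have "potential \<alpha> * (?ts + 2) + 2 \<le> (4 * n * n + 6 * n + 1) * (?ts + 2) + 2"
      using \<alpha>(3) by (intro add_le_mono1 mult_le_mono1)
    from runs_Seq[OF runs_weaken[OF runs_search[OF \<alpha>(1,2)] this] 1] show ?thesis by simp
  qed
  have 3: "runs w ?init s (duration ?init) (\<lambda>s. \<exists>\<alpha>. rep s \<alpha> \<and>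
      (if n = 0 then bound \<alpha> = 0 else search_inv \<alpha>) \<and> potential \<alpha> \<le> 4 * n * n + 6 * n + 1)"
    if C: "\<exists>\<gamma>. crep s \<gamma> \<and> courtship_inv \<gamma> \<and> entered \<gamma> = n" for s
  proof (rule runs_loop_free)
    obtain \<gamma> where \<gamma>: "crep s \<gamma>" "courtship_inv \<gamma>" "entered \<gamma> = n" using C by blast
    \<comment> \<open>The stack row is taken as found: at depth 0 its content is arbitrary.\<close>
    define \<alpha> where "\<alpha> = \<lparr>ptr = cptr \<gamma>, last = holder \<gamma>, scan = cscan \<gamma>,
      stack = (\<lambda>i. snd s (cell (array_row 5) i)), mark = (\<lambda>a. 0), bound = n, agent = 0, depth = 0,
      target = n\<rparr>"
    have "rep (run w ?init s) \<alpha>"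
      using \<gamma>(1) by (simp add: \<alpha>_def rep_def crep_def array_def)
    moreover have "(if n = 0 then bound \<alpha> = 0 else search_inv \<alpha>) \<and> potential \<alpha> \<le> 4 * n * n + 6 * n + 1"
    proof (cases "n = 0")
      case True
      then show ?thesis unfolding potential_def \<alpha>_def by simp
    next
      case False
      then show ?thesis using courtship_done[OF \<gamma>(2,3), of \<alpha>] by (simp add: \<alpha>_def)
    qed
    ultimately show "\<exists>\<alpha>. rep (run w ?init s) \<alpha> \<and> (if n = 0 then bound \<alpha> = 0 else search_inv \<alpha>) \<and>
      potential \<alpha> \<le> 4 * n * n + 6 * n + 1" by blast
  qed simp
  have 4: "runs w (While ?lt courtship_body) s ((n + n * n) * (?tc + 4) + 4)
      (\<lambda>s'. \<exists>\<gamma>. crep s' \<gamma> \<and> courtship_inv \<gamma> \<and> entered \<gamma> = n)"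
    if C: "\<exists>\<gamma>. crep s \<gamma> \<and> courtship_inv \<gamma> \<and> courtship_potential \<gamma> \<le> n + n * n" for s
  proof -
    obtain \<gamma> where \<gamma>: "crep s \<gamma>" "courtship_inv \<gamma>" "courtship_potential \<gamma> \<le> n + n * n" using C by blast
    have "courtship_potential \<gamma> * (?tc + 4) + 4 \<le> (n + n * n) * (?tc + 4) + 4"
      using \<gamma>(3) by (intro add_le_mono1 mult_le_mono1)
    from runs_weaken[OF runs_courtship[OF \<gamma>(1,2)] this] show ?thesis by simp
  qed
  have 5: "runs w (Assign 1 (Const 0)) s 2
      (\<lambda>s. \<exists>\<gamma>. crep s \<gamma> \<and> courtship_inv \<gamma> \<and> courtship_potential \<gamma> \<le> n + n * n)"
    if R: "ranked s (n, 0)" for s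
  proof -
    \<comment> \<open>The scan row is taken as found too: the invariant constrains it only on
      engaged agents, and there are none yet.\<close>
    define \<gamma> where "\<gamma> = \<lparr>cptr = (\<lambda>a. 1), holder = (\<lambda>a. n),
      cscan = (\<lambda>a. snd s (cell (array_row 4) a)), entered = 0, free = 0\<rparr>"
    have "crep (run w (Assign 1 (Const 0)) s) \<gamma>"
      using R by (simp add: \<gamma>_def crep_def ranked_def array_def ranks_def)
    with courtship_start[of \<gamma>] show ?thesis
      by (intro runs_weaken[OF runs_loop_free[where Q = "\<lambda>s'. s' = run w (Assign 1 (Const 0)) s"]])
        (auto simp: \<gamma>_def)
  qed
  have 6: "runs w (Assign 0 (Load (Const 0))) s 3 (\<lambda>s'. ranked s' (0, 0))"
    by (rule runs_weaken[OF runs_loop_free[where Q = "\<lambda>s'. s' = run w (Assign 0 (Load (Const 0))) s"]])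
      (use input_ranked[OF s] in auto)
  have "runs w min_regret_prog s
    (3 + (((n * n + n) * (?tr + 4) + 4) + (2 + (((n + n * n) * (?tc + 4) + 4) + (duration ?init +
      ((4 * n * n + 6 * n + 1) * (?ts + 2) + 2 + (n * (?to + 4) + 4) + 1) + 1) + 1) + 1) + 1) + 1) ?Q"
    unfolding min_regret_prog_def
    by (rule runs_Seq[OF 6], rule runs_Seq[OF runs_rank], assumption, rule runs_Seq[OF 5], assumption,
        rule runs_Seq[OF 4], assumption, rule runs_Seq[OF 3], assumption, rule 2)
  then show ?thesis
    by (rule runs_weaken) (auto simp: total_time_def step_cost_def algebra_simps)
qed

end

lemma min_regret_empty: "min_regret_stable_partition {..<0::nat} P id"
  by (auto simp: min_regret_stable_partition_def is_arg_min_def stable_partition_def)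

lemma linear_time_min_regret: "linear_time_computable min_regret_stable_partition"
  unfolding linear_time_computable_def
proof (rule exI[of _ min_regret_prog], rule exI[of _ 6], rule exI[of _ total_time],
    intro conjI allI impI)
  show "(\<lambda>n. real (total_time n)) \<in> O(\<lambda>n. real n ^ 2)" by (rule total_time_bigo)
  fix n w :: nat and P s
  assume I: "sr_instance {..<n} P" and w: "(n + 2) ^ 6 \<le> 2 ^ w" and s: "input_state n P s"
  interpret preferences n "rank {..<n} P" by (rule sr_instance_preferences[OF I])
  interpret word_ram n "rank {..<n} P" w by unfold_locales (rule w)
  have "runs w min_regret_prog s (total_time n)
    (\<lambda>s'. \<exists>\<alpha>. output_state n (succ_of \<alpha>) s' \<and> (n = 0 \<or> search_inv \<alpha>) \<and> bound \<alpha> = 0)"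
    by (rule runs_min_regret_prog) (use s in \<open>auto simp: input_state_def\<close>)
  then obtain t s' \<alpha> where t: "exec w min_regret_prog s t s'" "t \<le> total_time n"
    "output_state n (succ_of \<alpha>) s'" "n = 0 \<or> search_inv \<alpha>" "bound \<alpha> = 0"
    unfolding runs_def by blast
  have "min_regret_stable_partition {..<n} P (succ_of \<alpha>)"
  proof (cases "n = 0")
    case True
    have "succ_of \<alpha> = id"
      by (rule ext, unfold succ_of_def) (use True in simp)
    then show ?thesis by (simp only: True min_regret_empty)
  next
    case False
    with t(4,5) show ?thesis using succ_of_min_regret[OF I] by simp
  qed
  with t show "\<exists>t s' \<pi>. exec w min_regret_prog s t s' \<and> t \<le> total_time n \<and> output_state n \<pi> s' \<and>
      min_regret_stable_partition {..<n} P \<pi>" by blast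
qed

section \<open>Existence, first on initial segments and then on arbitrary agent sets\<close>

lemma input_state_exists:
  fixes n :: nat
  assumes "sr_instance {..<n} P"
  shows "\<exists>s. input_state n P s"
proof -
  interpret preferences n "rank {..<n} P" by (rule sr_instance_preferences[OF assms])
  define m where "m i = (if i = 0 then n else if i \<le> n * n then pr ((i - 1) div n) ((i - 1) mod n + 1) else 0)"
    for i
  have "m (n * a + rank {..<n} P a x) = x" if "a < n" "x < n" for a x
  proof -
    let ?r = "rank {..<n} P a x"
    have "1 \<le> ?r" "?r \<le> n" using rk_ge_1[OF that] rk_le_n[OF that] .
    then obtain j where j: "?r = Suc j" "j < n" by (cases ?r) auto
    have "n * a + ?r \<le> n * Suc a" using j by simp
    also have "\<dots> \<le> n * n" using that(1) by (intro mult_le_mono2) simp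
    finally have "m (n * a + ?r) = pr a (Suc j)" using j by (simp add: m_def)
    then show ?thesis using pr_rk[OF that] j by simp
  qed
  then have "input_state n P (\<lambda>r. 0, m)" by (auto simp: input_state_def m_def)
  then show ?thesis by blast
qed

text \<open>Correctness of the program includes that it halts with a partition, so any run on an
  encoding of the instance proves existence.\<close>

lemma stable_partition_exists_nat:
  fixes n :: nat
  assumes I: "sr_instance {..<n} P"
  shows "\<exists>\<pi>. stable_partition {..<n} P \<pi>"
proof -
  obtain c k and T :: "nat \<Rightarrow> nat" where c: "\<And>n P w s. sr_instance {..<n} P \<Longrightarrow> (n + 2) ^ k \<le> 2 ^ w \<Longrightarrow>
      input_state n P s \<Longrightarrow> \<exists>t s' \<pi>. exec w c s t s' \<and> t \<le> T n \<and> output_state n \<pi> s' \<and>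
        min_regret_stable_partition {..<n} P \<pi>"
    using linear_time_min_regret unfolding linear_time_computable_def by blast
  obtain s where "input_state n P s" using input_state_exists[OF I] by blast
  \<comment> \<open>The word length is chosen as \<open>(n + 2) ^ k\<close> itself, which is below
    its own power of two.\<close>
  from c[OF I less_imp_le[OF less_exp] this] show ?thesis
    by (auto simp: min_regret_stable_partition_def is_arg_min_def)
qed

lemma stable_partition_exists:
  assumes I: "sr_instance A P"
  shows "\<exists>\<pi>. stable_partition A P \<pi>"
proof -
  have fin: "finite A" using I by (simp add: sr_instance_def)
  define n where "n = card A"
  obtain h where h: "bij_betw h {..<n} A"
    using ex_bij_betw_nat_finite[OF fin] by (auto simp: n_def atLeast0LessThan)
  define g where "g = inv_into {..<n} h"
  have hA: "h i \<in> A" if "i < n" for i using h that by (auto simp: bij_betw_def)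
  have gn: "g x < n" "h (g x) = x" if "x \<in> A" for x
    using bij_betw_inv_into[OF h] bij_betw_inv_into_right[OF h that] that
    by (auto simp: g_def bij_betw_def)
  have gh: "g (h i) = i" if "i < n" for i
    using bij_betw_inv_into_left[OF h, of i] that by (simp add: g_def)
  define P' where "P' a = {(x, y). x < n \<and> y < n \<and> (h x, h y) \<in> P (h a)}" for a
  have "sr_instance {..<n} P'"
    unfolding sr_instance_def
  proof (intro conjI ballI)
    show "finite {..<n}" "even (card {..<n})" using I by (simp_all add: sr_instance_def n_def)
    fix a assume "a \<in> {..<n}"
    then have a: "a < n" by simp
    have lin: "trans (P (h a))" "irrefl (P (h a))" "total_on A (P (h a))"
      and worst: "\<And>x. x \<in> A - {h a} \<Longrightarrow> (x, h a) \<in> P (h a)"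
      using I hA[OF a] by (auto simp: sr_instance_def strict_linear_order_on_def)
    show "P' a \<subseteq> {..<n} \<times> {..<n}" by (auto simp: P'_def)
    show "strict_linear_order_on {..<n} (P' a)"
      unfolding strict_linear_order_on_def
    proof (intro conjI)
      show "trans (P' a)" using lin(1) unfolding trans_def P'_def by blast
      show "irrefl (P' a)" using lin(2) by (auto simp: irrefl_def P'_def)
      show "total_on {..<n} (P' a)"
        using lin(3) hA gh unfolding total_on_def P'_def by (auto simp: ) metis
    qed
    show "(x, a) \<in> P' a" if "x \<in> {..<n} - {a}" for x
    proof -
      have "h x \<noteq> h a" using that a gh by (metis DiffE lessThan_iff singletonI)
      with that a hA worst[of "h x"] show ?thesis by (simp add: P'_def)
    qed
  qed
  then obtain \<sigma> where \<sigma>: "stable_partition {..<n} P' \<sigma>" using stable_partition_exists_nat by blast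
  have p: "\<sigma> permutes {..<n}"
    and t1: "\<And>a. a < n \<Longrightarrow> \<sigma> a = inv \<sigma> a \<or> (\<sigma> a, inv \<sigma> a) \<in> P' a"
    and t2: "\<And>a b. a < n \<Longrightarrow> b < n \<Longrightarrow> a \<noteq> b \<Longrightarrow> (b, inv \<sigma> a) \<in> P' a \<Longrightarrow> (a, inv \<sigma> b) \<notin> P' b"
    using \<sigma> unfolding stable_partition_def by auto
  have in_n: "\<sigma> a < n" "inv \<sigma> a < n" if "a < n" for a
    using that permutes_in_image[OF p] permutes_in_image[OF permutes_inv[OF p]] by auto
  define \<pi> where "\<pi> x = (if x \<in> A then h (\<sigma> (g x)) else x)" for x
  define \<rho> where "\<rho> x = (if x \<in> A then h (inv \<sigma> (g x)) else x)" for x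
  have 1: "\<pi> (\<rho> x) = x" "\<rho> (\<pi> x) = x" for x
    using permutes_inverses[OF p] in_n gn gh hA by (auto simp: \<pi>_def \<rho>_def)
  have "\<exists>!x. \<pi> x = y" for y by (metis 1)
  then have "\<pi> permutes A" by (simp add: permutes_def \<pi>_def)
  moreover have inv: "inv \<pi> = \<rho>" by (rule inv_equality) (simp_all add: 1)
  moreover have "\<pi> a = \<rho> a \<or> (\<pi> a, \<rho> a) \<in> P a" if "a \<in> A" for a
    using t1[OF gn(1)[OF that]] gn[OF that] that by (auto simp: \<pi>_def \<rho>_def P'_def)
  moreover have "\<not> ((b, \<rho> a) \<in> P a \<and> (a, \<rho> b) \<in> P b)" if "a \<in> A" "b \<in> A" "a \<noteq> b" for a b
  proof -
    have "g a \<noteq> g b" using that gn by metis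
    then have "(g b, inv \<sigma> (g a)) \<notin> P' (g a) \<or> (g a, inv \<sigma> (g b)) \<notin> P' (g b)"
      using t2[OF gn(1)[OF that(1)] gn(1)[OF that(2)]] by blast
    then show ?thesis using gn that in_n by (auto simp: P'_def \<rho>_def)
  qed
  ultimately have "stable_partition A P \<pi>" unfolding stable_partition_def inv by blast
  then show ?thesis by blast
qed

lemma min_regret_exists:
  assumes "sr_instance A P"
  shows "\<exists>\<pi>. min_regret_stable_partition A P \<pi>"
proof -
  obtain \<sigma> where \<sigma>: "stable_partition A P \<sigma>" using stable_partition_exists[OF assms] by blast
  obtain \<pi> where "stable_partition A P \<pi>"
    "\<And>\<tau>. stable_partition A P \<tau> \<Longrightarrow> regret A P \<pi> \<le> regret A P \<tau>"
    using ex_has_least_nat[of "stable_partition A P" \<sigma> "regret A P"] \<sigma> by blast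
  then show ?thesis
    by (auto simp: min_regret_stable_partition_def is_arg_min_def not_less)
qed

theorem theorem39:
  shows "(\<forall>(A :: 'a set) P. sr_instance A P \<longrightarrow> (\<exists>\<pi>. min_regret_stable_partition A P \<pi>)) \<and>
         linear_time_computable min_regret_stable_partition"
  using min_regret_exists linear_time_min_regret by blast

end
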